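(* Let $A$ be a commutative ring containing $\mathbb{Q}$, let $G$ be a group, and let $t:G\to A$ be a pseudocharacter of $G$ of degree $n$ with coefficients in $A$. Then there exist a commutative $A$-algebra $B$ and a representation $\rho:G\to GL_n(B)$, extended $A$-linearly to an algebra homomorphism $\rho:A[G]\to M_n(B)$, such that $$t(g)=\mathrm{tr}(\rho(g))\quad\text{for all } g\in G,\qquad \ker\bigl(\rho:A[G]\to M_n(B)\bigr)=K_t .$$
   Context: For a permutation $\sigma\in S_m$ with cycle decomposition $\sigma=(i_1 i_2\dots i_h)\cdots(s_1 s_2\dots s_r)$ (fixed points included as cycles of length one) and $g_1,\dots,g_m\in G$ put $T_\sigma(g_1,\dots,g_m):=t(g_{i_1}g_{i_2}\cdots g_{i_h})\cdots t(g_{s_1}g_{s_2}\cdots g_{s_r})$ (one factor for each cycle), and $T_m(g_1,\dots,g_m):=\sum_{\sigma\in S_m}\epsilon_\sigma T_\sigma(g_1,\dots,g_m)$, where $\epsilon_\sigma$ is the sign of $\sigma$. A pseudocharacter of a group $G$ of degree $n$ with coefficients in a commutative ring $A$ is a map $t:G\to A$ such that: (1) $t(1)=n$; (2) $t(ab)=t(ba)$ for all $a,b\in G$; (3) $T_{n+1}(g_1,\dots,g_{n+1})=0$ for all $g_i\in G$. Extend $t$ to an $A$-linear map $t:A[G]\to A$ on the group algebra. The kernel of the associated trace form is $K_t:=\{a\in A[G]\mid t(ab)=0\ \ \forall b\in A[G]\}$. The equality $t(g)=\mathrm{tr}(\rho(g))$ is understood in $B$, via the structure map $A\to B$. *)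

theory Defs
  imports
    "HOL-Algebra.Algebra"
    "HOL-Combinatorics.Combinatorics"
begin

definition rat_ring :: "rat ring" where
  "rat_ring = \<lparr>carrier = UNIV, monoid.mult = (*), monoid.one = 1, ring.zero = 0, ring.add = (+)\<rparr>"

definition contains_rat :: "('a, 'm) ring_scheme \<Rightarrow> bool" where
  "contains_rat A \<longleftrightarrow> (\<exists>\<phi>. \<phi> \<in> ring_hom rat_ring A \<and> inj \<phi>)"

definition list_mult :: "('g, 'k) monoid_scheme \<Rightarrow> 'g list \<Rightarrow> 'g" where
  "list_mult G xs = foldr (\<otimes>\<^bsub>G\<^esub>) xs \<one>\<^bsub>G\<^esub>"

text \<open>
  The indices are \<open>0, \<dots>, m - 1\<close>. A cycle of \<open>\<sigma>\<close> is given by its underlying set \<open>C\<close>, an orbit of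
  \<open>\<sigma>\<close>, and is written starting from its least element: \<open>Cycles.support \<sigma> i\<close> is the list
  \<open>[i, \<sigma> i, \<sigma> (\<sigma> i), \<dots>]\<close> of the distinct iterates. For a map \<open>t\<close> with \<open>t (a b) = t (b a)\<close> the
  starting point is irrelevant.
\<close>

definition T_perm ::
  "('a, 'm) ring_scheme \<Rightarrow> ('g, 'k) monoid_scheme \<Rightarrow> ('g \<Rightarrow> 'a) \<Rightarrow> nat \<Rightarrow> (nat \<Rightarrow> nat) \<Rightarrow> (nat \<Rightarrow> 'g) \<Rightarrow> 'a"
where
  "T_perm A G t m \<sigma> g =
     (\<Otimes>\<^bsub>A\<^esub>C \<in> orbit \<sigma> ` {..<m}. t (list_mult G (map g (Cycles.support \<sigma> (Min C)))))"

definition T_alt ::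
  "('a, 'm) ring_scheme \<Rightarrow> ('g, 'k) monoid_scheme \<Rightarrow> ('g \<Rightarrow> 'a) \<Rightarrow> nat \<Rightarrow> (nat \<Rightarrow> 'g) \<Rightarrow> 'a"
where
  "T_alt A G t m g =
     (\<Oplus>\<^bsub>A\<^esub>\<sigma> \<in> {\<sigma>. \<sigma> permutes {..<m}}. [sign \<sigma>] \<cdot>\<^bsub>A\<^esub> T_perm A G t m \<sigma> g)"

definition pseudocharacter ::
  "('a, 'm) ring_scheme \<Rightarrow> ('g, 'k) monoid_scheme \<Rightarrow> nat \<Rightarrow> ('g \<Rightarrow> 'a) \<Rightarrow> bool"
where
  "pseudocharacter A G n t \<longleftrightarrow>
     t \<in> carrier G \<rightarrow> carrier A \<and>
     t \<one>\<^bsub>G\<^esub> = [n] \<cdot>\<^bsub>A\<^esub> \<one>\<^bsub>A\<^esub> \<and>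
     (\<forall>a\<in>carrier G. \<forall>b\<in>carrier G. t (a \<otimes>\<^bsub>G\<^esub> b) = t (b \<otimes>\<^bsub>G\<^esub> a)) \<and>
     (\<forall>g \<in> {..<n + 1} \<rightarrow> carrier G. T_alt A G t (n + 1) g = \<zero>\<^bsub>A\<^esub>)"

text \<open>
  An element \<open>\<Sum>\<^sub>x f(x) x\<close> of \<open>A[G]\<close> is the finitely supported coefficient function \<open>f\<close>, set to
  zero outside the carrier of \<open>G\<close>.
\<close>

definition coeff_support :: "('a, 'm) ring_scheme \<Rightarrow> ('g \<Rightarrow> 'a) \<Rightarrow> 'g set" where
  "coeff_support A f = {x. f x \<noteq> \<zero>\<^bsub>A\<^esub>}"

definition group_algebra ::
  "('a, 'm) ring_scheme \<Rightarrow> ('g, 'k) monoid_scheme \<Rightarrow> ('a, 'g \<Rightarrow> 'a) module"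
where
  "group_algebra A G =
     \<lparr>carrier = {f. range f \<subseteq> carrier A \<and> coeff_support A f \<subseteq> carrier G \<and> finite (coeff_support A f)},
      monoid.mult = (\<lambda>f h x. if x \<in> carrier G
                then \<Oplus>\<^bsub>A\<^esub>y \<in> coeff_support A f. f y \<otimes>\<^bsub>A\<^esub> h (inv\<^bsub>G\<^esub> y \<otimes>\<^bsub>G\<^esub> x)
                else \<zero>\<^bsub>A\<^esub>),
      monoid.one = (\<lambda>x. if x = \<one>\<^bsub>G\<^esub> then \<one>\<^bsub>A\<^esub> else \<zero>\<^bsub>A\<^esub>),
      ring.zero = (\<lambda>x. \<zero>\<^bsub>A\<^esub>),
      ring.add = (\<lambda>f h x. f x \<oplus>\<^bsub>A\<^esub> h x),
      smult = (\<lambda>a f x. a \<otimes>\<^bsub>A\<^esub> f x)\<rparr>"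

definition regular_module :: "('a, 'm) ring_scheme \<Rightarrow> ('a, 'a) module" where
  "regular_module A =
     \<lparr>carrier = carrier A, monoid.mult = (\<otimes>\<^bsub>A\<^esub>), monoid.one = \<one>\<^bsub>A\<^esub>,
      ring.zero = \<zero>\<^bsub>A\<^esub>, ring.add = (\<oplus>\<^bsub>A\<^esub>), smult = (\<otimes>\<^bsub>A\<^esub>)\<rparr>"

definition linear_extension ::
  "('a, 'm) ring_scheme \<Rightarrow> ('a, 'c, 'k) module_scheme \<Rightarrow> ('g \<Rightarrow> 'c) \<Rightarrow> ('g \<Rightarrow> 'a) \<Rightarrow> 'c"
where
  "linear_extension A N h f = (\<Oplus>\<^bsub>N\<^esub>x \<in> coeff_support A f. f x \<odot>\<^bsub>N\<^esub> h x)"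

definition trace_form_kernel ::
  "('a, 'm) ring_scheme \<Rightarrow> ('g, 'k) monoid_scheme \<Rightarrow> ('g \<Rightarrow> 'a) \<Rightarrow> ('g \<Rightarrow> 'a) set"
where
  "trace_form_kernel A G t =
     {f \<in> carrier (group_algebra A G).
        \<forall>h \<in> carrier (group_algebra A G).
          linear_extension A (regular_module A) t (f \<otimes>\<^bsub>group_algebra A G\<^esub> h) = \<zero>\<^bsub>A\<^esub>}"

text \<open>
  \<open>n \<times> n\<close> matrices over an \<open>A\<close>-algebra \<open>B\<close>, as an \<open>A\<close>-algebra: functions on the index pairs
  \<open>{..<n} \<times> {..<n}\<close>, \<open>undefined\<close> elsewhere so that equality of matrices is equality of entries.
\<close>

definition mat_algebra :: "nat \<Rightarrow> ('a, 'b, 'm) module_scheme \<Rightarrow> ('a, nat \<times> nat \<Rightarrow> 'b) module" where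
  "mat_algebra n B =
     \<lparr>carrier = {..<n} \<times> {..<n} \<rightarrow>\<^sub>E carrier B,
      monoid.mult = (\<lambda>M N. \<lambda>(i, j) \<in> {..<n} \<times> {..<n}. \<Oplus>\<^bsub>B\<^esub>k \<in> {..<n}. M (i, k) \<otimes>\<^bsub>B\<^esub> N (k, j)),
      monoid.one = (\<lambda>(i, j) \<in> {..<n} \<times> {..<n}. if i = j then \<one>\<^bsub>B\<^esub> else \<zero>\<^bsub>B\<^esub>),
      ring.zero = (\<lambda>(i, j) \<in> {..<n} \<times> {..<n}. \<zero>\<^bsub>B\<^esub>),
      ring.add = (\<lambda>M N. \<lambda>(i, j) \<in> {..<n} \<times> {..<n}. M (i, j) \<oplus>\<^bsub>B\<^esub> N (i, j)),
      smult = (\<lambda>a M. \<lambda>(i, j) \<in> {..<n} \<times> {..<n}. a \<odot>\<^bsub>B\<^esub> M (i, j))\<rparr>"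

definition GL :: "nat \<Rightarrow> ('a, 'b, 'm) module_scheme \<Rightarrow> (nat \<times> nat \<Rightarrow> 'b) monoid" where
  "GL n B = units_of (mat_algebra n B)"

definition mat_trace :: "nat \<Rightarrow> ('b, 'm) ring_scheme \<Rightarrow> (nat \<times> nat \<Rightarrow> 'b) \<Rightarrow> 'b" where
  "mat_trace n B M = (\<Oplus>\<^bsub>B\<^esub>i \<in> {..<n}. M (i, i))"

definition structure_map :: "('a, 'b, 'm) module_scheme \<Rightarrow> 'a \<Rightarrow> 'b" where
  "structure_map B a = a \<odot>\<^bsub>B\<^esub> \<one>\<^bsub>B\<^esub>"

definition algebra_hom ::
  "('a, 'm) ring_scheme \<Rightarrow> ('a, 'c, 'k) module_scheme \<Rightarrow> ('a, 'd, 'l) module_scheme \<Rightarrow> ('c \<Rightarrow> 'd) set"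
where
  "algebra_hom A M N =
     {h \<in> ring_hom M N. \<forall>a\<in>carrier A. \<forall>x\<in>carrier M. h (a \<odot>\<^bsub>M\<^esub> x) = a \<odot>\<^bsub>N\<^esub> h x}"

text \<open>
  An existential statement cannot range over types, so the algebras \<open>B\<close> asserted to exist have to
  live on a fixed type. This one contains every quotient of the polynomial ring over \<open>A\<close> in the
  variables \<open>x\<^sub>g\<^sub>,\<^sub>i\<^sub>,\<^sub>j\<close>: an element is a coset of polynomials, and a polynomial is a coefficient
  function on monomials, i.e. on multisets of variables. In particular it contains a copy of every
  \<open>A\<close>-algebra generated by the matrix entries of a representation of \<open>G\<close>.
\<close>

type_synonym ('a, 'g) poly_quot = "(('g \<times> nat \<times> nat) multiset \<Rightarrow> 'a) set"

end

(*
  Write x_{g,i,j} for the entries of generic n x n matrices, one for each g in G. If t came from a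
  representation over a field of characteristic zero, averaging a polynomial in the x_{g,i,j} over
  simultaneous conjugation by GL_n would give an invariant, hence a polynomial in traces of words.
  By Weingarten calculus the average of a monomial of degree m is a rational combination of the
  T_s, s in S_m, whose coefficients express the orthogonal projection of a matrix unit of
  (Q^n)^{(x) m} to the span of the permutations. This formula makes sense for every
  pseudocharacter: the coefficients are unique up to combinations that vanish on (Q^n)^{(x) m}, and
  by the second fundamental theorem these are killed because T_{n+1} = 0. The result is an
  A-linear functional Phi on A[x_{g,i,j}] with Phi(1) = 1. Let B be the quotient by the largest
  ideal in the kernel of Phi. The relations making g -> (x_{g,i,j}) a representation with trace t
  hold in B, since averaging respects them. Elements of K_t act by zero because the T_s see each
  word only through traces t(w v). Conversely A embeds in B since Phi(1) = 1, so an element a with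
  rho(a) = 0 has t(a b) = tr(rho(a) rho(b)) = 0 for all b.

  Identities in A are computed in the polynomial ring over Q with one variable for each element of
  A, modulo the kernel N of the evaluation map, which makes type-class algebra available.
*)
theory Submission
  imports Defs "HOL-Library.Poly_Mapping"
begin

section \<open>Cycle products\<close>

text \<open>For m > n the permutations in S_m are linearly dependent on (Q^n)^{(x) m}, so their Gram
  matrix is singular and has no inverse to serve as Weingarten function. Coefficients are therefore
  only required to have the right inner products with all permutations. Positivity over Q provides
  such coefficients and shows that two choices act alike on tensors; the second fundamental theorem
  then makes their difference vanish in A.

  Every rule for the average becomes an identity of inner products. Contracting an index is a
  partial trace: it deletes a point k from a permutation and gives a factor n if k was fixed, 1
  otherwise. In the product over cycles, deleting k splits off the trace of its word if k was fixed
  and otherwise joins that word to the next one. The two recursions run in parallel, and t(1) = n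
  reconciles them for a slot holding the identity.

  Slots carry words instead of group elements because words multiply freely: the product and unit
  rules hold before the group law is used, which enters afterwards through t seeing only the product
  of a word.\<close>

definition is_cycle :: "('a \<Rightarrow> 'a) \<Rightarrow> 'a list \<Rightarrow> bool" where
  "is_cycle s xs \<longleftrightarrow> xs \<noteq> [] \<and> distinct xs \<and> map s xs = rotate1 xs"

lemma is_cycle_rotate1: "is_cycle s xs \<Longrightarrow> is_cycle s (rotate1 xs)"
  unfolding is_cycle_def by (metis distinct1_rotate rotate1_is_Nil_conv rotate1_map)

lemma is_cycle_rotate: "is_cycle s xs \<Longrightarrow> is_cycle s (rotate k xs)"
  by (induction k) (auto simp: is_cycle_rotate1)

lemma is_cycle_funpow:
  assumes "is_cycle s xs"
  shows "(s ^^ i) (hd xs) = xs ! (i mod length xs)"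
proof (induction i)
  case 0
  then show ?case using assms by (simp add: is_cycle_def hd_conv_nth)
next
  case (Suc i)
  have *: "i mod length xs < length xs" using assms by (simp add: is_cycle_def)
  have "s (xs ! (i mod length xs)) = rotate1 xs ! (i mod length xs)"
    using assms * by (metis is_cycle_def nth_map)
  also have "\<dots> = xs ! (Suc i mod length xs)"
    using * by (simp add: nth_rotate1 mod_Suc_eq)
  finally show ?case using Suc by simp
qed

text \<open>Distinctness of the list forces the first return to \<open>hd xs\<close> to happen after
  exactly \<open>length xs\<close> steps.\<close>

lemma is_cycle_support_hd:
  assumes "is_cycle s xs"
  shows "Cycles.support s (hd xs) = xs"
proof -
  let ?m = "length xs"
  have m: "?m > 0" and d: "distinct xs" using assms by (auto simp: is_cycle_def)
  have h: "hd xs = xs ! 0" using m by (simp add: hd_conv_nth)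
  have "least_power s (hd xs) = ?m"
    unfolding least_power_def
  proof (rule Least_equality)
    show "(s ^^ ?m) (hd xs) = hd xs \<and> 0 < ?m"
      using is_cycle_funpow[OF assms, of ?m] m h by simp
  next
    fix y assume y: "(s ^^ y) (hd xs) = hd xs \<and> 0 < y"
    show "?m \<le> y"
    proof (rule ccontr)
      assume "\<not> ?m \<le> y"
      then have "y < ?m" by simp
      then have "xs ! y = xs ! 0"
        using is_cycle_funpow[OF assms, of y] y h by simp
      then show False using d m \<open>y < ?m\<close> y by (simp add: nth_eq_iff_index_eq)
    qed
  qed
  then show ?thesis
    by (auto intro!: nth_equalityI simp: is_cycle_funpow[OF assms])
qed

text \<open>Starting a cycle elsewhere only rotates its list. This is what later allows the least
  element, the start fixed in \<open>cycle_prod\<close>, to be replaced by any convenient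
  point.\<close>

lemma is_cycle_support:
  assumes "is_cycle s xs" "x \<in> set xs"
  shows "\<exists>k. Cycles.support s x = rotate k xs"
proof -
  obtain k where k: "k < length xs" "x = xs ! k" using assms(2) by (auto simp: in_set_conv_nth)
  then have "x = hd (rotate k xs)" by (metis hd_rotate_conv_nth length_0_conv less_nat_zero_code mod_less)
  then show ?thesis using is_cycle_support_hd[OF is_cycle_rotate[OF assms(1), of k]] by metis
qed

lemma is_cycle_orbit:
  assumes "is_cycle s xs" "x \<in> set xs"
  shows "orbit s x = set xs"
proof -
  obtain k where k: "k < length xs" "x = xs ! k" using assms(2) by (auto simp: in_set_conv_nth)
  define ys where "ys = rotate k xs"
  have ys: "is_cycle s ys" and sy: "set ys = set xs"
    using is_cycle_rotate[OF assms(1)] by (auto simp: ys_def)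
  have x: "x = hd ys" using k unfolding ys_def
    by (metis hd_rotate_conv_nth length_0_conv less_nat_zero_code mod_less)
  have ne: "length ys > 0" using ys by (simp add: is_cycle_def)
  have "orbit s x = {ys ! (i mod length ys) | i. 0 < i}"
    unfolding orbit_altdef x is_cycle_funpow[OF ys] by simp
  also have "\<dots> = set ys"
  proof
    show "{ys ! (i mod length ys) | i. 0 < i} \<subseteq> set ys" using ne by auto
    show "set ys \<subseteq> {ys ! (i mod length ys) | i. 0 < i}"
    proof
      fix y assume "y \<in> set ys"
      then obtain i where i: "i < length ys" "y = ys ! i" by (auto simp: in_set_conv_nth)
      then have "y = ys ! ((i + length ys) mod length ys)" "0 < i + length ys" using ne by auto
      then show "y \<in> {ys ! (i mod length ys) | i. 0 < i}" by blast
    qed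
  qed
  finally show ?thesis using sy by simp
qed

lemma permutes_is_cycle:
  assumes "s permutes D" "finite D"
  shows "is_cycle s (Cycles.support s x)" and "hd (Cycles.support s x) = x"
proof -
  have p: "permutation s" using assms permutation_permutes by blast
  have l: "least_power s x > 0" "(s ^^ least_power s x) x = x"
    using least_power_of_permutation[OF p] by auto
  show "is_cycle s (Cycles.support s x)"
    unfolding is_cycle_def
  proof (intro conjI)
    show "Cycles.support s x \<noteq> []" using l by simp
    show "distinct (Cycles.support s x)" by (rule cycle_of_permutation[OF p])
    show "map s (Cycles.support s x) = rotate1 (Cycles.support s x)"
    proof (rule nth_equalityI)
      fix i assume "i < length (map s (Cycles.support s x))"
      then have i: "i < least_power s x" by simp
      show "map s (Cycles.support s x) ! i = rotate1 (Cycles.support s x) ! i"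
      proof (cases "Suc i = least_power s x")
        case True
        have "s ((s ^^ i) x) = (s ^^ Suc i) x" by simp
        also have "\<dots> = x" using l True by simp
        finally show ?thesis using i True by (simp add: nth_rotate1)
      next
        case False
        then show ?thesis using i by (simp add: nth_rotate1)
      qed
    qed simp
  qed
  show "hd (Cycles.support s x) = x" using l by (simp add: hd_map)
qed

lemma is_cycle_subset:
  assumes "s permutes D" "is_cycle s xs" "hd xs \<in> D"
  shows "set xs \<subseteq> D"
proof
  fix x assume "x \<in> set xs"
  then obtain i where "i < length xs" "x = xs ! i" by (auto simp: in_set_conv_nth)
  then have "x = (s ^^ i) (hd xs)" using is_cycle_funpow[OF assms(2), of i] by simp
  moreover have "(s ^^ i) (hd xs) \<in> D"
    by (induction i) (use assms in \<open>auto simp: permutes_in_image\<close>)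
  ultimately show "x \<in> D" by simp
qed

text \<open>The paper's \<open>T\<^sub>\<sigma>\<close>, with words in place of group elements and an arbitrary index set \<open>D\<close>.\<close>

definition cycle_prod ::
  "('g list \<Rightarrow> 'r::comm_monoid_mult) \<Rightarrow> nat set \<Rightarrow> (nat \<Rightarrow> nat) \<Rightarrow> (nat \<Rightarrow> 'g list) \<Rightarrow> 'r" where
  "cycle_prod \<tau> D s w = (\<Prod>C\<in>orbit s ` D. \<tau> (concat (map w (Cycles.support s (Min C)))))"

text \<open>The functions are compared on \<open>D\<close> only and need not be permutations of it,
  so that a permutation can be exchanged for its restriction to an invariant subset.\<close>

lemma cycle_prod_cong:
  assumes "finite D" "\<And>x. x \<in> D \<Longrightarrow> s x = s' x" "\<And>x. x \<in> D \<Longrightarrow> s x \<in> D"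
    "\<And>x. x \<in> D \<Longrightarrow> w x = w' x"
  shows "cycle_prod \<tau> D s w = cycle_prod \<tau> D s' w'"
proof -
  have fp: "(s ^^ i) x = (s' ^^ i) x \<and> (s ^^ i) x \<in> D" if "x \<in> D" for x i
    by (induction i) (use that assms in auto)
  have o: "orbit s x = orbit s' x" "orbit s x \<subseteq> D" if "x \<in> D" for x
  proof -
    show "orbit s x = orbit s' x" using fp[OF that] by (simp add: orbit_altdef)
    show "orbit s x \<subseteq> D" unfolding orbit_altdef using fp[OF that] by blast
  qed
  have l: "least_power s x = least_power s' x" if "x \<in> D" for x
    using fp[OF that] by (simp add: least_power_def)
  have w: "map w (Cycles.support s x) = map w' (Cycles.support s' x)" if "x \<in> D" for x
  proof -
    have "w ((s ^^ i) x) = w' ((s' ^^ i) x)" for i using fp[OF that, of i] assms(4) by metis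
    then show ?thesis by (simp add: l[OF that])
  qed
  have mn: "Min (orbit s x) \<in> D" if "x \<in> D" for x
    using o(2)[OF that] assms(1) Min_in[of "orbit s x"] by (metis finite_subset orbit_nonempty subsetD)
  have im: "orbit s ` D = orbit s' ` D" using o(1) by (rule image_cong[OF refl])
  show ?thesis unfolding cycle_prod_def im[symmetric]
  proof (rule prod.cong[OF refl])
    fix C assume "C \<in> orbit s ` D"
    then have "Min C \<in> D" using mn by blast
    from w[OF this] show "\<tau> (concat (map w (Cycles.support s (Min C)))) =
        \<tau> (concat (map w' (Cycles.support s' (Min C))))" by (rule arg_cong)
  qed
qed

section \<open>Cycle products of a cyclic function: peeling, contraction, relabelling\<close>

locale cyclic_fun =
  fixes \<tau> :: "'g list \<Rightarrow> 'r::comm_ring_1"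
  assumes cyclic: "\<tau> (u @ v) = \<tau> (v @ u)"
begin

lemma cyclic_concat_rotate: "\<tau> (concat (map w (rotate k xs))) = \<tau> (concat (map w xs))"
proof (induction k arbitrary: xs)
  case (Suc k)
  have "\<tau> (concat (map w (rotate1 ys))) = \<tau> (concat (map w ys))" for ys
    by (cases ys) (auto simp: cyclic)
  with Suc show ?case by simp
qed simp

text \<open>Cyclicity makes the factor of a cycle independent of its starting point, so any list
  \<open>xs\<close> for the cycle may replace the one that starts at the minimum.\<close>

lemma cycle_prod_peel:
  assumes "s permutes D" "finite D" "is_cycle s xs" "set xs \<subseteq> D"
  shows "cycle_prod \<tau> D s w = \<tau> (concat (map w xs)) * cycle_prod \<tau> (D - set xs) s w"
proof -
  obtain x where x: "x \<in> set xs" using assms(3) by (cases xs) (auto simp: is_cycle_def)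
  have o: "orbit s y = set xs" if "y \<in> set xs" for y using is_cycle_orbit[OF assms(3) that] .
  have self: "y \<in> orbit s y" for y
    by (rule permutation_self_in_orbit) (use assms(1,2) in \<open>auto simp: permutation_permutes\<close>)
  have "orbit s ` D = orbit s ` (set xs) \<union> orbit s ` (D - set xs)" using assms(4) by blast
  also have "orbit s ` set xs = {set xs}" using o x by force
  finally have 1: "orbit s ` D = insert (set xs) (orbit s ` (D - set xs))" by simp
  have 2: "set xs \<notin> orbit s ` (D - set xs)" using self by blast
  have "Min (set xs) \<in> set xs" using x by (intro Min_in) auto
  then obtain k where "Cycles.support s (Min (set xs)) = rotate k xs"
    using is_cycle_support[OF assms(3)] by blast
  then have 3: "\<tau> (concat (map w (Cycles.support s (Min (set xs))))) = \<tau> (concat (map w xs))"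
    by (simp only: cyclic_concat_rotate)
  have "finite (orbit s ` (D - set xs))" using assms(2) by simp
  then show ?thesis
    unfolding cycle_prod_def 1 prod.insert[OF \<open>finite (orbit s ` (D - set xs))\<close> 2] by (simp only: 3)
qed

lemma cycle_prod_fixed:
  assumes "s permutes D" "finite D" "k \<notin> D"
  shows "cycle_prod \<tau> (insert k D) s w = \<tau> (w k) * cycle_prod \<tau> D s w"
proof -
  have "is_cycle s [k]" using assms by (simp add: is_cycle_def permutes_not_in)
  then show ?thesis
    using cycle_prod_peel[of s "insert k D" "[k]" w] assms
    by (simp add: permutes_subset[OF assms(1)] subset_insertI)
qed

lemma permutes_transpose_comp:
  assumes "s permutes insert k D"
  shows "(transpose k (s k) \<circ> s) permutes D"
  by (rule permutes_insert_lemma[OF assms])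

text \<open>Deleting \<open>k\<close> from its cycle while prepending its word to that of its
  successor \<open>q\<close> leaves the word read along the cycle unchanged; the other cycles are
  not touched.\<close>

lemma cycle_prod_contract:
  assumes "s permutes insert k D" "finite D" "k \<notin> D" "s k = q" "q \<noteq> k"
  shows "cycle_prod \<tau> (insert k D) s w =
    cycle_prod \<tau> D (transpose k q \<circ> s) (w(q := w k @ w q))"
proof -
  let ?s' = "transpose k q \<circ> s" and ?w' = "w(q := w k @ w q)"
  have s': "?s' permutes D" using permutes_transpose_comp[OF assms(1)] assms(4) by simp
  have fin: "finite (insert k D)" using assms by simp
  define xs where "xs = Cycles.support s k"
  have xs: "is_cycle s xs" "hd xs = k" using permutes_is_cycle[OF assms(1) fin] xs_def by auto
  then obtain ys where ys: "xs = k # ys" by (cases xs) (auto simp: is_cycle_def)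
  have ysne: "ys \<noteq> []"
    using xs ys assms by (auto simp: is_cycle_def)
  then obtain zs where zs: "xs = k # q # zs" 
    using xs ys assms by (cases ys) (auto simp: is_cycle_def)
  have d: "distinct (k # q # zs)" and m: "map s (q # zs) = zs @ [k]"
    using xs zs assms by (auto simp: is_cycle_def)
  \<comment> \<open>The last point of the cycle was sent to \<open>k\<close>; the transposition
    redirects it to \<open>q\<close> and so closes the shortened cycle.\<close>
  have "map ?s' (q # zs) = map (transpose k q) (zs @ [k])"
    using m by (metis map_map)
  also have "\<dots> = zs @ [q]"
    using d by (auto intro!: map_idI simp: transpose_def)
  finally have c': "is_cycle ?s' (q # zs)" using d by (simp add: is_cycle_def)
  have sub: "set xs \<subseteq> insert k D" using is_cycle_subset[OF assms(1) xs(1)] xs by simp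
  then have sub': "set (q # zs) \<subseteq> D" using d zs by auto
  have e: "insert k D - set xs = D - set (q # zs)" using zs assms by auto
  have wz: "map ?w' zs = map w zs" using d by auto
  have out: "x \<in> D - set (q # zs) \<Longrightarrow> s x \<in> D - set (q # zs) \<and> s x \<noteq> k \<and> s x \<noteq> q" for x
  proof -
    assume x: "x \<in> D - set (q # zs)"
    have inj: "inj s" using assms(1) permutes_inj by blast
    have "s ` set xs = set xs" using xs(1) by (metis is_cycle_def list.set_map set_rotate1)
    moreover have "x \<notin> set xs" using x zs assms by auto
    ultimately have "s x \<notin> set xs" using inj by (metis inj_image_mem_iff)
    moreover have "s x \<in> insert k D" using x assms(1) by (metis Diff_iff insertI2 permutes_in_image)
    ultimately show ?thesis using zs by auto
  qed
  have "cycle_prod \<tau> (D - set (q # zs)) s w = cycle_prod \<tau> (D - set (q # zs)) ?s' ?w'"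
    using assms out by (intro cycle_prod_cong) (auto simp: transpose_def)
  then show ?thesis
    unfolding cycle_prod_peel[OF assms(1) fin xs(1) sub] 
      cycle_prod_peel[OF s' assms(2) c' sub'] e
    unfolding zs by (simp only: list.map concat.simps wz fun_upd_same fun_upd_other[OF assms(5)[symmetric]] append_assoc)
qed

lemma is_cycle_map:
  assumes "is_cycle s xs" "inj_on b (set xs)" "\<And>x. x \<in> set xs \<Longrightarrow> s' (b x) = b (s x)"
  shows "is_cycle s' (map b xs)"
proof -
  have "map s' (map b xs) = map b (map s xs)" using assms(3) by simp
  also have "\<dots> = map b (rotate1 xs)" using assms(1) by (simp add: is_cycle_def)
  finally show ?thesis using assms by (auto simp: is_cycle_def distinct_map rotate1_map)
qed

lemma permutes_remove_cycle:
  assumes "s permutes D" "finite D" "is_cycle s xs"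
  shows "(\<lambda>y. if y \<in> D - set xs then s y else y) permutes (D - set xs)"
  using semidecomposition[OF assms(1,2), of "hd xs"] is_cycle_support_hd[OF assms(3)] by simp

lemma out_of_cycle:
  assumes "s permutes D" "is_cycle s xs" "x \<in> D - set xs"
  shows "s x \<in> D - set xs"
proof -
  have "s ` set xs = set xs" using assms(2) by (metis is_cycle_def list.set_map set_rotate1)
  then have "s x \<notin> set xs" using assms(1,3) by (metis Diff_iff inj_image_mem_iff permutes_inj)
  then show ?thesis using assms(1,3) by (simp add: permutes_in_image)
qed

text \<open>A bijection need not preserve minima, so the starting points of the cycles change.
  Peeling one cycle at a time avoids them, because \<open>cycle_prod_peel\<close> accepts any
  start.\<close>

lemma cycle_prod_relabel:
  assumes "s permutes D" "s' permutes D'" "finite D" "bij_betw b D D'"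
    "\<And>x. x \<in> D \<Longrightarrow> s' (b x) = b (s x)"
  shows "cycle_prod \<tau> D s (w \<circ> b) = cycle_prod \<tau> D' s' w"
  using assms
proof (induction "card D" arbitrary: D D' s s' rule: less_induct)
  case (less D D' s s')
  show ?case
  proof (cases "D = {}")
    case True
    then have "D' = {}" using less(5) by (auto simp: bij_betw_def)
    with True show ?thesis by (simp add: cycle_prod_def)
  next
    case False
    then obtain x where x: "x \<in> D" by blast
    have fin': "finite D'" using less(4,5) bij_betw_finite by blast
    define xs where "xs = Cycles.support s x"
    have xs: "is_cycle s xs" "hd xs = x" using permutes_is_cycle[OF less(2,4)] xs_def by auto
    have sub: "set xs \<subseteq> D" using is_cycle_subset[OF less(2) xs(1)] xs x by simp
    have inj: "inj_on b D" using less(5) by (simp add: bij_betw_def)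
    have c': "is_cycle s' (map b xs)"
      by (rule is_cycle_map[OF xs(1)]) (use inj sub less(6) in \<open>auto intro: inj_on_subset\<close>)
    have sub': "set (map b xs) \<subseteq> D'" using image_mono[OF sub, of b] less(5) unfolding bij_betw_def by (simp only: set_map)
    let ?E = "D - set xs" and ?E' = "D' - set (map b xs)"
    have bE: "bij_betw b ?E ?E'"
    proof -
      have "b ` ?E = b ` D - b ` set xs" by (rule inj_on_image_set_diff[OF inj Diff_subset sub])
      then have "b ` ?E = ?E'" using less(5) by (simp add: bij_betw_def)
      moreover have "inj_on b ?E" using inj Diff_subset by (rule inj_on_subset)
      ultimately show ?thesis by (simp add: bij_betw_def)
    qed
    \<comment> \<open>The induction hypothesis wants permutations of the smaller sets, hence the
      extension by the identity on the removed cycle.\<close>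
    define r where "r = (\<lambda>y. if y \<in> ?E then s y else y)"
    define r' where "r' = (\<lambda>y. if y \<in> ?E' then s' y else y)"
    have r: "r permutes ?E" using permutes_remove_cycle[OF less(2,4) xs(1)] r_def by simp
    have r': "r' permutes ?E'" using permutes_remove_cycle[OF less(3) fin' c'] r'_def by simp
    have o: "s y \<in> ?E" if "y \<in> ?E" for y using out_of_cycle[OF less(2) xs(1) that] .
    have o': "s' y \<in> ?E'" if "y \<in> ?E'" for y using out_of_cycle[OF less(3) c' that] .
    have "x \<in> set xs" using xs hd_in_set unfolding is_cycle_def by blast
    then have cd: "card ?E < card D" using less(4) x
      by (intro psubset_card_mono) blast+
    have "cycle_prod \<tau> ?E s (w \<circ> b) = cycle_prod \<tau> ?E r (w \<circ> b)"
      using less(4) o by (intro cycle_prod_cong) (auto simp: r_def)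
    also have "\<dots> = cycle_prod \<tau> ?E' r' w"
    proof (rule less(1)[OF cd r r' _ bE])
      fix y assume y: "y \<in> ?E"
      then have "b y \<in> ?E'" using bE by (auto simp: bij_betw_def)
      then show "r' (b y) = b (r y)" using y less(6) by (auto simp: r_def r'_def)
    qed (use less(4) in auto)
    also have "\<dots> = cycle_prod \<tau> ?E' s' w"
      using fin' o' by (intro cycle_prod_cong) (auto simp: r'_def)
    finally show ?thesis
      unfolding cycle_prod_peel[OF less(2,4) xs(1) sub] cycle_prod_peel[OF less(3) fin' c' sub']
      by simp
  qed
qed

text \<open>The word in slot \<open>k\<close> occurs once, in the cycle through \<open>k\<close>;
  starting that cycle at \<open>k\<close> brings it to the front. As a function of a single slot,
  every product over cycles is thus a multiple of one trace, which is how the trace form will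
  enter.\<close>

lemma cycle_prod_single_slot:
  assumes "s permutes D" "finite D" "k \<in> D"
  shows "\<exists>c v. \<forall>u. cycle_prod \<tau> D s (w(k := u)) = c * \<tau> (u @ v)"
proof -
  define xs where "xs = Cycles.support s k"
  have xs: "is_cycle s xs" "hd xs = k" using permutes_is_cycle[OF assms(1,2)] xs_def by auto
  have sub: "set xs \<subseteq> D" using is_cycle_subset[OF assms(1) xs(1)] xs assms by simp
  obtain ys where ys: "xs = k # ys" using xs by (cases xs) (auto simp: is_cycle_def)
  have k: "k \<notin> set ys" using xs ys by (auto simp: is_cycle_def)
  have "cycle_prod \<tau> (D - set xs) s (w(k := u)) = cycle_prod \<tau> (D - set xs) s w" for u
    using out_of_cycle[OF assms(1) xs(1)] assms ys by (intro cycle_prod_cong) auto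
  moreover have "map (w(k := u)) ys = map w ys" for u using k by simp
  ultimately have "cycle_prod \<tau> D s (w(k := u)) =
      cycle_prod \<tau> (D - set xs) s w * \<tau> (u @ concat (map w ys))" for u
    unfolding cycle_prod_peel[OF assms(1,2) xs(1) sub]
    by (simp only: ys list.map concat.simps fun_upd_same mult.commute)
  then show ?thesis by blast
qed

end

section \<open>Permutations in lexicographic order\<close>

lemma sum_mult_of_bool:
  fixes g :: "'x \<Rightarrow> 'b::semiring_1"
  assumes "finite A" "a \<in> A" "\<And>x. x \<in> A \<Longrightarrow> P x \<longleftrightarrow> x = a"
  shows "(\<Sum>x\<in>A. g x * of_bool (P x)) = g a"
proof -
  have "(\<Sum>x\<in>A. g x * of_bool (P x)) = (\<Sum>x\<in>A. if x = a then g x else 0)"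
    using assms(3) by (intro sum.cong) auto
  then show ?thesis using assms by simp
qed

section \<open>Orthogonal projection and Gram kernels over an ordered field\<close>

text \<open>Gram-Schmidt for a family that may be linearly dependent: \<open>u\<close> is the part
  of the new vector orthogonal to the old ones, \<open>d\<close> the residue of \<open>e\<close>,
  and the projection of \<open>e\<close> is corrected by a multiple of \<open>u\<close>.\<close>

lemma exists_orthogonal_projection:
  fixes v :: "'i \<Rightarrow> 'x \<Rightarrow> 'b::linordered_field" and e :: "'x \<Rightarrow> 'b"
  assumes "finite S" "finite Y"
  shows "\<exists>a. \<forall>r\<in>S. (\<Sum>s\<in>S. a s * (\<Sum>x\<in>Y. v s x * v r x)) = (\<Sum>x\<in>Y. e x * v r x)"
  using assms(1)
proof (induction S arbitrary: e)
  case (insert z S)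
  obtain a where a: "\<And>r. r \<in> S \<Longrightarrow>
      (\<Sum>s\<in>S. a s * (\<Sum>x\<in>Y. v s x * v r x)) = (\<Sum>x\<in>Y. e x * v r x)"
    using insert.IH by blast
  obtain b where b: "\<And>r. r \<in> S \<Longrightarrow>
      (\<Sum>s\<in>S. b s * (\<Sum>x\<in>Y. v s x * v r x)) = (\<Sum>x\<in>Y. v z x * v r x)"
    using insert.IH by blast
  define u where "u x = v z x - (\<Sum>s\<in>S. b s * v s x)" for x
  define d where "d x = e x - (\<Sum>s\<in>S. a s * v s x)" for x
  \<comment> \<open>The denominator is the squared length of \<open>u\<close>. If it is zero, then
    \<open>u\<close> vanishes, the new vector lies in the old span, and \<open>d\<close> is
    orthogonal to it already, whatever the value of \<open>c\<close>.\<close>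
  define c where "c = (\<Sum>x\<in>Y. d x * v z x) / (\<Sum>x\<in>Y. u x * v z x)"
  have swap: "(\<Sum>x\<in>Y. (\<Sum>s\<in>S. k s * v s x) * v r x) = (\<Sum>s\<in>S. k s * (\<Sum>x\<in>Y. v s x * v r x))" for k r
    by (subst sum_distrib_right, subst sum.swap) (simp add: sum_distrib_left mult.assoc)
  have u0: "(\<Sum>x\<in>Y. u x * v r x) = 0" if "r \<in> S" for r
    using b[OF that] by (simp add: u_def left_diff_distrib sum_subtractf swap)
  have d0: "(\<Sum>x\<in>Y. d x * v r x) = 0" if "r \<in> S" for r
    using a[OF that] by (simp add: d_def left_diff_distrib sum_subtractf swap)
  have "(\<Sum>x\<in>Y. u x * u x) = (\<Sum>x\<in>Y. u x * v z x) - (\<Sum>s\<in>S. b s * (\<Sum>x\<in>Y. u x * v s x))"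
  proof -
    have "(\<Sum>s\<in>S. b s * (\<Sum>x\<in>Y. u x * v s x)) = (\<Sum>x\<in>Y. u x * (\<Sum>s\<in>S. b s * v s x))"
      by (simp only: sum_distrib_left, subst sum.swap) (simp add: mult.left_commute)
    moreover have "u x * u x = u x * v z x - u x * (\<Sum>s\<in>S. b s * v s x)" for x
      by (simp only: right_diff_distrib[symmetric]) (simp add: u_def)
    ultimately show ?thesis by (simp only: sum_subtractf)
  qed
  then have uu: "(\<Sum>x\<in>Y. u x * u x) = (\<Sum>x\<in>Y. u x * v z x)" using u0 by simp
  have dz: "(\<Sum>x\<in>Y. d x * v z x) = c * (\<Sum>x\<in>Y. u x * v z x)"
  proof (cases "(\<Sum>x\<in>Y. u x * v z x) = 0")
    case True
    then have "\<forall>x\<in>Y. u x * u x = 0"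
      using uu assms(2) sum_nonneg_eq_0_iff[of Y "\<lambda>x. u x * u x"] by simp
    then have "\<And>x. x \<in> Y \<Longrightarrow> v z x = (\<Sum>s\<in>S. b s * v s x)" by (simp add: u_def)
    then have "(\<Sum>x\<in>Y. d x * v z x) = (\<Sum>x\<in>Y. d x * (\<Sum>s\<in>S. b s * v s x))" by simp
    also have "\<dots> = (\<Sum>s\<in>S. b s * (\<Sum>x\<in>Y. d x * v s x))"
      by (simp only: sum_distrib_left, subst sum.swap) (simp add: mult.left_commute)
    also have "\<dots> = 0" using d0 by simp
    finally show ?thesis using True by simp
  qed (simp add: c_def)
  \<comment> \<open>These are the coefficients of the old projection plus \<open>c\<close> times
    \<open>u\<close>.\<close>
  define a' where "a' s = (if s = z then c else a s - c * b s)" for s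
  have "(\<Sum>s\<in>insert z S. a' s * (\<Sum>x\<in>Y. v s x * v r x)) = (\<Sum>x\<in>Y. e x * v r x)"
    if r: "r \<in> insert z S" for r
  proof -
    have ud: "(\<Sum>x\<in>Y. d x * v r x) = c * (\<Sum>x\<in>Y. u x * v r x)"
      using r dz u0 d0 by auto
    have "(\<Sum>s\<in>insert z S. a' s * (\<Sum>x\<in>Y. v s x * v r x)) =
        c * (\<Sum>x\<in>Y. v z x * v r x) + (\<Sum>s\<in>S. (a s - c * b s) * (\<Sum>x\<in>Y. v s x * v r x))"
      using insert.hyps by (auto simp: a'_def intro!: sum.cong)
    also have "(\<Sum>s\<in>S. (a s - c * b s) * (\<Sum>x\<in>Y. v s x * v r x)) =
        (\<Sum>s\<in>S. a s * (\<Sum>x\<in>Y. v s x * v r x)) - c * (\<Sum>s\<in>S. b s * (\<Sum>x\<in>Y. v s x * v r x))"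
      by (simp only: left_diff_distrib sum_subtractf sum_distrib_left mult.assoc)
    also have "c * (\<Sum>x\<in>Y. v z x * v r x) + \<dots> = (\<Sum>x\<in>Y. e x * v r x)"
    proof -
      have "(\<Sum>x\<in>Y. d x * v r x) = (\<Sum>x\<in>Y. e x * v r x) - (\<Sum>s\<in>S. a s * (\<Sum>x\<in>Y. v s x * v r x))"
        by (simp only: d_def left_diff_distrib sum_subtractf swap)
      moreover have "(\<Sum>x\<in>Y. u x * v r x) =
          (\<Sum>x\<in>Y. v z x * v r x) - (\<Sum>s\<in>S. b s * (\<Sum>x\<in>Y. v s x * v r x))"
        by (simp only: u_def left_diff_distrib sum_subtractf swap)
      ultimately show ?thesis using ud by (simp add: algebra_simps)
    qed
    finally show ?thesis .
  qed
  then show ?case by blast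
qed auto

text \<open>A combination orthogonal to every member of the family is orthogonal to itself, and over
  an ordered field a vanishing sum of squares has vanishing terms.\<close>

lemma gram_kernel:
  fixes v :: "'i \<Rightarrow> 'x \<Rightarrow> 'b::linordered_field"
  assumes "finite S" "finite Y"
    and "\<And>r. r \<in> S \<Longrightarrow> (\<Sum>s\<in>S. a s * (\<Sum>x\<in>Y. v s x * v r x)) = 0"
    and "x \<in> Y"
  shows "(\<Sum>s\<in>S. a s * v s x) = 0"
proof -
  let ?m = "\<lambda>x. \<Sum>s\<in>S. a s * v s x"
  have "(\<Sum>x\<in>Y. ?m x * ?m x) = (\<Sum>x\<in>Y. \<Sum>r\<in>S. a r * (\<Sum>s\<in>S. a s * (v s x * v r x)))"
    by (simp add: sum_distrib_left sum_distrib_right mult_ac)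
  also have "\<dots> = (\<Sum>r\<in>S. a r * (\<Sum>s\<in>S. a s * (\<Sum>x\<in>Y. v s x * v r x)))"
  proof -
    have "(\<Sum>s\<in>S. a s * (\<Sum>x\<in>Y. v s x * v r x)) = (\<Sum>x\<in>Y. \<Sum>s\<in>S. a s * (v s x * v r x))" for r
      by (simp only: sum_distrib_left, subst sum.swap) simp
    then show ?thesis by (subst sum.swap) (simp only: sum_distrib_left)
  qed
  also have "\<dots> = 0" using assms(3) by simp
  finally have "\<forall>x\<in>Y. ?m x * ?m x = 0"
    using assms(2) sum_nonneg_eq_0_iff[of Y "\<lambda>x. ?m x * ?m x"] by simp
  then show ?thesis using assms(4) by simp
qed

section \<open>Decreasing subsequences and the lexicographic order\<close>

definition decreasing_on :: "nat set \<Rightarrow> (nat \<Rightarrow> nat) \<Rightarrow> bool" where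
  "decreasing_on P s \<longleftrightarrow> (\<forall>x\<in>P. \<forall>y\<in>P. x < y \<longrightarrow> s y < s x)"

text \<open>The label of \<open>x\<close> is the length of the longest decreasing subsequence ending at \<open>x\<close>.\<close>

lemma decreasing_or_labelling:
  assumes "finite D" "inj_on s D"
    and no: "\<And>P. P \<subseteq> D \<Longrightarrow> decreasing_on P s \<Longrightarrow> card P \<noteq> Suc n"
  shows "\<exists>f. f ` D \<subseteq> {..<n} \<and> (\<forall>x\<in>D. \<forall>y\<in>D. x < y \<longrightarrow> f x = f y \<longrightarrow> s x < s y)"
proof -
  define Q where "Q x = {P. P \<subseteq> D \<and> x \<in> P \<and> (\<forall>y\<in>P. y \<le> x) \<and> decreasing_on P s}" for x
  define L where "L x = Max (card ` Q x)" for x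
  have fin: "finite (card ` Q x)" for x
    using assms(1) by (intro finite_imageI) (auto simp: Q_def intro: finite_subset[of _ "Pow D"])
  have sing: "{x} \<in> Q x" if "x \<in> D" for x using that by (simp add: Q_def decreasing_on_def)
  have le: "card P \<le> n" if "P \<subseteq> D" "decreasing_on P s" for P
  proof (rule ccontr)
    assume "\<not> card P \<le> n"
    then have "Suc n \<le> card P" by simp
    then obtain P' where "P' \<subseteq> P" "card P' = Suc n" by (rule obtain_subset_with_card_n)
    moreover from this have "decreasing_on P' s" using that(2) by (auto simp: decreasing_on_def)
    ultimately show False using no[of P'] that(1) by blast
  qed
  have L: "1 \<le> L x \<and> L x \<le> n \<and> (\<exists>P\<in>Q x. card P = L x)" if "x \<in> D" for x
  proof -
    have ne: "card ` Q x \<noteq> {}" using sing[OF that] by blast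
    have "card {x} \<le> L x" unfolding L_def using sing[OF that] fin by (intro Max_ge) blast+
    moreover have "L x \<in> card ` Q x" unfolding L_def using fin ne by (rule Max_in)
    then obtain P where "P \<in> Q x" "card P = L x" by force
    moreover from this have "L x \<le> n" using le[of P] by (auto simp: Q_def)
    ultimately show ?thesis by auto
  qed
  show ?thesis
  \<comment> \<open>The lengths run from 1 to \<open>n\<close>, the labels from 0 to
    \<open>n - 1\<close>; since every length is positive, the truncated subtraction loses no
    information.\<close>
  proof (intro exI[of _ "\<lambda>x. L x - 1"] conjI ballI impI)
    show "(\<lambda>x. L x - 1) ` D \<subseteq> {..<n}" using L by fastforce
  next
    fix x y assume xy: "x \<in> D" "y \<in> D" "x < y" "L x - 1 = L y - 1"
    then have eq: "L x = L y" using L[of x] L[of y] by linarith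
    show "s x < s y"
    proof (rule ccontr)
      assume "\<not> s x < s y"
      moreover have "s x \<noteq> s y" using xy assms(2) by (auto simp: inj_on_def)
      ultimately have gt: "s y < s x" by simp
      obtain P where P: "P \<in> Q x" "card P = L x" using L xy by blast
      \<comment> \<open>A longest decreasing subsequence ending at \<open>x\<close> could be
        prolonged by \<open>y\<close>, which contradicts the equality of the labels.\<close>
      have P': "insert y P \<in> Q y"
      proof -
        have *: "\<And>z. z \<in> P \<Longrightarrow> z \<le> x" "\<And>z. z \<in> P \<Longrightarrow> z < x \<Longrightarrow> s x < s z"
          using P by (auto simp: Q_def decreasing_on_def)
        have "s y < s z" if "z \<in> P" for z using *[OF that] gt by (cases "z = x") force+
        moreover have "z < y" if "z \<in> P" for z using *[OF that] xy by simp
        ultimately show ?thesis using P xy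
          by (auto simp: Q_def decreasing_on_def less_imp_le dest: less_asym)
      qed
      have "y \<notin> P" using P(1) xy(3) leD unfolding Q_def by blast
      moreover have "finite P" using P(1) assms(1) finite_subset unfolding Q_def by blast
      ultimately have "card (insert y P) = Suc (L x)" using P by simp
      moreover have "card (insert y P) \<le> L y" unfolding L_def using P' fin by (intro Max_ge) blast+
      ultimately show False using eq by simp
    qed
  qed
qed

definition perms :: "nat set \<Rightarrow> (nat \<Rightarrow> nat) set" where
  "perms D = {s. s permutes D}"

lemma finite_perms: "finite D \<Longrightarrow> finite (perms D)"
  unfolding perms_def by (rule finite_permutations)

definition lex_less :: "nat set \<Rightarrow> (nat \<Rightarrow> nat) \<Rightarrow> (nat \<Rightarrow> nat) \<Rightarrow> bool" where
  "lex_less D r s \<longleftrightarrow> (\<exists>x\<in>D. r x < s x \<and> (\<forall>y\<in>D. y < x \<longrightarrow> r y = s y))"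

lemma lex_less_trans:
  assumes "lex_less D r s" "lex_less D s u" shows "lex_less D r u"
proof -
  obtain x where x: "x \<in> D" "r x < s x" "\<And>y. y \<in> D \<Longrightarrow> y < x \<Longrightarrow> r y = s y"
    using assms(1) unfolding lex_less_def by blast
  obtain z where z: "z \<in> D" "s z < u z" "\<And>y. y \<in> D \<Longrightarrow> y < z \<Longrightarrow> s y = u y"
    using assms(2) unfolding lex_less_def by blast
  consider "x < z" | "x = z" | "z < x" by linarith
  then show ?thesis
  proof cases
    case 1
    have "r x < u x" using x z(3)[OF x(1) 1] by simp
    moreover have "\<forall>y\<in>D. y < x \<longrightarrow> r y = u y" using x(3) z(3) 1 by (metis less_trans)
    ultimately show ?thesis using x(1) unfolding lex_less_def by blast
  next
    case 2
    then have "r x < u x" using x z by simp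
    moreover have "\<forall>y\<in>D. y < x \<longrightarrow> r y = u y" using x(3) z(3) 2 by metis
    ultimately show ?thesis using x(1) unfolding lex_less_def by blast
  next
    case 3
    have "r z < u z" using z x(3)[OF z(1) 3] by simp
    moreover have "\<forall>y\<in>D. y < z \<longrightarrow> r y = u y" using x(3) z(3) 3 by (metis less_trans)
    ultimately show ?thesis using z(1) unfolding lex_less_def by blast
  qed
qed

lemma lex_less_irrefl: "\<not> lex_less D s s"
  by (auto simp: lex_less_def)

text \<open>The agreement below \<open>x\<close> extends to all numbers, not just those in
  \<open>D\<close>, because both permutations fix the complement of \<open>D\<close>.\<close>

lemma least_difference:
  assumes "r \<in> perms D" "s \<in> perms D" "r \<noteq> s"
  shows "\<exists>x\<in>D. r x \<noteq> s x \<and> (\<forall>y<x. r y = s y)"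
proof -
  define x where "x = (LEAST x. r x \<noteq> s x)"
  have "\<exists>x. r x \<noteq> s x" using assms(3) by auto
  then have x: "r x \<noteq> s x" unfolding x_def by (rule LeastI_ex)
  have "x \<in> D"
  proof (rule ccontr)
    assume "x \<notin> D"
    then have "r x = x" "s x = x" using assms(1,2) by (auto simp: perms_def permutes_not_in)
    with x show False by simp
  qed
  moreover have "r y = s y" if "y < x" for y
    using not_less_Least that unfolding x_def by blast
  ultimately show ?thesis using x by blast
qed

lemma lex_less_total:
  assumes "r \<in> perms D" "s \<in> perms D" "r \<noteq> s"
  shows "lex_less D r s \<or> lex_less D s r"
proof -
  obtain x where x: "x \<in> D" "r x \<noteq> s x" "\<And>y. y < x \<Longrightarrow> r y = s y"
    using least_difference[OF assms] by blast
  have "\<forall>y\<in>D. y < x \<longrightarrow> r y = s y" "\<forall>y\<in>D. y < x \<longrightarrow> s y = r y" using x(3) by simp_all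
  moreover have "r x < s x \<or> s x < r x" using x(2) by linarith
  ultimately show ?thesis unfolding lex_less_def using x(1) by blast
qed

text \<open>Turns the order into a number, so that lowering the leading permutation becomes an
  ordinary induction.\<close>

definition lex_rank :: "nat set \<Rightarrow> (nat \<Rightarrow> nat) \<Rightarrow> nat" where
  "lex_rank D s = card {r \<in> perms D. lex_less D r s}"

lemma lex_rank_less:
  assumes "finite D" "r \<in> perms D" "lex_less D r s"
  shows "lex_rank D r < lex_rank D s"
  unfolding lex_rank_def
proof (rule psubset_card_mono)
  show "finite {r \<in> perms D. lex_less D r s}" using finite_perms[OF assms(1)] by simp
  show "{u \<in> perms D. lex_less D u r} \<subset> {u \<in> perms D. lex_less D u s}"
    using lex_less_trans[OF _ assms(3)] assms(2,3) lex_less_irrefl[of D r] by blast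
qed

lemma lex_rank_inj:
  assumes "finite D" "r \<in> perms D" "s \<in> perms D" "lex_rank D r = lex_rank D s"
  shows "r = s"
  using lex_less_total[OF assms(2,3)] lex_rank_less[OF assms(1)] assms by (metis less_irrefl)

text \<open>Conjugation by \<open>b\<close>. It carries the identity for the index set
  \<open>{..<Suc n}\<close> to an arbitrary set of \<open>Suc n\<close> indices.\<close>

lemma bij_betw_map_permutation:
  assumes "bij_betw b D D'"
  shows "bij_betw (map_permutation D b) (perms D) (perms D')"
proof (rule bij_betw_byWitness[where f' = "map_permutation D' (inv_into D b)"])
  have inv: "bij_betw (inv_into D b) D' D" using assms by (rule bij_betw_inv_into)
  show "\<forall>s\<in>perms D. map_permutation D' (inv_into D b) (map_permutation D b s) = s"
    using map_permutation_compose_inv[OF assms] bij_betw_inv_into_left[OF assms]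
    by (simp add: perms_def)
  show "\<forall>s\<in>perms D'. map_permutation D b (map_permutation D' (inv_into D b) s) = s"
    using map_permutation_compose_inv[OF inv] bij_betw_inv_into_right[OF assms]
    by (simp add: perms_def)
  show "map_permutation D b ` perms D \<subseteq> perms D'"
    using map_permutation_permutes[OF assms] by (auto simp: perms_def)
  show "map_permutation D' (inv_into D b) ` perms D' \<subseteq> perms D"
    using map_permutation_permutes[OF inv] by (auto simp: perms_def)
qed

text \<open>The entry at \<open>(f, h)\<close> of the matrix by which the permutation \<open>s\<close> acts on the tensor power
  \<open>(\<rat>\<^sup>n)\<^bsup>\<otimes>D\<^esup>\<close>.\<close>

definition perm_entry :: "nat set \<Rightarrow> (nat \<Rightarrow> nat) \<Rightarrow> (nat \<Rightarrow> nat) \<times> (nat \<Rightarrow> nat) \<Rightarrow> rat" where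
  "perm_entry D s = (\<lambda>(f, h). of_bool (\<forall>x\<in>D. f (s x) = h x))"

text \<open>By the pigeonhole principle \<open>f \<circ> s\<close> takes some value twice on
  \<open>P\<close>. Composing with the transposition of these two positions preserves the entries
  and flips the signs, so the sum equals its own negative.\<close>

lemma alternating_sum_perm_entry:
  assumes P: "P \<subseteq> D" "card P = Suc n" and f: "f \<in> D \<rightarrow> {..<n}" and s: "s permutes D"
  shows "(\<Sum>p\<in>perms P. of_int (sign p) * perm_entry D (s \<circ> p) (f, h)) = 0"
proof -
  have finP: "finite P" using P(2) card.infinite by fastforce
  have "(f \<circ> s) ` P \<subseteq> {..<n}" using f P(1) s by (auto simp: Pi_def permutes_in_image)
  then have "card ((f \<circ> s) ` P) \<le> n" by (metis card_lessThan card_mono finite_lessThan)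
  then have "\<not> inj_on (f \<circ> s) P" using P(2) by (metis card_image Suc_n_not_le_n)
  then obtain x y where xy: "x \<in> P" "y \<in> P" "x \<noteq> y" "f (s x) = f (s y)" by (auto simp: inj_on_def)
  let ?t = "transpose x y"
  have t: "?t permutes P" using xy by (intro permutes_swap_id)
  have ft: "f (s (?t z)) = f (s z)" for z using xy by (cases "z = x"; cases "z = y") auto
  let ?g = "\<lambda>p. of_int (sign p) * perm_entry D (s \<circ> p) (f, h)"
  have "sum ?g (perms P) = (\<Sum>p\<in>perms P. ?g (?t \<circ> p))"
    unfolding perms_def by (rule setum_permutations_compose_left[OF t])
  also have "\<dots> = (\<Sum>p\<in>perms P. - ?g p)"
  proof (rule sum.cong[OF refl])
    fix p assume "p \<in> perms P"
    then have "permutation p" using finP by (auto simp: perms_def permutation_permutes)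
    then have "sign (?t \<circ> p) = - sign p"
      using xy by (subst sign_compose) (auto simp: sign_swap_id permutation_swap_id)
    moreover have "perm_entry D (s \<circ> (?t \<circ> p)) (f, h) = perm_entry D (s \<circ> p) (f, h)"
      unfolding perm_entry_def by (simp add: ft)
    ultimately show "?g (?t \<circ> p) = - ?g p" by simp
  qed
  finally show ?thesis by (simp add: sum_negf)
qed

section \<open>The second fundamental theorem\<close>

text \<open>The ring \<open>'r\<close> models the coefficient ring only modulo \<open>N\<close>, so
  the trace axioms are congruences. Cyclicity is the exception: it is an equality, and the
  manipulations of cycle products above stay exact.\<close>

locale trace_ideal = cyclic_fun \<tau> for \<tau> :: "'g list \<Rightarrow> 'r::comm_ring_1" +
  fixes N :: "'r set" and q :: "rat \<Rightarrow> 'r" and n :: nat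
  assumes N_zero: "0 \<in> N"
    and N_add: "a \<in> N \<Longrightarrow> b \<in> N \<Longrightarrow> a + b \<in> N"
    and N_mult: "a \<in> N \<Longrightarrow> c * a \<in> N"
    and q_one: "q 1 = 1"
    and q_add: "q (x + y) = q x + q y"
    and q_mult: "q (x * y) = q x * q y"
    and trace_one: "\<tau> [] - of_nat n \<in> N"
    and alternating_vanish:
      "(\<Sum>p\<in>perms {..<Suc n}. of_int (sign p) * cycle_prod \<tau> {..<Suc n} p w) \<in> N"
begin

lemma N_uminus: "a \<in> N \<Longrightarrow> - a \<in> N"
  using N_mult[of a "-1"] by simp

lemma N_sum: "(\<And>x. x \<in> I \<Longrightarrow> f x \<in> N) \<Longrightarrow> sum f I \<in> N"
  by (induction I rule: infinite_finite_induct) (auto simp: N_zero N_add)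

lemma N_trans: "a - b \<in> N \<Longrightarrow> b - c \<in> N \<Longrightarrow> a - c \<in> N"
  using N_add[of "a - b" "b - c"] by simp

lemma N_sym: "a - b \<in> N \<Longrightarrow> b - a \<in> N"
  using N_uminus[of "a - b"] by simp

lemma q_zero: "q 0 = 0"
  using q_add[of 0 0] by simp

lemma q_uminus: "q (- x) = - q x"
  using q_add[of x "- x"] q_zero by (simp add: eq_neg_iff_add_eq_0 add.commute)

lemma q_diff: "q (x - y) = q x - q y"
  using q_add[of x "- y"] by (simp add: q_uminus)

lemma q_sum: "q (sum f I) = (\<Sum>x\<in>I. q (f x))"
  by (induction I rule: infinite_finite_induct) (auto simp: q_zero q_add)

lemma q_of_nat: "q (of_nat k) = of_nat k"
  by (induction k) (auto simp: q_zero q_add q_one)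

lemma q_sign: "q (of_int (sign p)) = of_int (sign p)"
  by (cases p rule: sign_cases) (auto simp: q_one q_uminus)

text \<open>Relabelling reduces \<open>P\<close> to \<open>{..<Suc n}\<close>, and translation by
  \<open>s\<close> merely multiplies the alternating sum by the sign of \<open>s\<close>, which is
  its own inverse.\<close>

lemma alternating_sum_cycle_prod_full:
  assumes "card P = Suc n" "s permutes P"
  shows "(\<Sum>p\<in>perms P. of_int (sign p) * cycle_prod \<tau> P (s \<circ> p) w) \<in> N"
proof -
  have finP: "finite P" using assms(1) card.infinite by fastforce
  have ps: "permutation s" using assms(2) finP by (auto simp: permutation_permutes)
  obtain b where b: "bij_betw b {..<Suc n} P"
    using finP assms(1) by (metis bij_betw_from_nat_into_finite)
  let ?b = "map_permutation {..<Suc n} b"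
  have "(\<Sum>p\<in>perms P. of_int (sign p) * cycle_prod \<tau> P p w) =
      (\<Sum>p\<in>perms P. of_int (sign (s \<circ> p)) * cycle_prod \<tau> P (s \<circ> p) w)"
    unfolding perms_def by (rule setum_permutations_compose_left[OF assms(2)])
  also have "\<dots> = of_int (sign s) * (\<Sum>p\<in>perms P. of_int (sign p) * cycle_prod \<tau> P (s \<circ> p) w)"
    unfolding sum_distrib_left
  proof (rule sum.cong[OF refl])
    fix p assume "p \<in> perms P"
    then have "permutation p" using finP by (auto simp: perms_def permutation_permutes)
    then show "of_int (sign (s \<circ> p)) * cycle_prod \<tau> P (s \<circ> p) w =
        of_int (sign s) * (of_int (sign p) * cycle_prod \<tau> P (s \<circ> p) w)"
      by (simp add: sign_compose[OF ps] mult.assoc)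
  qed
  finally have 1: "(\<Sum>p\<in>perms P. of_int (sign p) * cycle_prod \<tau> P p w) =
    of_int (sign s) * (\<Sum>p\<in>perms P. of_int (sign p) * cycle_prod \<tau> P (s \<circ> p) w)" .
  have "(\<Sum>p\<in>perms P. of_int (sign p) * cycle_prod \<tau> P p w) =
      (\<Sum>p\<in>perms {..<Suc n}. of_int (sign (?b p)) * cycle_prod \<tau> P (?b p) w)"
    by (rule sum.reindex_bij_betw[OF bij_betw_map_permutation[OF b], symmetric])
  also have "\<dots> = (\<Sum>p\<in>perms {..<Suc n}. of_int (sign p) * cycle_prod \<tau> {..<Suc n} p (w \<circ> b))"
  proof (rule sum.cong[OF refl])
    fix p assume "p \<in> perms {..<Suc n}"
    then have p: "p permutes {..<Suc n}" by (simp add: perms_def)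
    have inj: "inj_on b {..<Suc n}" using b by (rule bij_betw_imp_inj_on)
    have "cycle_prod \<tau> {..<Suc n} p (w \<circ> b) = cycle_prod \<tau> P (?b p) w"
      by (rule cycle_prod_relabel[OF p map_permutation_permutes[OF b p] _ b])
        (auto simp: map_permutation_apply[OF inj])
    moreover have "sign (?b p) = sign p" by (rule sign_map_permutation[OF inj p]) simp
    ultimately show "of_int (sign (?b p)) * cycle_prod \<tau> P (?b p) w =
        of_int (sign p) * cycle_prod \<tau> {..<Suc n} p (w \<circ> b)" by simp
  qed
  also have "\<dots> \<in> N" by (rule alternating_vanish)
  finally have "of_int (sign s) * (\<Sum>p\<in>perms P. of_int (sign p) * cycle_prod \<tau> P p w) \<in> N"
    by (rule N_mult)
  moreover have "of_int (sign s) * (of_int (sign s) * z) = z" for z :: 'r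
    by (cases s rule: sign_cases) auto
  ultimately show ?thesis unfolding 1 by simp
qed

text \<open>A point \<open>k\<close> outside \<open>P\<close> is fixed by every \<open>p\<close>, so
  \<open>s \<circ> p\<close> sends it to \<open>s k\<close> for all \<open>p\<close> alike. It can
  be deleted from all terms at once, by splitting off a common factor or by merging words, until
  only \<open>P\<close> remains.\<close>

lemma alternating_sum_cycle_prod:
  assumes "finite D" "P \<subseteq> D" "card P = Suc n" "s permutes D"
  shows "(\<Sum>p\<in>perms P. of_int (sign p) * cycle_prod \<tau> D (s \<circ> p) w) \<in> N"
  using assms
proof (induction "card (D - P)" arbitrary: D s w)
  case 0
  then have "D = P" by auto
  with 0 show ?case using alternating_sum_cycle_prod_full by blast
next
  case (Suc m D s w)
  have "D - P \<noteq> {}" using Suc.hyps(2) by (metis card.empty nat.distinct(1))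
  then obtain k where k: "k \<in> D - P" by blast
  define E where "E = D - {k}"
  have D: "D = insert k E" "k \<notin> E" "finite E" "P \<subseteq> E" using k Suc.prems by (auto simp: E_def)
  have "E - P = (D - P) - {k}" by (auto simp: E_def)
  then have cE: "m = card (E - P)" using Suc.hyps(2) k by simp
  have pk: "p k = k" "p permutes E" if "p \<in> perms P" for p
    using that k D(4) by (auto simp: perms_def permutes_not_in intro: permutes_subset)
  have sD: "s permutes insert k E" using Suc.prems D by simp
  show ?case
  proof (cases "s k = k")
    case True
    have sE: "s permutes E" using permutes_transpose_comp[OF sD] True by simp
    have "cycle_prod \<tau> D (s \<circ> p) w = \<tau> (w k) * cycle_prod \<tau> E (s \<circ> p) w" if "p \<in> perms P" for p
      unfolding D(1) by (rule cycle_prod_fixed[OF permutes_compose[OF pk(2)[OF that] sE] D(3,2)])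
    then have "(\<Sum>p\<in>perms P. of_int (sign p) * cycle_prod \<tau> D (s \<circ> p) w) =
        \<tau> (w k) * (\<Sum>p\<in>perms P. of_int (sign p) * cycle_prod \<tau> E (s \<circ> p) w)"
      by (simp add: sum_distrib_left mult.left_commute)
    then show ?thesis using N_mult[OF Suc.hyps(1)[OF cE D(3,4) Suc.prems(3) sE]] by simp
  next
    case False
    let ?s = "transpose k (s k) \<circ> s"
    let ?w = "w(s k := w k @ w (s k))"
    have sE: "?s permutes E" using permutes_transpose_comp[OF sD] .
    have "cycle_prod \<tau> D (s \<circ> p) w = cycle_prod \<tau> E (?s \<circ> p) ?w" if "p \<in> perms P" for p
    proof -
      have "p permutes insert k E" using pk(2)[OF that] by (rule permutes_subset) auto
      from cycle_prod_contract[OF permutes_compose[OF this sD] D(3,2) _ False, of w]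
      show ?thesis using pk(1)[OF that] unfolding D(1) by (simp add: comp_assoc)
    qed
    then show ?thesis using Suc.hyps(1)[OF cE D(3,4) Suc.prems(3) sE, of ?w] by simp
  qed
qed

definition trace_comb :: "nat set \<Rightarrow> ((nat \<Rightarrow> nat) \<Rightarrow> rat) \<Rightarrow> (nat \<Rightarrow> 'g list) \<Rightarrow> 'r" where
  "trace_comb D a w = (\<Sum>s\<in>perms D. q (a s) * cycle_prod \<tau> D s w)"

abbreviation (input) funs :: "nat set \<Rightarrow> (nat \<Rightarrow> nat) set" where
  "funs D \<equiv> D \<rightarrow>\<^sub>E {..<n}"

text \<open>A combination of permutations that vanishes on \<open>(\<rat>\<^sup>n)\<^bsup>\<otimes>D\<^esup>\<close> is a consequence of
  \<open>T\<^sub>n\<^sub>+\<^sub>1 = 0\<close>. The lexicographically largest permutation \<open>s\<close> of the support has a decreasing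
  subsequence of length \<open>n + 1\<close>, since otherwise a labelling along whose fibres \<open>s\<close> increases isolates
  it; antisymmetrizing over that subsequence removes \<open>s\<close>.\<close>

lemma second_fundamental_theorem:
  assumes "finite D"
    and "\<And>f h. f \<in> funs D \<Longrightarrow> h \<in> funs D \<Longrightarrow> (\<Sum>s\<in>perms D. a s * perm_entry D s (f, h)) = 0"
  shows "trace_comb D a w \<in> N"
proof -
  \<comment> \<open>The induction runs over a strict bound \<open>k\<close> for the ranks in the
    support of \<open>a\<close>.\<close>
  have "trace_comb D a w \<in> N"
    if "\<And>s. s \<in> perms D \<Longrightarrow> a s \<noteq> 0 \<Longrightarrow> lex_rank D s < k"
      "\<And>f h. f \<in> funs D \<Longrightarrow> h \<in> funs D \<Longrightarrow> (\<Sum>s\<in>perms D. a s * perm_entry D s (f, h)) = 0"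
    for k a
    using that
  proof (induction k arbitrary: a)
    case 0
    then show ?case by (force simp: trace_comb_def q_zero N_zero)
  next
    case (Suc k)
    have fin: "finite (perms D)" using assms(1) by (rule finite_perms)
    show ?case
    proof (cases "\<exists>s\<in>perms D. a s \<noteq> 0 \<and> lex_rank D s = k")
      case False
      then have "lex_rank D s < k" if "s \<in> perms D" "a s \<noteq> 0" for s
        using Suc.prems(1)[OF that] that less_antisym by blast
      then show ?thesis using Suc.IH Suc.prems(2) by blast
    next
      case True
      then obtain s where s: "s \<in> perms D" "a s \<noteq> 0" "lex_rank D s = k" by blast
      have sp: "s permutes D" using s(1) by (simp add: perms_def)
      have small: "lex_rank D r < k" if "r \<in> perms D" "a r \<noteq> 0" "r \<noteq> s" for r
        using Suc.prems(1)[OF that(1,2)] lex_rank_inj[OF assms(1) that(1) s(1)] s(3) that(3)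
        by (metis less_antisym)
      have injs: "inj_on s D" using sp by (rule permutes_inj_on)
      show ?thesis
      proof (cases "\<exists>P\<subseteq>D. decreasing_on P s \<and> card P = Suc n")
        case False
        then have no: "\<And>P. P \<subseteq> D \<Longrightarrow> decreasing_on P s \<Longrightarrow> card P \<noteq> Suc n" by blast
        have "\<exists>f. f ` D \<subseteq> {..<n} \<and> (\<forall>x\<in>D. \<forall>y\<in>D. x < y \<longrightarrow> f x = f y \<longrightarrow> s x < s y)"
          by (rule decreasing_or_labelling[OF assms(1) injs no])
        then obtain f where f: "f ` D \<subseteq> {..<n}"
          "\<forall>x\<in>D. \<forall>y\<in>D. x < y \<longrightarrow> f x = f y \<longrightarrow> s x < s y" by (elim exE conjE)
        \<comment> \<open>The entry of \<open>s\<close> at \<open>(g, h)\<close> is 1, as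
          \<open>g\<close> is the labelling transported by \<open>s\<close>. Any other permutation
          of the support with entry 1 there would exceed \<open>s\<close> lexicographically, so the
          vanishing sum at this entry equals \<open>a s\<close>, a contradiction.\<close>
        define h where "h = restrict f D"
        define g where "g = restrict (f \<circ> inv_into UNIV s) D"
        have invD: "inv_into UNIV s x \<in> D" if "x \<in> D" for x
          using that permutes_inv[OF sp] by (simp add: permutes_in_image)
        have h: "h \<in> funs D" using f(1) by (auto simp: h_def)
        have g: "g \<in> funs D" using f(1) invD by (fastforce simp: g_def image_subset_iff)
        have iff: "a r = 0 \<or> ((\<forall>x\<in>D. g (r x) = h x) \<longleftrightarrow> r = s)" if r: "r \<in> perms D" for r
        proof (cases "r = s")
          case True
          have "g (s x) = h x" if "x \<in> D" for x
            using that sp by (simp add: g_def h_def permutes_in_image permutes_inverses)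
          then show ?thesis using True by simp
        next
          case ne: False
          have "\<not> (\<forall>x\<in>D. g (r x) = h x)" if "a r \<noteq> 0"
          proof
            assume eq: "\<forall>x\<in>D. g (r x) = h x"
            have rp: "r permutes D" using r by (simp add: perms_def)
            obtain x where x: "x \<in> D" "r x \<noteq> s x" "\<forall>y<x. r y = s y"
              using least_difference[OF r s(1) ne] by blast
            define y where "y = inv_into UNIV s (r x)"
            have y: "s y = r x" "y \<in> D"
              using sp rp x(1) invD by (auto simp: y_def permutes_inverses permutes_in_image)
            have "f y = f x" using eq x(1) rp by (auto simp: g_def h_def y_def permutes_in_image)
            have "\<not> y < x"
            proof
              assume "y < x"
              then have "r y = r x" using x(3) y(1) by simp
              then have "y = x" using rp by (metis permutes_inj injD)
              with \<open>y < x\<close> show False by simp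
            qed
            moreover have "y \<noteq> x" using y(1) x(2) by auto
            ultimately have "x < y" by simp
            then have "s x < r x" using f(2)[rule_format, OF x(1) y(2)] \<open>f y = f x\<close> y(1) by simp
            moreover have "\<forall>z\<in>D. z < x \<longrightarrow> s z = r z" using x(3) by simp
            ultimately have "lex_less D s r" using x(1) unfolding lex_less_def by blast
            then have "lex_rank D s < lex_rank D r" by (rule lex_rank_less[OF assms(1) s(1)])
            then show False using small[OF r that ne] s(3) by simp
          qed
          then show ?thesis using ne by blast
        qed
        have "(\<Sum>r\<in>perms D. a r * perm_entry D r (g, h)) = (\<Sum>r\<in>perms D. a r * of_bool (r = s))"
          unfolding perm_entry_def prod.case
        proof (rule sum.cong[OF refl])
          fix r assume "r \<in> perms D"
          from iff[OF this] show "a r * of_bool (\<forall>x\<in>D. g (r x) = h x) = a r * of_bool (r = s)"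
            by (elim disjE) simp_all
        qed
        also have "\<dots> = a s" by (rule sum_mult_of_bool[OF fin s(1)]) simp
        finally show ?thesis using Suc.prems(2)[OF g h] s(2) by simp
      next
        case True
        then obtain P where P: "P \<subseteq> D" "decreasing_on P s" "card P = Suc n" by blast
        have finP: "finite (perms P)" using P(1) assms(1) by (intro finite_perms finite_subset[OF P(1)])
        have sPp: "s \<circ> p \<in> perms D" if "p \<in> perms P" for p
          using that P(1) sp by (auto simp: perms_def intro: permutes_compose permutes_subset)
        \<comment> \<open>Coefficients of \<open>s\<close> times the antisymmetrizer of
          \<open>P\<close>, an element that vanishes both on tensors and, modulo \<open>N\<close>,
          on traces.\<close>
        define c where "c r = (\<Sum>p\<in>perms P. of_int (sign p) * of_bool (r = s \<circ> p) :: rat)" for r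
        have csum: "(\<Sum>r\<in>perms D. q (c r) * z r) = (\<Sum>p\<in>perms P. of_int (sign p) * z (s \<circ> p))" for z
        proof -
          have "q (c r) * z r = (\<Sum>p\<in>perms P. of_int (sign p) * (z r * of_bool (r = s \<circ> p)))" for r
            unfolding c_def q_sum sum_distrib_right
            by (intro sum.cong) (auto simp: q_mult q_sign q_one q_zero)
          then have "(\<Sum>r\<in>perms D. q (c r) * z r) =
              (\<Sum>p\<in>perms P. of_int (sign p) * (\<Sum>r\<in>perms D. z r * of_bool (r = s \<circ> p)))"
            by (simp only: sum_distrib_left) (rule sum.swap)
          also have "\<dots> = (\<Sum>p\<in>perms P. of_int (sign p) * z (s \<circ> p))"
            by (intro sum.cong refl arg_cong2[where f = "(*)"] sum_mult_of_bool[OF fin sPp]) simp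
          finally show ?thesis .
        qed
        have csum': "(\<Sum>r\<in>perms D. c r * z r) = (\<Sum>p\<in>perms P. of_int (sign p) * z (s \<circ> p))"
          for z :: "_ \<Rightarrow> rat"
        proof -
          have "c r * z r = (\<Sum>p\<in>perms P. of_int (sign p) * (z r * of_bool (r = s \<circ> p)))" for r
            unfolding c_def sum_distrib_right by (intro sum.cong) auto
          then have "(\<Sum>r\<in>perms D. c r * z r) =
              (\<Sum>p\<in>perms P. of_int (sign p) * (\<Sum>r\<in>perms D. z r * of_bool (r = s \<circ> p)))"
            by (simp only: sum_distrib_left) (rule sum.swap)
          also have "\<dots> = (\<Sum>p\<in>perms P. of_int (sign p) * z (s \<circ> p))"
            by (intro sum.cong refl arg_cong2[where f = "(*)"] sum_mult_of_bool[OF fin sPp]) simp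
          finally show ?thesis .
        qed
        have compinj: "s \<circ> p = s \<circ> p' \<longleftrightarrow> p = p'" for p p'
          using permutes_inj[OF sp] by (auto simp: fun_eq_iff inj_def)
        have idP: "id \<in> perms P" by (simp add: perms_def permutes_id)
        have cs: "c s = 1"
        proof -
          have "c s = (\<Sum>p\<in>perms P. of_int (sign p) * of_bool (p = id))"
            unfolding c_def using compinj[of id] by (intro sum.cong refl) (auto simp: eq_commute)
          also have "\<dots> = of_int (sign (id :: nat \<Rightarrow> nat))"
            by (rule sum_mult_of_bool[OF finP idP]) simp
          finally show ?thesis by simp
        qed
        \<comment> \<open>Since \<open>c s = 1\<close>, this cancels the leading coefficient; what
          it introduces are the \<open>s \<circ> p\<close> with
          \<open>p \<noteq> id\<close>.\<close>
        define b where "b r = a r - a s * c r" for r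
        have "trace_comb D b w \<in> N"
        proof (rule Suc.IH)
          fix r assume r: "r \<in> perms D" "b r \<noteq> 0"
          have rs: "r \<noteq> s" using r(2) cs by (auto simp: b_def)
          show "lex_rank D r < k"
          proof (cases "a r = 0")
            case False
            then show ?thesis using small r(1) rs by blast
          next
            case True
            then have "c r \<noteq> 0" using r(2) by (auto simp: b_def)
            then obtain p where p: "p \<in> perms P" "r = s \<circ> p"
            proof -
              from \<open>c r \<noteq> 0\<close> obtain p where "p \<in> perms P"
                "of_int (sign p) * of_bool (r = s \<circ> p) \<noteq> (0 :: rat)"
                unfolding c_def by (rule sum.not_neutral_contains_not_neutral)
              then show ?thesis using that by (cases "r = s \<circ> p") auto
            qed
            \<comment> \<open>The first point moved by \<open>p\<close> is moved upwards, and
              \<open>s\<close> decreases on \<open>P\<close>, so the first change from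
              \<open>s\<close> to \<open>s \<circ> p\<close> lowers a value.\<close>
            have "p \<noteq> id" using p(2) rs by auto
            then obtain x where x: "x \<in> P" "p x \<noteq> x" "\<forall>y<x. p y = y"
              using least_difference[OF p(1) idP] by auto
            have px: "p x \<in> P" using p(1) x(1) by (simp add: perms_def permutes_in_image)
            have "\<not> p x < x"
            proof
              assume "p x < x"
              then have "p (p x) = p x" using x(3) by simp
              then have "p x = x" using p(1) by (metis perms_def mem_Collect_eq permutes_inj injD)
              with x(2) show False by simp
            qed
            with x(2) have "x < p x" by simp
            then have "s (p x) < s x" using P(2) x(1) px unfolding decreasing_on_def by blast
            moreover have "\<forall>y\<in>D. y < x \<longrightarrow> r y = s y" using x(3) p(2) by simp
            ultimately have "lex_less D r s"
              using x(1) P(1) p(2) unfolding lex_less_def by auto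
            from lex_rank_less[OF assms(1) r(1) this] show ?thesis using s(3) by simp
          qed
        next
          fix f h assume fh: "f \<in> funs D" "h \<in> funs D"
          then have fpi: "f \<in> D \<rightarrow> {..<n}" by auto
          have "(\<Sum>r\<in>perms D. b r * perm_entry D r (f, h)) =
              (\<Sum>r\<in>perms D. a r * perm_entry D r (f, h)) - a s * (\<Sum>r\<in>perms D. c r * perm_entry D r (f, h))"
            by (simp only: b_def left_diff_distrib sum_subtractf sum_distrib_left mult.assoc)
          also have "\<dots> = 0"
            unfolding csum' using alternating_sum_perm_entry[OF P(1,3) fpi sp, of h] Suc.prems(2)[OF fh]
            by simp
          finally show "(\<Sum>r\<in>perms D. b r * perm_entry D r (f, h)) = 0" .
        qed
        moreover have "trace_comb D a w = trace_comb D b w + q (a s) * trace_comb D c w"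
          unfolding trace_comb_def b_def
          by (simp add: q_diff q_mult left_diff_distrib sum_subtractf sum_distrib_left mult.assoc)
        moreover have "trace_comb D c w \<in> N"
          unfolding trace_comb_def csum by (rule alternating_sum_cycle_prod[OF assms(1) P(1,3) sp])
        ultimately show ?thesis using N_add N_mult by simp
      qed
    qed
  qed
  from this[of a "Suc (Max (lex_rank D ` perms D))"] show ?thesis
    using assms finite_perms[OF assms(1)] by (simp add: less_Suc_eq_le)
qed

end

section \<open>Invariant integration of products of matrix entries\<close>

text \<open>Cuts \<open>k\<close> out of its cycle: the predecessor of \<open>k\<close> is sent to
  \<open>r k\<close> and \<open>k\<close> becomes fixed.\<close>

definition reduce :: "nat \<Rightarrow> (nat \<Rightarrow> nat) \<Rightarrow> nat \<Rightarrow> nat" where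
  "reduce k r = transpose k (r k) \<circ> r"

lemma reduce_perms: "r \<in> perms (insert k D) \<Longrightarrow> reduce k r \<in> perms D"
  by (simp add: perms_def reduce_def permutes_insert_lemma)

lemma perms_insert: "s \<in> perms D \<Longrightarrow> s \<in> perms (insert k D)"
  by (auto simp: perms_def intro: permutes_subset)

lemma perms_in: "s \<in> perms D \<Longrightarrow> s x \<in> D \<longleftrightarrow> x \<in> D"
  by (simp add: perms_def permutes_in_image)

lemma perms_fixed: "s \<in> perms D \<Longrightarrow> k \<notin> D \<Longrightarrow> s k = k"
  by (simp add: perms_def permutes_not_in)

lemma perms_eq_iff: "s \<in> perms D \<Longrightarrow> s x = s y \<longleftrightarrow> x = y"
  using permutes_inj[of s D] by (auto simp: perms_def inj_def)

text \<open>Summing over the index at \<open>k\<close> is the partial trace.\<close>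

lemma partial_trace:
  assumes k: "k \<notin> D" and r: "r \<in> perms (insert k D)" and f: "\<And>x. x \<in> D \<Longrightarrow> f x < n"
  shows "(\<Sum>c<n. of_bool (\<forall>x\<in>insert k D. (f(k := c)) (r x) = (h(k := c)) x)) =
    (if r k = k then of_nat n else 1) * (of_bool (\<forall>x\<in>D. f (reduce k r x) = h x) :: rat)"
proof (cases "r k = k")
  case True
  have rk: "r x \<noteq> k" if "x \<in> D" for x using perms_eq_iff[OF r, of x k] True that k by auto
  have "(\<forall>x\<in>insert k D. (f(k := c)) (r x) = (h(k := c)) x) \<longleftrightarrow> (\<forall>x\<in>D. f (r x) = h x)" for c
  proof -
    have "(f(k := c)) (r x) = (h(k := c)) x \<longleftrightarrow> f (r x) = h x" if "x \<in> D" for x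
      using rk[OF that] that k by auto
    then show ?thesis using True by simp
  qed
  moreover have "reduce k r = r" using True by (simp add: reduce_def)
  ultimately show ?thesis using True by simp
next
  case False
  have qD: "r k \<in> D" using perms_in[OF r, of k] False by simp
  obtain p where p: "r p = k" using r unfolding perms_def by (metis mem_Collect_eq permutes_surj surjD)
  have "p \<noteq> k" using p False by auto
  moreover have "p \<in> insert k D" using perms_in[OF r, of p] p by simp
  ultimately have pD: "p \<in> D" by simp
  have red_p: "reduce k r p = r k" using p by (simp add: reduce_def)
  have red: "reduce k r x = r x" "r x \<noteq> k" if "x \<in> D" "x \<noteq> p" for x
  proof -
    show "r x \<noteq> k" using perms_eq_iff[OF r, of x p] p that by simp
    moreover have "r x \<noteq> r k" using perms_eq_iff[OF r, of x k] that k by auto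
    ultimately show "reduce k r x = r x" by (simp add: reduce_def)
  qed
  \<comment> \<open>The condition at \<open>k\<close> forces \<open>c = f (r k)\<close>; inserted
    into the condition at the predecessor \<open>p\<close>, it gives the condition of the reduced
    permutation there.\<close>
  have eq: "(\<forall>x\<in>insert k D. (f(k := c)) (r x) = (h(k := c)) x) \<longleftrightarrow>
      (\<forall>x\<in>D. f (reduce k r x) = h x) \<and> c = f (r k)" for c
  proof -
    have 1: "(f(k := c)) (r k) = (h(k := c)) k \<longleftrightarrow> c = f (r k)" using False by auto
    have 2: "(f(k := c)) (r x) = (h(k := c)) x \<longleftrightarrow> f (reduce k r x) = h x"
      if "x \<in> D" "c = f (r k)" for x
    proof (cases "x = p")
      case True
      then show ?thesis using that \<open>p \<noteq> k\<close> p red_p by simp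
    next
      case False
      then show ?thesis using red[OF that(1) False] that(1) k by auto
    qed
    have 3: "(\<forall>x\<in>insert k D. P x) \<longleftrightarrow> P k \<and> (\<forall>x\<in>D. P x)" for P by blast
    show ?thesis unfolding 3 1 using 2 by blast
  qed
  have "(\<Sum>c<n. of_bool (\<forall>x\<in>insert k D. (f(k := c)) (r x) = (h(k := c)) x)) =
      (\<Sum>c<n. of_bool (\<forall>x\<in>D. f (reduce k r x) = h x) * (of_bool (c = f (r k)) :: rat))"
    by (intro sum.cong refl) (simp only: eq of_bool_conj)
  also have "\<dots> = of_bool (\<forall>x\<in>D. f (reduce k r x) = h x)"
    by (rule sum_mult_of_bool[where a = "f (r k)"]) (use f[OF qD] in auto)
  finally show ?thesis using False by simp
qed

context trace_ideal
begin

text \<open>For permutations of \<open>D\<close> this is n to the number of cycles of s^{-1} r,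
  written as a count of colourings by \<open>n\<close> colours so that single indices can be summed
  out.\<close>

definition gram :: "nat set \<Rightarrow> (nat \<Rightarrow> nat) \<Rightarrow> (nat \<Rightarrow> nat) \<Rightarrow> rat" where
  "gram D s r = (\<Sum>f\<in>funs D. of_bool (\<forall>x\<in>D. f (s x) = f (r x)))"

lemma finite_funs: "finite D \<Longrightarrow> finite (funs D)"
  by (intro finite_PiE) auto

lemma gram_sym: "gram D s r = gram D r s"
  by (simp add: gram_def eq_commute)

text \<open>For a fixed row \<open>f\<close> only the column \<open>f \<circ> s\<close> contributes,
  so the inner product of the two matrices collapses to a sum over rows.\<close>

lemma gram_perm_entry:
  assumes "finite D" "s \<in> perms D"
  shows "(\<Sum>p\<in>funs D \<times> funs D. perm_entry D s p * perm_entry D r p) = gram D s r"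
proof -
  have "(\<Sum>h\<in>funs D. perm_entry D s (f, h) * perm_entry D r (f, h)) =
      of_bool (\<forall>x\<in>D. f (s x) = f (r x))" if f: "f \<in> funs D" for f
  proof -
    define z where "z = restrict (f \<circ> s) D"
    have z: "z \<in> funs D" using f perms_in[OF assms(2)] by (auto simp: z_def)
    have eq: "h = z" if "h \<in> funs D" "\<forall>x\<in>D. f (s x) = h x" for h
      by (rule PiE_ext[OF that(1) z]) (use that(2) in \<open>simp add: z_def\<close>)
    have "(\<Sum>h\<in>funs D. perm_entry D s (f, h) * perm_entry D r (f, h)) =
        (\<Sum>h\<in>funs D. perm_entry D r (f, h) * of_bool (\<forall>x\<in>D. f (s x) = h x))"
      by (simp add: perm_entry_def mult.commute)
    also have "\<dots> = perm_entry D r (f, z)"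
      using eq by (intro sum_mult_of_bool[OF finite_funs[OF assms(1)] z]) (auto simp: z_def)
    finally show ?thesis by (simp add: perm_entry_def z_def eq_commute)
  qed
  then have "(\<Sum>f\<in>funs D. \<Sum>h\<in>funs D. perm_entry D s (f, h) * perm_entry D r (f, h)) = gram D s r"
    unfolding gram_def by (rule sum.cong[OF refl])
  then show ?thesis by (simp only: sum.cartesian_product case_prod_eta split_def prod.collapse)
qed

lemma sum_funs_insert:
  assumes "finite D" "k \<notin> D"
  shows "(\<Sum>f\<in>funs (insert k D). F f) = (\<Sum>g\<in>funs D. \<Sum>c<n. F (g(k := c)))"
proof -
  have "(\<Sum>f\<in>funs (insert k D). F f) = (\<Sum>(c, g)\<in>{..<n} \<times> funs D. F (g(k := c)))"
    unfolding PiE_insert_eq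
    by (subst sum.reindex[OF inj_combinator[OF assms(2)]]) (simp add: case_prod_beta comp_def)
  also have "\<dots> = (\<Sum>c<n. \<Sum>g\<in>funs D. F (g(k := c)))"
    by (simp add: sum.cartesian_product)
  also have "\<dots> = (\<Sum>g\<in>funs D. \<Sum>c<n. F (g(k := c)))" by (rule sum.swap)
  finally show ?thesis .
qed

definition weight :: "nat \<Rightarrow> (nat \<Rightarrow> nat) \<Rightarrow> rat" where
  "weight k r = (if r k = k then of_nat n else 1)"

text \<open>Since \<open>s\<close> acts as the identity in slot \<open>k\<close>, pairing with it
  takes the partial trace of \<open>r\<close> in that slot.\<close>

lemma gram_insert:
  assumes "finite D" "k \<notin> D" "s \<in> perms D" "r \<in> perms (insert k D)"
  shows "gram (insert k D) s r = weight k r * gram D s (reduce k r)"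
proof -
  have sk: "s k = k" using perms_fixed[OF assms(3,2)] .
  have "(\<Sum>c<n. of_bool (\<forall>x\<in>insert k D. (g(k := c)) (s x) = (g(k := c)) (r x))) =
      weight k r * of_bool (\<forall>x\<in>D. g (s x) = g (reduce k r x))" if g: "g \<in> funs D" for g
  proof -
    have "(g(k := c)) (s x) = ((g \<circ> s)(k := c)) x" if "x \<in> insert k D" for x c
      using that sk perms_in[OF assms(3), of x] assms(2) by auto
    then have "(\<Sum>c<n. of_bool (\<forall>x\<in>insert k D. (g(k := c)) (s x) = (g(k := c)) (r x))) =
        (\<Sum>c<n. of_bool (\<forall>x\<in>insert k D. (g(k := c)) (r x) = ((g \<circ> s)(k := c)) x) :: rat)"
      by (intro sum.cong refl arg_cong[where f = of_bool] ball_cong) auto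
    also have "\<dots> = weight k r * of_bool (\<forall>x\<in>D. g (reduce k r x) = (g \<circ> s) x)"
      unfolding weight_def by (rule partial_trace[OF assms(2,4)]) (use g in auto)
    finally show ?thesis by (simp add: eq_commute)
  qed
  then show ?thesis
    unfolding gram_def sum_funs_insert[OF assms(1,2)] sum_distrib_left by (intro sum.cong refl) 
qed

lemma sum_funs_comp:
  assumes p: "p \<in> perms D"
  shows "(\<Sum>f\<in>funs D. F (f \<circ> p)) = (\<Sum>f\<in>funs D. F f)"
proof (rule sum.reindex_bij_betw)
  define p' where "p' = inv_into UNIV p"
  have p': "p' \<in> perms D" "p \<circ> p' = id" "p' \<circ> p = id"
    using p permutes_inv permutes_inv_o by (auto simp: perms_def p'_def)
  have mem: "f \<circ> r \<in> funs D" if "f \<in> funs D" "r \<in> perms D" for f r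
    using that perms_in[OF that(2)] perms_fixed[OF that(2)] by (auto simp: PiE_iff extensional_def)
  show "bij_betw (\<lambda>f. f \<circ> p) (funs D) (funs D)"
    using mem p p' by (intro bij_betw_byWitness[where f' = "\<lambda>f. f \<circ> p'"]) (auto simp: comp_assoc)
qed

text \<open>An involution is its own inverse, so substituting \<open>f \<circ> \<theta>\<close> for
  \<open>f\<close> moves it to the other side of the pairing.\<close>

lemma gram_comp_left:
  assumes "\<theta> \<in> perms D" "\<theta> \<circ> \<theta> = id"
  shows "gram D (\<theta> \<circ> s) r = gram D s (\<theta> \<circ> r)"
proof -
  have "\<theta> (\<theta> x) = x" for x using assms(2) by (metis comp_apply id_apply)
  then show ?thesis
    unfolding gram_def
    using sum_funs_comp[OF assms(1), of "\<lambda>f. of_bool (\<forall>x\<in>D. f ((\<theta> \<circ> s) x) = f (r x)) :: rat"] by simp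
qed

text \<open>The pairing of the matrix unit with indices \<open>(i, j)\<close> with the permutation \<open>r\<close>.\<close>

definition target :: "nat set \<Rightarrow> (nat \<Rightarrow> nat) \<Rightarrow> (nat \<Rightarrow> nat) \<Rightarrow> (nat \<Rightarrow> nat) \<Rightarrow> rat" where
  "target D i j r = of_bool ((\<forall>x\<in>D. i x < n) \<and> (\<forall>x\<in>D. i (r x) = j x))"

definition pairing :: "nat set \<Rightarrow> ((nat \<Rightarrow> nat) \<Rightarrow> rat) \<Rightarrow> (nat \<Rightarrow> nat) \<Rightarrow> rat" where
  "pairing D a r = (\<Sum>s\<in>perms D. a s * gram D s r)"

text \<open>The matrix unit with indices \<open>(i, j)\<close> is projected to the span of the
  permutation matrices.\<close>

lemma exists_pairing_target:
  assumes "finite D"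
  shows "\<exists>a. \<forall>r\<in>perms D. pairing D a r = target D i j r"
proof -
  let ?Y = "funs D \<times> funs D"
  \<comment> \<open>With an index out of range the distinguished pair lies outside
    \<open>?Y\<close>, and \<open>e\<close> is the zero matrix.\<close>
  define e :: "(nat \<Rightarrow> nat) \<times> (nat \<Rightarrow> nat) \<Rightarrow> rat" where
    "e p = of_bool (p = (restrict i D, restrict j D))" for p
  have "finite ?Y" using finite_funs[OF assms] by simp
  then obtain a where a: "\<And>r. r \<in> perms D \<Longrightarrow>
      (\<Sum>s\<in>perms D. a s * (\<Sum>p\<in>?Y. perm_entry D s p * perm_entry D r p)) = (\<Sum>p\<in>?Y. e p * perm_entry D r p)"
    using exists_orthogonal_projection[OF finite_perms[OF assms] \<open>finite ?Y\<close>, of "perm_entry D" e]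
    by (elim exE) blast
  have "(\<Sum>p\<in>?Y. e p * perm_entry D r p) = target D i j r" if r: "r \<in> perms D" for r
  proof (cases "(\<forall>x\<in>D. i x < n) \<and> (\<forall>x\<in>D. j x < n)")
    case True
    then have "(restrict i D, restrict j D) \<in> ?Y" by auto
    then have "(\<Sum>p\<in>?Y. perm_entry D r p * e p) = perm_entry D r (restrict i D, restrict j D)"
      unfolding e_def using \<open>finite ?Y\<close> by (intro sum_mult_of_bool) auto
    then show ?thesis using True perms_in[OF r]
      by (simp add: perm_entry_def target_def mult.commute)
  next
    case False
    have "e p = 0" if "p \<in> ?Y" for p
    proof -
      have "p \<noteq> (restrict i D, restrict j D)" using False that by (force simp: PiE_iff)
      then show ?thesis by (simp add: e_def)
    qed
    \<comment> \<open>The bound on \<open>i\<close> in \<open>target\<close> passes to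
      \<open>j\<close>, because \<open>r\<close> permutes \<open>D\<close> and
      \<open>i \<circ> r\<close> agrees with \<open>j\<close> there.\<close>
    moreover have "target D i j r = 0"
    proof -
      have "\<not> ((\<forall>x\<in>D. i x < n) \<and> (\<forall>x\<in>D. i (r x) = j x))"
      proof
        assume *: "(\<forall>x\<in>D. i x < n) \<and> (\<forall>x\<in>D. i (r x) = j x)"
        then have "j x < n" if "x \<in> D" for x using that perms_in[OF r, of x] by metis
        with False * show False by blast
      qed
      then show ?thesis unfolding target_def by (simp only: of_bool_eq)
    qed
    ultimately show ?thesis by simp
  qed
  then show ?thesis
    using a gram_perm_entry[OF assms] unfolding pairing_def by (intro exI[of _ a] ballI) simp
qed

text \<open>Equal pairings mean equal action on tensors, by positive definiteness; the second
  fundamental theorem turns this into a congruence. All later identities are checked on pairings for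
  this reason.\<close>

lemma trace_comb_eq:
  assumes "finite D" "\<And>r. r \<in> perms D \<Longrightarrow> pairing D a r = pairing D b r"
  shows "trace_comb D a w - trace_comb D b w \<in> N"
proof -
  let ?c = "\<lambda>s. a s - b s"
  have "trace_comb D ?c w \<in> N"
  proof (rule second_fundamental_theorem[OF assms(1)])
    fix f h assume fh: "f \<in> funs D" "h \<in> funs D"
    show "(\<Sum>s\<in>perms D. (a s - b s) * perm_entry D s (f, h)) = 0"
    proof (rule gram_kernel[OF finite_perms[OF assms(1)], where Y = "funs D \<times> funs D"])
      show "finite (funs D \<times> funs D)" using finite_funs[OF assms(1)] by simp
      fix r assume r: "r \<in> perms D"
      show "(\<Sum>s\<in>perms D. (a s - b s) * (\<Sum>p\<in>funs D \<times> funs D. perm_entry D s p * perm_entry D r p)) = 0"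
        using assms(2)[OF r] gram_perm_entry[OF assms(1)]
        by (simp add: pairing_def left_diff_distrib sum_subtractf)
    qed (use fh in auto)
  qed
  then show ?thesis by (simp add: trace_comb_def q_diff left_diff_distrib sum_subtractf)
qed

section \<open>Weingarten coefficients and averages of products of matrix entries\<close>

text \<open>An arbitrary solution: it is not unique once \<open>D\<close> has more than
  \<open>n\<close> elements, and it is accessible only through its pairings.\<close>

definition weingarten :: "nat set \<Rightarrow> (nat \<Rightarrow> nat) \<Rightarrow> (nat \<Rightarrow> nat) \<Rightarrow> (nat \<Rightarrow> nat) \<Rightarrow> rat" where
  "weingarten D i j = (SOME a. \<forall>r\<in>perms D. pairing D a r = target D i j r)"

lemma pairing_weingarten:
  assumes "finite D" "r \<in> perms D" shows "pairing D (weingarten D i j) r = target D i j r"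
  using someI_ex[OF exists_pairing_target[OF assms(1), of i j]] assms(2) unfolding weingarten_def by blast

text \<open>The value of the invariant integral of \<open>\<Prod>\<^sub>k\<^sub>\<in>\<^sub>D (w k)\<^sub>i\<^sub>k\<^sub>,\<^sub>j\<^sub>k\<close>, the product of matrix entries.\<close>

definition reynolds :: "nat set \<Rightarrow> (nat \<Rightarrow> nat) \<Rightarrow> (nat \<Rightarrow> nat) \<Rightarrow> (nat \<Rightarrow> 'g list) \<Rightarrow> 'r" where
  "reynolds D i j w = trace_comb D (weingarten D i j) w"

lemma reynolds_eq:
  assumes "finite D" "\<And>r. r \<in> perms D \<Longrightarrow> pairing D a r = target D i j r"
  shows "reynolds D i j w - trace_comb D a w \<in> N"
  unfolding reynolds_def using assms by (intro trace_comb_eq) (auto simp: pairing_weingarten)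

lemma pairing_sum: "pairing D (\<lambda>s. \<Sum>c\<in>C. a c s) r = (\<Sum>c\<in>C. pairing D (a c) r)"
  unfolding pairing_def sum_distrib_right by (rule sum.swap)

lemma trace_comb_sum: "trace_comb D (\<lambda>s. \<Sum>c\<in>C. a c s) w = (\<Sum>c\<in>C. trace_comb D (a c) w)"
  unfolding trace_comb_def q_sum sum_distrib_right by (rule sum.swap)

lemma reynolds_cong:
  assumes "finite D" "\<And>x. x \<in> D \<Longrightarrow> i x = i' x" "\<And>x. x \<in> D \<Longrightarrow> j x = j' x" "\<And>x. x \<in> D \<Longrightarrow> w x = w' x"
  shows "reynolds D i j w = reynolds D i' j' w'"
proof -
  have "target D i j r = target D i' j' r" if "r \<in> perms D" for r
    unfolding target_def using assms(2,3) perms_in[OF that]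
    by (intro arg_cong[where f = of_bool] conj_cong ball_cong refl) auto
  then have "weingarten D i j = weingarten D i' j'" unfolding weingarten_def by simp
  moreover have "cycle_prod \<tau> D s w = cycle_prod \<tau> D s w'" if "s \<in> perms D" for s
    by (rule cycle_prod_cong) (use assms perms_in[OF that] in auto)
  ultimately show ?thesis by (simp add: reynolds_def trace_comb_def)
qed

section \<open>Rules for averages: contraction, unit, linearity, relabelling\<close>

text \<open>Common source of the trace and product rules: \<open>\<theta> = id\<close> closes slot
  \<open>k\<close> on itself, and the transposition of \<open>k\<close> and \<open>l\<close> plugs
  it into slot \<open>l\<close>. On both sides, pairing with \<open>r\<close> comes down to the
  partial trace of \<open>\<theta> \<circ> r\<close> at \<open>k\<close>.\<close>

lemma reynolds_extend:
  assumes "finite D" "k \<notin> D" "\<theta> \<in> perms (insert k D)" "\<theta> \<circ> \<theta> = id"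
  shows "(\<Sum>c<n. reynolds (insert k D) (i(k := c) \<circ> \<theta>) (j(k := c)) w) -
    (\<Sum>s\<in>perms D. q (weingarten D i j s) * cycle_prod \<tau> (insert k D) (\<theta> \<circ> s) w) \<in> N"
proof -
  let ?D = "insert k D"
  have fin: "finite ?D" using assms(1) by simp
  have tt: "\<theta> (\<theta> x) = x" for x using assms(4) by (metis comp_apply id_apply)
  have comp: "\<theta> \<circ> r \<in> perms ?D" if "r \<in> perms ?D" for r
    using that assms(3) by (auto simp: perms_def intro: permutes_compose)
  have sub: "\<theta> \<circ> s \<in> perms ?D" if "s \<in> perms D" for s
    using comp perms_insert[OF that] by blast
  \<comment> \<open>The coefficients on \<open>D\<close>, pushed forward along
    \<open>s \<mapsto> \<theta> \<circ> s\<close>.\<close>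
  define a where "a r = (\<Sum>s\<in>perms D. weingarten D i j s * of_bool (r = \<theta> \<circ> s))" for r
  have swap: "(\<Sum>r\<in>perms ?D. a r * z r) = (\<Sum>s\<in>perms D. weingarten D i j s * z (\<theta> \<circ> s))" for z
  proof -
    have "(\<Sum>r\<in>perms ?D. a r * z r) =
        (\<Sum>s\<in>perms D. weingarten D i j s * (\<Sum>r\<in>perms ?D. z r * of_bool (r = \<theta> \<circ> s)))"
      unfolding a_def sum_distrib_right sum_distrib_left by (subst sum.swap) (simp add: mult_ac)
    also have "\<dots> = (\<Sum>s\<in>perms D. weingarten D i j s * z (\<theta> \<circ> s))"
      by (intro sum.cong refl arg_cong2[where f = "(*)"] sum_mult_of_bool[OF finite_perms[OF fin] sub]) simp
    finally show ?thesis .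
  qed
  have swapq: "(\<Sum>r\<in>perms ?D. q (a r) * z r) = (\<Sum>s\<in>perms D. q (weingarten D i j s) * z (\<theta> \<circ> s))" for z
  proof -
    have "q (a r) * z r = (\<Sum>s\<in>perms D. q (weingarten D i j s) * (z r * of_bool (r = \<theta> \<circ> s)))" for r
      unfolding a_def q_sum sum_distrib_right
      by (intro sum.cong) (auto simp: q_mult q_one q_zero)
    then have "(\<Sum>r\<in>perms ?D. q (a r) * z r) =
        (\<Sum>s\<in>perms D. q (weingarten D i j s) * (\<Sum>r\<in>perms ?D. z r * of_bool (r = \<theta> \<circ> s)))"
      by (simp only: sum_distrib_left) (rule sum.swap)
    also have "\<dots> = (\<Sum>s\<in>perms D. q (weingarten D i j s) * z (\<theta> \<circ> s))"
      by (intro sum.cong refl arg_cong2[where f = "(*)"] sum_mult_of_bool[OF finite_perms[OF fin] sub]) simp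
    finally show ?thesis .
  qed
  have "pairing ?D a r = (\<Sum>c<n. target ?D (i(k := c) \<circ> \<theta>) (j(k := c)) r)" if r: "r \<in> perms ?D" for r
  proof -
    let ?r = "\<theta> \<circ> r"
    have r': "?r \<in> perms ?D" using comp[OF r] .
    have "pairing ?D a r = (\<Sum>s\<in>perms D. weingarten D i j s * gram ?D (\<theta> \<circ> s) r)"
      unfolding pairing_def by (rule swap)
    also have "\<dots> = (\<Sum>s\<in>perms D. weight k ?r * (weingarten D i j s * gram D s (reduce k ?r)))"
      by (intro sum.cong refl)
        (simp add: gram_comp_left[OF assms(3,4)] gram_insert[OF assms(1,2) _ r'] del: comp_apply)
    also have "\<dots> = weight k ?r * pairing D (weingarten D i j) (reduce k ?r)"
      unfolding pairing_def sum_distrib_left ..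
    also have "\<dots> = weight k ?r * target D i j (reduce k ?r)"
      using pairing_weingarten[OF assms(1) reduce_perms[OF r']] by simp
    also have "\<dots> = (\<Sum>c<n. target ?D (i(k := c) \<circ> \<theta>) (j(k := c)) r)"
    proof -
      have range: "(\<forall>x\<in>?D. (i(k := c) \<circ> \<theta>) x < n) \<longleftrightarrow> (\<forall>x\<in>D. i x < n)" if "c < n" for c
      proof -
        have "(\<forall>x\<in>?D. (i(k := c) \<circ> \<theta>) x < n) \<longleftrightarrow> (\<forall>x\<in>?D. (i(k := c)) x < n)"
          using perms_in[OF assms(3)] tt by (metis comp_apply)
        also have "\<dots> \<longleftrightarrow> (\<forall>x\<in>D. i x < n)" using that assms(2) by auto
        finally show ?thesis .
      qed
      show ?thesis
      proof (cases "\<forall>x\<in>D. i x < n")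
        case True
        have "(\<Sum>c<n. target ?D (i(k := c) \<circ> \<theta>) (j(k := c)) r) =
            (\<Sum>c<n. of_bool (\<forall>x\<in>?D. (i(k := c)) (?r x) = (j(k := c)) x))"
          using True range unfolding target_def by (intro sum.cong refl arg_cong[where f = of_bool]) auto
        also have "\<dots> = weight k ?r * of_bool (\<forall>x\<in>D. i (reduce k ?r x) = j x)"
          unfolding weight_def by (rule partial_trace[OF assms(2) r']) (use True in auto)
        finally show ?thesis using True by (simp add: target_def)
      next
        case False
        then have "target ?D (i(k := c) \<circ> \<theta>) (j(k := c)) r = 0" if "c < n" for c
          using range[OF that] unfolding target_def by (simp only: of_bool_eq simp_thms)
        moreover have "target D i j (reduce k ?r) = 0"
          using False unfolding target_def by (simp only: of_bool_eq simp_thms)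
        ultimately show ?thesis by simp
      qed
    qed
    finally show ?thesis .
  qed
  then have "trace_comb ?D (\<lambda>s. \<Sum>c<n. weingarten ?D (i(k := c) \<circ> \<theta>) (j(k := c)) s) w - trace_comb ?D a w \<in> N"
    by (intro trace_comb_eq[OF fin]) (simp add: pairing_sum pairing_weingarten[OF fin])
  then show ?thesis unfolding trace_comb_sum reynolds_def[symmetric] 
    by (simp only: trace_comb_def[of _ a] swapq)
qed

lemma reynolds_trace:
  assumes "finite D" "k \<notin> D"
  shows "(\<Sum>c<n. reynolds (insert k D) (i(k := c)) (j(k := c)) w) - \<tau> (w k) * reynolds D i j w \<in> N"
proof -
  have "(\<Sum>s\<in>perms D. q (weingarten D i j s) * cycle_prod \<tau> (insert k D) (id \<circ> s) w) =
      \<tau> (w k) * reynolds D i j w"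
    unfolding reynolds_def trace_comb_def sum_distrib_left
    using cycle_prod_fixed[OF _ assms] by (intro sum.cong) (auto simp: perms_def mult.left_commute)
  then show ?thesis
    using reynolds_extend[OF assms, of id i j w] by (simp add: perms_def permutes_id)
qed

text \<open>Slot \<open>k\<close> carries the indices \<open>(i l, c)\<close> and slot
  \<open>l\<close> the indices \<open>(c, j l)\<close>: the sum over \<open>c\<close> is an entry of
  the matrix product, and contracting \<open>k\<close> concatenates the two words in the same
  order.\<close>

lemma reynolds_mult:
  assumes "finite D" "k \<notin> D" "l \<in> D"
  shows "(\<Sum>c<n. reynolds (insert k D) (i(k := i l, l := c)) (j(k := c)) w) -
    reynolds D i j (w(l := w k @ w l)) \<in> N"
proof -
  let ?\<theta> = "transpose k l"
  have kl: "k \<noteq> l" using assms by auto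
  have \<theta>: "?\<theta> \<in> perms (insert k D)" "?\<theta> \<circ> ?\<theta> = id"
    using assms by (auto simp: perms_def permutes_swap_id)
  have "cycle_prod \<tau> (insert k D) (?\<theta> \<circ> s) w = cycle_prod \<tau> D s (w(l := w k @ w l))"
    if s: "s \<in> perms D" for s
  proof -
    have p: "?\<theta> \<circ> s permutes insert k D"
      using perms_insert[OF s] \<theta>(1) by (auto simp: perms_def intro: permutes_compose)
    have "(?\<theta> \<circ> s) k = l" using perms_fixed[OF s assms(2)] by simp
    moreover have "transpose k l \<circ> (?\<theta> \<circ> s) = s" using \<theta>(2) by (simp add: fun_eq_iff)
    ultimately show ?thesis
      using cycle_prod_contract[OF p assms(1,2), of l w] kl by simp
  qed
  then have "(\<Sum>s\<in>perms D. q (weingarten D i j s) * cycle_prod \<tau> (insert k D) (?\<theta> \<circ> s) w) =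
      reynolds D i j (w(l := w k @ w l))"
    unfolding reynolds_def trace_comb_def by (intro sum.cong refl) simp
  moreover have "reynolds (insert k D) (i(k := c) \<circ> ?\<theta>) (j(k := c)) w =
      reynolds (insert k D) (i(k := i l, l := c)) (j(k := c)) w" for c
    by (rule reynolds_cong) (use assms kl in \<open>auto simp: transpose_def\<close>)
  ultimately show ?thesis using reynolds_extend[OF assms(1,2) \<theta>, of i j w] by simp
qed

text \<open>Coefficients travel downwards here: every permutation of the larger set is replaced by
  its partial trace at \<open>k\<close>. The bound \<open>p < n\<close> keeps the new index within
  the range tested by \<open>target\<close>.\<close>

lemma reynolds_one:
  assumes "finite D" "k \<notin> D" "p < n"
  shows "reynolds (insert k D) (i(k := p)) (j(k := p')) (w(k := [])) - of_bool (p = p') * reynolds D i j w \<in> N"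
proof -
  let ?D = "insert k D"
  have fin: "finite ?D" using assms(1) by simp
  define a where "a = weingarten ?D (i(k := p)) (j(k := p'))"
  \<comment> \<open>The partial trace at \<open>k\<close> of the combination \<open>a\<close>. It is
    adjoint to adding \<open>k\<close> as a fixed point, so its pairings with permutations of
    \<open>D\<close> are those of \<open>a\<close>.\<close>
  define b where "b s = (\<Sum>r\<in>perms ?D. (weight k r * a r) * of_bool (s = reduce k r))" for s
  have red: "r \<in> perms ?D \<Longrightarrow> reduce k r \<in> perms D" for r by (rule reduce_perms)
  have "pairing D b r = of_bool (p = p') * target D i j r" if r: "r \<in> perms D" for r
  proof -
    have rD: "r \<in> perms ?D" using perms_insert[OF r] .
    have rk: "r k = k" using perms_fixed[OF r assms(2)] .
    have "pairing D b r =
        (\<Sum>u\<in>perms ?D. weight k u * a u * (\<Sum>s\<in>perms D. gram D s r * of_bool (s = reduce k u)))"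
      unfolding b_def pairing_def sum_distrib_right sum_distrib_left by (subst sum.swap) (simp add: mult_ac)
    also have "\<dots> = (\<Sum>u\<in>perms ?D. weight k u * a u * gram D (reduce k u) r)"
      by (intro sum.cong refl arg_cong2[where f = "(*)"] sum_mult_of_bool[OF finite_perms[OF assms(1)] red]) simp
    also have "\<dots> = (\<Sum>u\<in>perms ?D. a u * gram ?D u r)"
      by (intro sum.cong refl)
        (simp add: gram_sym[of _ _ r] gram_insert[OF assms(1,2) r])
    also have "\<dots> = target ?D (i(k := p)) (j(k := p')) r"
      using pairing_weingarten[OF fin rD] unfolding pairing_def a_def .
    also have "\<dots> = of_bool (p = p') * target D i j r"
    proof -
      have "(\<forall>x\<in>?D. (i(k := p)) x < n) \<longleftrightarrow> (\<forall>x\<in>D. i x < n)" using assms(2,3) by auto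
      moreover have "(i(k := p)) (r x) = (j(k := p')) x \<longleftrightarrow> i (r x) = j x" if "x \<in> D" for x
        using that assms(2) perms_in[OF r, of x] by auto
      then have "(\<forall>x\<in>?D. (i(k := p)) (r x) = (j(k := p')) x) \<longleftrightarrow> p = p' \<and> (\<forall>x\<in>D. i (r x) = j x)"
        using rk by auto
      ultimately show ?thesis unfolding target_def by (simp only:) auto
    qed
    finally show ?thesis .
  qed
  moreover have "pairing D (\<lambda>s. of_bool (p = p') * weingarten D i j s) r = of_bool (p = p') * pairing D (weingarten D i j) r" for r
    unfolding pairing_def sum_distrib_left by (simp add: mult.assoc)
  ultimately have "trace_comb D b w - trace_comb D (\<lambda>s. of_bool (p = p') * weingarten D i j s) w \<in> N"
    by (intro trace_comb_eq[OF assms(1)]) (simp add: pairing_weingarten[OF assms(1)])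
  moreover have "trace_comb D (\<lambda>s. of_bool (p = p') * weingarten D i j s) w = of_bool (p = p') * reynolds D i j w"
    by (cases "p = p'") (simp_all add: reynolds_def trace_comb_def q_zero)
  moreover have "reynolds ?D (i(k := p)) (j(k := p')) (w(k := [])) - trace_comb D b w \<in> N"
  proof -
    have tb: "trace_comb D b w = (\<Sum>r\<in>perms ?D. q (weight k r) * q (a r) * cycle_prod \<tau> D (reduce k r) w)"
    proof -
      have "q (b s) * z = (\<Sum>r\<in>perms ?D. q (weight k r) * q (a r) * (z * of_bool (s = reduce k r)))" for s z
        unfolding b_def q_sum sum_distrib_right
        by (intro sum.cong) (auto simp: q_mult q_one q_zero)
      then have "trace_comb D b w = (\<Sum>r\<in>perms ?D. q (weight k r) * q (a r) *
          (\<Sum>s\<in>perms D. cycle_prod \<tau> D s w * of_bool (s = reduce k r)))"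
        unfolding trace_comb_def sum_distrib_left by (simp only:) (rule sum.swap)
      also have "\<dots> = (\<Sum>r\<in>perms ?D. q (weight k r) * q (a r) * cycle_prod \<tau> D (reduce k r) w)"
        by (intro sum.cong refl arg_cong2[where f = "(*)"] sum_mult_of_bool[OF finite_perms[OF assms(1)] red]) simp
      finally show ?thesis .
    qed
    have "cycle_prod \<tau> ?D r (w(k := [])) - q (weight k r) * cycle_prod \<tau> D (reduce k r) w \<in> N"
      if r: "r \<in> perms ?D" for r
    proof (cases "r k = k")
      case True
      have rr: "reduce k r = r" using True by (simp add: reduce_def)
      have rD: "r permutes D" using red[OF r] rr by (simp add: perms_def)
      have "cycle_prod \<tau> D r (w(k := [])) = cycle_prod \<tau> D r w"
        using assms(1,2) rD by (intro cycle_prod_cong) (auto simp: permutes_in_image)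
      then have "cycle_prod \<tau> ?D r (w(k := [])) = \<tau> [] * cycle_prod \<tau> D r w"
        using cycle_prod_fixed[OF rD assms(1,2), of "w(k := [])"] by simp
      \<comment> \<open>A fixed \<open>k\<close> contributes \<open>\<tau> []\<close> to the cycle
        product and \<open>n\<close> to the partial trace; \<open>trace_one\<close> reconciles the
        two.\<close>
      then have "cycle_prod \<tau> ?D r (w(k := [])) - q (weight k r) * cycle_prod \<tau> D (reduce k r) w =
          cycle_prod \<tau> D r w * (\<tau> [] - of_nat n)"
        using True by (simp add: rr weight_def q_of_nat algebra_simps)
      then show ?thesis using N_mult[OF trace_one] by simp
    next
      case False
      have rp: "r permutes ?D" using r by (simp add: perms_def)
      have rD: "reduce k r permutes D" using red[OF r] by (simp add: perms_def)
      have "cycle_prod \<tau> ?D r (w(k := [])) =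
          cycle_prod \<tau> D (reduce k r) ((w(k := []))(r k := (w(k := [])) k @ (w(k := [])) (r k)))"
        unfolding reduce_def by (rule cycle_prod_contract[OF rp assms(1,2) refl False])
      also have "\<dots> = cycle_prod \<tau> D (reduce k r) w"
        using assms(1,2) rD False by (intro cycle_prod_cong) (auto simp: permutes_in_image)
      finally show ?thesis using False by (simp add: weight_def q_one N_zero)
    qed
    then have "q (a r) * (cycle_prod \<tau> ?D r (w(k := [])) - q (weight k r) * cycle_prod \<tau> D (reduce k r) w) \<in> N"
      if "r \<in> perms ?D" for r using that by (intro N_mult)
    then have "(\<Sum>r\<in>perms ?D. q (a r) *
        (cycle_prod \<tau> ?D r (w(k := [])) - q (weight k r) * cycle_prod \<tau> D (reduce k r) w)) \<in> N"
      by (rule N_sum)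
    then show ?thesis
      unfolding tb unfolding reynolds_def trace_comb_def a_def[symmetric]
      by (simp add: right_diff_distrib sum_subtractf mult_ac)
  qed
  ultimately show ?thesis using N_trans by metis
qed

text \<open>The form in which the kernel of the trace form acts: each permutation sees the word in
  slot \<open>k\<close> only through a single trace \<open>\<tau> (u @ v)\<close>.\<close>

lemma reynolds_linear:
  assumes "finite D" "k \<in> D"
    and "\<And>v. (\<Sum>u\<in>W. \<alpha> u * \<tau> (\<beta> u @ v)) \<in> N"
  shows "(\<Sum>u\<in>W. \<alpha> u * reynolds D i j (w(k := \<beta> u))) \<in> N"
proof -
  have "(\<Sum>u\<in>W. \<alpha> u * cycle_prod \<tau> D s (w(k := \<beta> u))) \<in> N" if s: "s \<in> perms D" for s
  proof -
    have "s permutes D" using s by (simp add: perms_def)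
    from cycle_prod_single_slot[OF this assms(1,2), of w]
    obtain c v where cv: "\<And>u. cycle_prod \<tau> D s (w(k := u)) = c * \<tau> (u @ v)" by blast
    have "(\<Sum>u\<in>W. \<alpha> u * cycle_prod \<tau> D s (w(k := \<beta> u))) = c * (\<Sum>u\<in>W. \<alpha> u * \<tau> (\<beta> u @ v))"
      unfolding cv sum_distrib_left by (simp add: mult.left_commute)
    then show ?thesis using N_mult[OF assms(3)] by simp
  qed
  then have "(\<Sum>s\<in>perms D. q (weingarten D i j s) * (\<Sum>u\<in>W. \<alpha> u * cycle_prod \<tau> D s (w(k := \<beta> u)))) \<in> N"
    by (intro N_sum) (rule N_mult)
  moreover have "(\<Sum>u\<in>W. \<alpha> u * reynolds D i j (w(k := \<beta> u))) =
      (\<Sum>s\<in>perms D. q (weingarten D i j s) * (\<Sum>u\<in>W. \<alpha> u * cycle_prod \<tau> D s (w(k := \<beta> u))))"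
    unfolding reynolds_def trace_comb_def sum_distrib_left
    by (subst sum.swap) (simp add: mult.left_commute)
  ultimately show ?thesis by simp
qed

text \<open>Conjugation by \<open>b\<close> preserves pairings and targets, whereas the chosen
  coefficients need not be conjugate; hence a congruence. It makes the average a function of a
  commutative monomial.\<close>

lemma reynolds_relabel:
  assumes "finite D" "b permutes D"
  shows "reynolds D (i \<circ> b) (j \<circ> b) (w \<circ> b) - reynolds D i j w \<in> N"
proof -
  define b' where "b' = inv_into UNIV b"
  have b: "b \<in> perms D" "b' \<in> perms D" "\<And>x. b (b' x) = x" "\<And>x. b' (b x) = x"
    using assms(2) permutes_inv[OF assms(2)] permutes_inverses[OF assms(2)]
    by (auto simp: perms_def b'_def)
  define \<kappa> where "\<kappa> s = b \<circ> s \<circ> b'" for s :: "nat \<Rightarrow> nat"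
  have mem: "\<kappa> s \<in> perms D" if "s \<in> perms D" for s
    using that b by (auto simp: perms_def \<kappa>_def intro!: permutes_compose)
  have mem': "b' \<circ> s \<circ> b \<in> perms D" if "s \<in> perms D" for s
    using that b by (auto simp: perms_def intro!: permutes_compose)
  have bij: "bij_betw \<kappa> (perms D) (perms D)"
    by (rule bij_betw_byWitness[where f' = "\<lambda>s. b' \<circ> s \<circ> b"])
      (use mem mem' in \<open>auto simp: \<kappa>_def fun_eq_iff b(3,4)\<close>)
  have gr: "gram D s r = gram D (\<kappa> s) (\<kappa> r)" if "s \<in> perms D" "r \<in> perms D" for s r
  proof -
    have eq: "(\<forall>x\<in>D. f (b (s x)) = f (b (r x))) \<longleftrightarrow> (\<forall>x\<in>D. f (\<kappa> s x) = f (\<kappa> r x))" for f :: "nat \<Rightarrow> nat"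
      using b perms_in[OF b(1)] perms_in[OF b(2)] unfolding \<kappa>_def by (metis comp_apply)
    have "gram D s r = (\<Sum>f\<in>funs D. of_bool (\<forall>x\<in>D. (f \<circ> b) (s x) = (f \<circ> b) (r x)))"
      unfolding gram_def by (rule sum_funs_comp[OF b(1), symmetric])
    then show ?thesis unfolding gram_def by (simp add: eq)
  qed
  define a where "a s = weingarten D i j (\<kappa> s)" for s
  have "pairing D a r = target D (i \<circ> b) (j \<circ> b) r" if r: "r \<in> perms D" for r
  proof -
    have "pairing D a r = (\<Sum>s\<in>perms D. weingarten D i j (\<kappa> s) * gram D (\<kappa> s) (\<kappa> r))"
      unfolding pairing_def a_def using gr r by simp
    also have "\<dots> = pairing D (weingarten D i j) (\<kappa> r)"
      unfolding pairing_def by (rule sum.reindex_bij_betw[OF bij])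
    also have "\<dots> = target D i j (\<kappa> r)" by (rule pairing_weingarten[OF assms(1) mem[OF r]])
    also have "\<dots> = target D (i \<circ> b) (j \<circ> b) r"
    proof -
      have "(\<forall>x\<in>D. i x < n) \<longleftrightarrow> (\<forall>x\<in>D. (i \<circ> b) x < n)"
        using b perms_in[OF b(1)] perms_in[OF b(2)] by (metis comp_apply)
      moreover have "(\<forall>x\<in>D. i (\<kappa> r x) = j x) \<longleftrightarrow> (\<forall>x\<in>D. (i \<circ> b) (r x) = (j \<circ> b) x)"
        using b perms_in[OF b(1)] perms_in[OF b(2)] unfolding \<kappa>_def by (metis comp_apply)
      ultimately show ?thesis unfolding target_def by simp
    qed
    finally show ?thesis .
  qed
  then have "reynolds D (i \<circ> b) (j \<circ> b) (w \<circ> b) - trace_comb D a (w \<circ> b) \<in> N"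
    by (rule reynolds_eq[OF assms(1)])
  moreover have "trace_comb D a (w \<circ> b) = reynolds D i j w"
  proof -
    have "cycle_prod \<tau> D s (w \<circ> b) = cycle_prod \<tau> D (\<kappa> s) w" if "s \<in> perms D" for s
      using that mem[OF that] assms permutes_imp_bij[OF assms(2)]
      by (intro cycle_prod_relabel) (auto simp: perms_def \<kappa>_def b(4))
    then have "trace_comb D a (w \<circ> b) = (\<Sum>s\<in>perms D. q (weingarten D i j (\<kappa> s)) * cycle_prod \<tau> D (\<kappa> s) w)"
      unfolding trace_comb_def a_def by simp
    also have "\<dots> = reynolds D i j w"
      unfolding reynolds_def trace_comb_def by (rule sum.reindex_bij_betw[OF bij])
    finally show ?thesis .
  qed
  ultimately show ?thesis by simp
qed

lemma reynolds_empty: "reynolds {} i j w = 1"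
proof -
  have p: "perms {} = {id}" by (simp add: perms_def permutes_empty)
  have "pairing {} (weingarten {} i j) id = target {} i j id"
    by (rule pairing_weingarten) (simp_all add: p)
  then have "weingarten {} i j id = 1" by (simp add: pairing_def p gram_def target_def)
  then show ?thesis by (simp add: reynolds_def trace_comb_def p cycle_prod_def q_one)
qed

end

section \<open>The functional on polynomials in the matrix entries\<close>

lemma poly_mapping_add_induct [case_names single add]:
  assumes "\<And>M c. P (Poly_Mapping.single M c)" "\<And>p p'. P p \<Longrightarrow> P p' \<Longrightarrow> P (p + p')"
  shows "P (p :: 'x \<Rightarrow>\<^sub>0 'b::comm_monoid_add)"
proof (induction p rule: update_induct)
  case const
  show ?case using assms(1)[of _ 0] by simp
next
  case (update f a b)
  have "Poly_Mapping.update a b f = f + Poly_Mapping.single a b"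
    using update(1) by (intro poly_mapping_eqI)
      (auto simp: lookup_update lookup_add lookup_single when_def in_keys_iff)
  then show ?case using assms(2)[OF update(3) assms(1)] by simp
qed

definition lin_ext :: "('x \<Rightarrow> 'b) \<Rightarrow> ('x \<Rightarrow>\<^sub>0 'b::comm_semiring_1) \<Rightarrow> 'b" where
  "lin_ext f p = (\<Sum>M\<in>Poly_Mapping.keys p. Poly_Mapping.lookup p M * f M)"

lemma lin_ext_add: "lin_ext f (p + p') = lin_ext f p + lin_ext f p'"
  unfolding lin_ext_def
  by (rule setsum_keys_plus_distrib[where f = "\<lambda>M c. c * f M"]) (auto simp: distrib_right)

lemma lin_ext_single: "lin_ext f (Poly_Mapping.single M c) = c * f M"
  by (simp add: lin_ext_def)

lemma lin_ext_scale:
  "lin_ext f (Poly_Mapping.single 0 c * p) = c * lin_ext f (p :: 'x::monoid_add \<Rightarrow>\<^sub>0 'b::comm_semiring_1)"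
  by (induction p rule: poly_mapping_add_induct)
    (simp_all add: mult_single lin_ext_single lin_ext_add distrib_left mult.assoc)

lemma lin_ext_zero: "lin_ext f 0 = 0"
  by (simp add: lin_ext_def)

lemma lin_ext_sum: "lin_ext f (sum p I) = (\<Sum>x\<in>I. lin_ext f (p x))"
  by (induction I rule: infinite_finite_induct) (simp_all add: lin_ext_zero lin_ext_add)

lemma lin_ext_diff: "lin_ext f (p - p') = lin_ext f p - lin_ext f (p' :: 'x \<Rightarrow>\<^sub>0 'b::comm_ring_1)"
  using lin_ext_add[of f "p - p'" p'] by simp

context trace_ideal
begin

section \<open>Averages of lists of entries, each a word with two indices\<close>

definition list_reynolds :: "('g list \<times> nat \<times> nat) list \<Rightarrow> 'r" where
  "list_reynolds ys = reynolds {..<length ys} (\<lambda>x. fst (snd (ys ! x))) (\<lambda>x. snd (snd (ys ! x)))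
    (\<lambda>x. fst (ys ! x))"

lemma list_reynolds_eq:
  assumes "D = {..<length ys}" "\<And>x. x < length ys \<Longrightarrow> ys ! x = (w x, i x, j x)"
  shows "list_reynolds ys = reynolds D i j w"
  unfolding list_reynolds_def assms(1) by (rule reynolds_cong) (use assms(2) in auto)

lemma list_reynolds_mset:
  assumes "mset ys = mset zs"
  shows "list_reynolds ys - list_reynolds zs \<in> N"
proof -
  obtain p where p: "p permutes {..<length zs}" "permute_list p zs = ys"
    using mset_eq_permutation[OF assms] by blast
  have "list_reynolds ys = reynolds {..<length zs} ((\<lambda>x. fst (snd (zs ! x))) \<circ> p)
      ((\<lambda>x. snd (snd (zs ! x))) \<circ> p) ((\<lambda>x. fst (zs ! x)) \<circ> p)"
    by (rule list_reynolds_eq) (use p in \<open>auto simp: permute_list_nth\<close>)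
  then show ?thesis
    unfolding list_reynolds_def[of zs] using reynolds_relabel[OF _ p(1)] by simp
qed

text \<open>The right factor stands first because the last slot is the one contracted, and its word
  is prepended to that of the slot before it.\<close>

lemma list_reynolds_mult:
  "(\<Sum>c<n. list_reynolds (ys @ [(v, c, j), (u, i, c)])) - list_reynolds (ys @ [(u @ v, i, j)]) \<in> N"
proof -
  let ?m = "length ys"
  define I where "I = (\<lambda>x. fst (snd (ys ! x)))(?m := i)"
  define J where "J = (\<lambda>x. snd (snd (ys ! x)))(?m := j)"
  define w where "w = (\<lambda>x. fst (ys ! x))(?m := v, Suc ?m := u)"
  have "list_reynolds (ys @ [(v, c, j), (u, i, c)]) =
      reynolds (insert (Suc ?m) {..<Suc ?m}) (I(Suc ?m := I ?m, ?m := c)) (J(Suc ?m := c)) w" for c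
    by (rule list_reynolds_eq)
      (auto simp: I_def J_def w_def nth_append less_Suc_eq lessThan_Suc)
  moreover have "list_reynolds (ys @ [(u @ v, i, j)]) =
      reynolds {..<Suc ?m} I J (w(?m := w (Suc ?m) @ w ?m))"
    by (rule list_reynolds_eq) (auto simp: I_def J_def w_def nth_append less_Suc_eq)
  ultimately show ?thesis
    using reynolds_mult[of "{..<Suc ?m}" "Suc ?m" ?m I J w] by simp
qed

lemma list_reynolds_one:
  assumes "i < n"
  shows "list_reynolds (ys @ [([], i, j)]) - of_bool (i = j) * list_reynolds ys \<in> N"
proof -
  let ?m = "length ys"
  let ?I = "\<lambda>x. fst (snd (ys ! x))" and ?J = "\<lambda>x. snd (snd (ys ! x))" and ?w = "\<lambda>x. fst (ys ! x)"
  have "list_reynolds (ys @ [([], i, j)]) =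
      reynolds (insert ?m {..<?m}) (?I(?m := i)) (?J(?m := j)) (?w(?m := []))"
    by (rule list_reynolds_eq) (auto simp: nth_append less_Suc_eq)
  then show ?thesis
    using reynolds_one[of "{..<?m}" ?m i ?I ?J j ?w] assms by (simp add: list_reynolds_def)
qed

lemma list_reynolds_trace:
  "(\<Sum>c<n. list_reynolds (ys @ [(u, c, c)])) - \<tau> u * list_reynolds ys \<in> N"
proof -
  let ?m = "length ys"
  let ?I = "\<lambda>x. fst (snd (ys ! x))" and ?J = "\<lambda>x. snd (snd (ys ! x))"
  let ?w = "(\<lambda>x. fst (ys ! x))(?m := u)"
  have "list_reynolds (ys @ [(u, c, c)]) = reynolds (insert ?m {..<?m}) (?I(?m := c)) (?J(?m := c)) ?w" for c
    by (rule list_reynolds_eq) (auto simp: nth_append less_Suc_eq)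
  moreover have "list_reynolds ys = reynolds {..<?m} ?I ?J ?w"
    by (rule list_reynolds_eq) auto
  ultimately show ?thesis using reynolds_trace[of "{..<?m}" ?m ?I ?J ?w] by simp
qed

lemma list_reynolds_linear:
  assumes "\<And>v. (\<Sum>u\<in>W. \<alpha> u * \<tau> (\<beta> u @ v)) \<in> N"
  shows "(\<Sum>u\<in>W. \<alpha> u * list_reynolds (ys @ [(\<beta> u, i, j)])) \<in> N"
proof -
  let ?m = "length ys"
  let ?I = "(\<lambda>x. fst (snd (ys ! x)))(?m := i)" and ?J = "(\<lambda>x. snd (snd (ys ! x)))(?m := j)"
  let ?w = "\<lambda>x. fst (ys ! x)"
  have "list_reynolds (ys @ [(\<beta> u, i, j)]) = reynolds {..<Suc ?m} ?I ?J (?w(?m := \<beta> u))" for u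
    by (rule list_reynolds_eq) (auto simp: nth_append less_Suc_eq)
  then show ?thesis using reynolds_linear[of "{..<Suc ?m}" ?m \<alpha> \<beta> W ?I ?J ?w] assms by simp
qed

definition letter :: "'g \<times> nat \<times> nat \<Rightarrow> 'g list \<times> nat \<times> nat" where
  "letter = (\<lambda>(g, i, j). ([g], i, j))"

text \<open>The choice of an ordering is harmless modulo \<open>N\<close>, by
  \<open>list_reynolds_mset\<close>.\<close>

definition monomial_value :: "('g \<times> nat \<times> nat) multiset \<Rightarrow> 'r" where
  "monomial_value M = list_reynolds (map letter (SOME xs. mset xs = M))"

lemma monomial_value_mset: "monomial_value (mset xs) - list_reynolds (map letter xs) \<in> N"
proof -
  have "mset (SOME ys. mset ys = mset xs) = mset xs" by (rule someI) (rule refl)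
  then have "mset (map letter (SOME ys. mset ys = mset xs)) = mset (map letter xs)"
    by simp
  then show ?thesis unfolding monomial_value_def by (rule list_reynolds_mset)
qed

lemma N_sum_diff:
  assumes "\<And>x. x \<in> I \<Longrightarrow> f x - g x \<in> N"
  shows "sum f I - sum g I \<in> N"
  using N_sum[of I "\<lambda>x. f x - g x"] assms by (simp add: sum_subtractf)

lemma N_mult_diff: "a - b \<in> N \<Longrightarrow> c * a - c * b \<in> N"
  using N_mult[of "a - b" c] by (simp add: right_diff_distrib)

section \<open>The averaging functional and the ideal of relations\<close>

definition functional :: "(('g \<times> nat \<times> nat) multiset \<Rightarrow>\<^sub>0 'r) \<Rightarrow> 'r" where
  "functional = lin_ext monomial_value"

text \<open>The largest ideal on which \<open>functional\<close> takes values in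
  \<open>N\<close>.\<close>

definition relations :: "(('g \<times> nat \<times> nat) multiset \<Rightarrow>\<^sub>0 'r) set" where
  "relations = {p. \<forall>p'. functional (p * p') \<in> N}"

lemma relationsI:
  assumes "\<And>xs. functional (p * Poly_Mapping.single (mset xs) 1) \<in> N"
  shows "p \<in> relations"
proof -
  have "functional (p * p') \<in> N" for p'
  proof (induction p' rule: poly_mapping_add_induct)
    case (single M c)
    obtain xs where M: "M = mset xs" using ex_mset by metis
    have "p * Poly_Mapping.single M c =
        Poly_Mapping.single 0 c * (p * Poly_Mapping.single (mset xs) 1)"
      by (simp add: M mult_single mult.left_commute[of _ p])
    then show ?case using N_mult[OF assms] by (simp add: functional_def lin_ext_scale)
  next
    case (add p1 p2)
    then show ?case by (simp add: functional_def distrib_left lin_ext_add N_add)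
  qed
  then show ?thesis by (simp add: relations_def)
qed

lemma relations_add: "p \<in> relations \<Longrightarrow> p' \<in> relations \<Longrightarrow> p + p' \<in> relations"
  by (simp add: relations_def functional_def distrib_right lin_ext_add N_add)

lemma relations_mult: "p \<in> relations \<Longrightarrow> p' * p \<in> relations"
  unfolding relations_def by (auto simp: mult.assoc mult.left_commute[of p' p])

text \<open>The functional is linear over the coefficients and normalized to 1 on the empty
  monomial, so it returns a constant unchanged. This will make the structure map injective.\<close>

lemma relations_const_iff: "Poly_Mapping.single 0 c \<in> relations \<longleftrightarrow> c \<in> N"
proof
  assume "Poly_Mapping.single 0 c \<in> relations"
  then have "functional (Poly_Mapping.single 0 c * 1) \<in> N" unfolding relations_def by blast
  moreover have "functional (Poly_Mapping.single 0 c) = c * monomial_value 0"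
    by (simp add: functional_def lin_ext_single)
  moreover have "monomial_value {#} = 1"
    by (simp add: monomial_value_def list_reynolds_def reynolds_empty)
  ultimately show "c \<in> N" by simp
next
  assume "c \<in> N"
  then have "functional (Poly_Mapping.single 0 c * p) \<in> N" for p
    unfolding functional_def lin_ext_scale by (subst mult.commute) (rule N_mult)
  then show "Poly_Mapping.single 0 c \<in> relations" by (simp add: relations_def)
qed

definition entry :: "'g \<Rightarrow> nat \<Rightarrow> nat \<Rightarrow> (('g \<times> nat \<times> nat) multiset \<Rightarrow>\<^sub>0 'r)" where
  "entry g i j = Poly_Mapping.single {#(g, i, j)#} 1"

lemma functional_single: "functional (Poly_Mapping.single M c) = c * monomial_value M"
  by (simp add: functional_def lin_ext_single)

lemma functional_entry:
  "functional (entry g i j * Poly_Mapping.single (mset xs) 1) - list_reynolds (map letter xs @ [([g], i, j)]) \<in> N"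
  using monomial_value_mset[of "xs @ [(g, i, j)]"]
  by (simp add: entry_def mult_single functional_single letter_def)

lemma functional_entry_entry:
  "functional (entry g i j * entry h k l * Poly_Mapping.single (mset xs) 1)
    - list_reynolds (map letter xs @ [([h], k, l), ([g], i, j)]) \<in> N"
  using monomial_value_mset[of "xs @ [(h, k, l), (g, i, j)]"]
  by (simp add: entry_def mult_single functional_single letter_def add_mset_commute)

lemma functional_linear:
  assumes "\<And>v. (\<Sum>u\<in>W. \<alpha> u * \<tau> ([\<beta> u] @ v)) \<in> N"
  shows "(\<Sum>u\<in>W. Poly_Mapping.single 0 (\<alpha> u) * entry (\<beta> u) i j) \<in> relations"
proof (rule relationsI)
  fix xs :: "('g \<times> nat \<times> nat) list"
  have "functional ((\<Sum>u\<in>W. Poly_Mapping.single 0 (\<alpha> u) * entry (\<beta> u) i j) * Poly_Mapping.single (mset xs) 1) =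
      (\<Sum>u\<in>W. \<alpha> u * functional (entry (\<beta> u) i j * Poly_Mapping.single (mset xs) 1))"
    by (simp add: sum_distrib_right functional_def lin_ext_sum lin_ext_scale mult.assoc)
  moreover have "(\<Sum>u\<in>W. \<alpha> u * functional (entry (\<beta> u) i j * Poly_Mapping.single (mset xs) 1)) -
      (\<Sum>u\<in>W. \<alpha> u * list_reynolds (map letter xs @ [([\<beta> u], i, j)])) \<in> N"
    by (intro N_sum_diff N_mult_diff functional_entry)
  moreover have "(\<Sum>u\<in>W. \<alpha> u * list_reynolds (map letter xs @ [([\<beta> u], i, j)])) \<in> N"
    using list_reynolds_linear[of \<alpha> "\<lambda>u. [\<beta> u]" W, OF assms] .
  ultimately show "functional ((\<Sum>u\<in>W. Poly_Mapping.single 0 (\<alpha> u) * entry (\<beta> u) i j) *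
      Poly_Mapping.single (mset xs) 1) \<in> N"
    using N_add by fastforce
qed

text \<open>The two-term case of linearity, with the difference written as a signed sum over the
  booleans.\<close>

lemma list_reynolds_word_cong:
  assumes "\<And>v. \<tau> (u @ v) - \<tau> (u' @ v) \<in> N"
  shows "list_reynolds (ys @ [(u, i, j)]) - list_reynolds (ys @ [(u', i, j)]) \<in> N"
proof -
  have "(\<Sum>b\<in>UNIV. (if b then 1 else - 1) * \<tau> ((if b then u else u') @ v)) \<in> N" for v
    using assms by (simp add: UNIV_bool)
  from list_reynolds_linear[of "\<lambda>b. if b then 1 else - 1" "\<lambda>b. if b then u else u'" UNIV, OF this]
  show ?thesis by (simp add: UNIV_bool)
qed

text \<open>The sum over \<open>c\<close> first merges the two letters into the word
  \<open>[g, h]\<close>; only then is this word exchanged for \<open>[k]\<close>, which no trace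
  distinguishes from it modulo \<open>N\<close>.\<close>

lemma entry_mult:
  assumes "\<And>v. \<tau> ([g, h] @ v) - \<tau> ([k] @ v) \<in> N"
  shows "(\<Sum>c<n. entry g i c * entry h c j) - entry k i j \<in> relations"
proof (rule relationsI)
  fix xs :: "('g \<times> nat \<times> nat) list"
  let ?e = "Poly_Mapping.single (mset xs) (1 :: 'r)" and ?ys = "map letter xs"
  have eq: "functional (((\<Sum>c<n. entry g i c * entry h c j) - entry k i j) * ?e) =
      (\<Sum>c<n. functional (entry g i c * entry h c j * ?e)) - functional (entry k i j * ?e)"
    by (simp add: sum_distrib_right left_diff_distrib functional_def lin_ext_sum lin_ext_diff)
  have r1: "(\<Sum>c<n. functional (entry g i c * entry h c j * ?e)) -
      (\<Sum>c<n. list_reynolds (?ys @ [([h], c, j), ([g], i, c)])) \<in> N"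
    by (intro N_sum_diff functional_entry_entry)
  have r2: "(\<Sum>c<n. list_reynolds (?ys @ [([h], c, j), ([g], i, c)])) -
      list_reynolds (?ys @ [([g, h], i, j)]) \<in> N"
    using list_reynolds_mult[of ?ys "[h]" j "[g]" i] by simp
  have r3: "list_reynolds (?ys @ [([g, h], i, j)]) - list_reynolds (?ys @ [([k], i, j)]) \<in> N"
    by (rule list_reynolds_word_cong[OF assms])
  have r4: "list_reynolds (?ys @ [([k], i, j)]) - functional (entry k i j * ?e) \<in> N"
    by (rule N_sym[OF functional_entry])
  show "functional (((\<Sum>c<n. entry g i c * entry h c j) - entry k i j) * ?e) \<in> N"
    unfolding eq by (rule N_trans[OF N_trans[OF N_trans[OF r1 r2] r3] r4])
qed

lemma entry_one:
  assumes "\<And>v. \<tau> ([e] @ v) - \<tau> v \<in> N" "i < n"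
  shows "entry e i j - of_bool (i = j) \<in> relations"
proof (rule relationsI)
  fix xs :: "('g \<times> nat \<times> nat) list"
  let ?e = "Poly_Mapping.single (mset xs) (1 :: 'r)" and ?ys = "map letter xs"
  have eq: "functional ((entry e i j - of_bool (i = j)) * ?e) =
      functional (entry e i j * ?e) - of_bool (i = j) * functional ?e"
    by (simp add: left_diff_distrib functional_def lin_ext_diff lin_ext_zero)
  have r1: "functional (entry e i j * ?e) - list_reynolds (?ys @ [([e], i, j)]) \<in> N"
    by (rule functional_entry)
  have r2: "list_reynolds (?ys @ [([e], i, j)]) - list_reynolds (?ys @ [([], i, j)]) \<in> N"
    by (rule list_reynolds_word_cong) (use assms(1) in simp)
  have r3: "list_reynolds (?ys @ [([], i, j)]) - of_bool (i = j) * list_reynolds ?ys \<in> N"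
    by (rule list_reynolds_one[OF assms(2)])
  have r4: "of_bool (i = j) * list_reynolds ?ys - of_bool (i = j) * functional ?e \<in> N"
    using N_sym[OF monomial_value_mset[of xs]] by (intro N_mult_diff) (simp add: functional_single)
  show "functional ((entry e i j - of_bool (i = j)) * ?e) \<in> N"
    unfolding eq by (rule N_trans[OF N_trans[OF N_trans[OF r1 r2] r3] r4])
qed

lemma entry_trace: "(\<Sum>c<n. entry g c c) - Poly_Mapping.single 0 (\<tau> [g]) \<in> relations"
proof (rule relationsI)
  fix xs :: "('g \<times> nat \<times> nat) list"
  let ?e = "Poly_Mapping.single (mset xs) (1 :: 'r)" and ?ys = "map letter xs"
  have eq: "functional (((\<Sum>c<n. entry g c c) - Poly_Mapping.single 0 (\<tau> [g])) * ?e) =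
      (\<Sum>c<n. functional (entry g c c * ?e)) - \<tau> [g] * functional ?e"
    by (simp add: sum_distrib_right left_diff_distrib functional_def lin_ext_sum lin_ext_diff
        lin_ext_scale del: mult_single)
  have r1: "(\<Sum>c<n. functional (entry g c c * ?e)) - (\<Sum>c<n. list_reynolds (?ys @ [([g], c, c)])) \<in> N"
    by (intro N_sum_diff functional_entry)
  have r2: "(\<Sum>c<n. list_reynolds (?ys @ [([g], c, c)])) - \<tau> [g] * list_reynolds ?ys \<in> N"
    by (rule list_reynolds_trace)
  have r3: "\<tau> [g] * list_reynolds ?ys - \<tau> [g] * functional ?e \<in> N"
    using N_sym[OF monomial_value_mset[of xs]] by (intro N_mult_diff) (simp add: functional_single)
  show "functional (((\<Sum>c<n. entry g c c) - Poly_Mapping.single 0 (\<tau> [g])) * ?e) \<in> N"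
    unfolding eq by (rule N_trans[OF N_trans[OF r1 r2] r3])
qed

end

section \<open>Pseudocharacters over a commutative ring containing the rationals\<close>

locale rat_cring = cring A for A :: "('a, 'm) ring_scheme" (structure) +
  fixes \<phi> :: "rat \<Rightarrow> 'a"
  assumes \<phi>_hom: "\<phi> \<in> ring_hom rat_ring A"
begin

lemma \<phi>_closed [simp]: "\<phi> x \<in> carrier A"
  using \<phi>_hom by (auto simp: ring_hom_def rat_ring_def)

lemma \<phi>_add: "\<phi> (x + y) = \<phi> x \<oplus> \<phi> y"
  using \<phi>_hom by (auto simp: ring_hom_def rat_ring_def)

lemma \<phi>_mult: "\<phi> (x * y) = \<phi> x \<otimes> \<phi> y"
  using \<phi>_hom by (auto simp: ring_hom_def rat_ring_def)

lemma \<phi>_one: "\<phi> 1 = \<one>"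
  using \<phi>_hom by (auto simp: ring_hom_def rat_ring_def)

lemma \<phi>_zero: "\<phi> 0 = \<zero>"
  using \<phi>_add[of 0 0] add.r_cancel_one[of "\<phi> 0" "\<phi> 0"] by simp

section \<open>Evaluation of rational polynomials at elements of the ring\<close>

text \<open>Every element of the type is a variable; those outside the carrier are evaluated to
  zero, which keeps the map total and multiplicative.\<close>

definition monomial_eval :: "'a multiset \<Rightarrow> 'a" where
  "monomial_eval M = (\<Otimes>a\<in>set_mset M. (if a \<in> carrier A then a else \<zero>) [^] count M a)"

lemma monomial_eval_closed [simp]: "monomial_eval M \<in> carrier A"
  unfolding monomial_eval_def by (rule finprod_closed) auto

lemma monomial_eval_superset:
  assumes "finite S" "set_mset M \<subseteq> S"
  shows "monomial_eval M = (\<Otimes>a\<in>S. (if a \<in> carrier A then a else \<zero>) [^] count M a)"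
  unfolding monomial_eval_def
  by (rule finprod_mono_neutral_cong_left[OF assms]) (auto simp: not_in_iff[THEN iffD1])

lemma monomial_eval_add: "monomial_eval (M + M') = monomial_eval M \<otimes> monomial_eval M'"
proof -
  let ?S = "set_mset M \<union> set_mset M'"
  let ?c = "\<lambda>a. if a \<in> carrier A then a else \<zero>"
  have "monomial_eval (M + M') = (\<Otimes>a\<in>?S. ?c a [^] count (M + M') a)"
    by (rule monomial_eval_superset) auto
  also have "\<dots> = (\<Otimes>a\<in>?S. ?c a [^] count M a \<otimes> ?c a [^] count M' a)"
    by (rule finprod_cong) (auto simp: nat_pow_mult simp_implies_def)
  also have "\<dots> = (\<Otimes>a\<in>?S. ?c a [^] count M a) \<otimes> (\<Otimes>a\<in>?S. ?c a [^] count M' a)"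
    by (rule finprod_multf) auto
  finally show ?thesis
    using monomial_eval_superset[of ?S M] monomial_eval_superset[of ?S M'] by simp
qed

lemma monomial_eval_empty: "monomial_eval {#} = \<one>"
  by (simp add: monomial_eval_def)

lemma monomial_eval_single: "a \<in> carrier A \<Longrightarrow> monomial_eval {#a#} = a"
  by (simp add: monomial_eval_def)

definition ev :: "('a multiset \<Rightarrow>\<^sub>0 rat) \<Rightarrow> 'a" where
  "ev p = (\<Oplus>M\<in>Poly_Mapping.keys p. \<phi> (Poly_Mapping.lookup p M) \<otimes> monomial_eval M)"

lemma ev_closed [simp]: "ev p \<in> carrier A"
  unfolding ev_def by (rule finsum_closed) auto

lemma ev_superset:
  assumes "finite S" "Poly_Mapping.keys p \<subseteq> S"
  shows "ev p = (\<Oplus>M\<in>S. \<phi> (Poly_Mapping.lookup p M) \<otimes> monomial_eval M)"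
  unfolding ev_def
  by (rule add.finprod_mono_neutral_cong_left[OF assms]) (auto simp: in_keys_iff \<phi>_zero)

lemma ev_add: "ev (p + p') = ev p \<oplus> ev p'"
proof -
  let ?S = "Poly_Mapping.keys p \<union> Poly_Mapping.keys p'"
  have "ev (p + p') = (\<Oplus>M\<in>?S. \<phi> (Poly_Mapping.lookup (p + p') M) \<otimes> monomial_eval M)"
    by (rule ev_superset) (simp, rule Poly_Mapping.keys_add)
  also have "\<dots> = (\<Oplus>M\<in>?S. \<phi> (Poly_Mapping.lookup p M) \<otimes> monomial_eval M \<oplus>
      \<phi> (Poly_Mapping.lookup p' M) \<otimes> monomial_eval M)"
    by (rule finsum_cong) (auto simp: lookup_add \<phi>_add l_distr simp_implies_def)
  also have "\<dots> = (\<Oplus>M\<in>?S. \<phi> (Poly_Mapping.lookup p M) \<otimes> monomial_eval M) \<oplus>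
      (\<Oplus>M\<in>?S. \<phi> (Poly_Mapping.lookup p' M) \<otimes> monomial_eval M)"
    by (rule finsum_addf) auto
  finally show ?thesis using ev_superset[of ?S p] ev_superset[of ?S p'] by simp
qed

lemma ev_single: "ev (Poly_Mapping.single M c) = \<phi> c \<otimes> monomial_eval M"
  by (cases "c = 0") (auto simp: ev_def \<phi>_zero)

lemma ev_mult: "ev (p * p') = ev p \<otimes> ev p'"
proof (induction p rule: poly_mapping_add_induct)
  case (single M c)
  show ?case
  proof (induction p' rule: poly_mapping_add_induct)
    case (single M' c')
    show ?case by (simp add: mult_single ev_single monomial_eval_add \<phi>_mult m_ac)
  next
    case (add p p')
    then show ?case by (simp add: distrib_left ev_add r_distr)
  qed
next
  case (add p1 p2)
  then show ?case by (simp add: distrib_right ev_add l_distr)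
qed

lemma ev_zero: "ev 0 = \<zero>"
  by (simp add: ev_def)

lemma ev_const: "ev (Poly_Mapping.single 0 c) = \<phi> c"
  by (simp add: ev_single monomial_eval_empty)

lemma ev_one: "ev 1 = \<one>"
  using ev_const[of 1] by (simp add: \<phi>_one)

lemma ev_uminus: "ev (- p) = \<ominus> ev p"
  using ev_add[of "- p" p] by (simp add: ev_zero minus_equality)

lemma ev_diff: "ev (p - p') = ev p \<ominus> ev p'"
  using ev_add[of p "- p'"] by (simp add: ev_uminus a_minus_def)

lemma ev_sum: "ev (sum f I) = (\<Oplus>x\<in>I. ev (f x))"
  by (induction I rule: infinite_finite_induct) (simp_all add: ev_zero ev_add)

lemma ev_prod: "ev (prod f I) = (\<Otimes>x\<in>I. ev (f x))"
  by (induction I rule: infinite_finite_induct) (simp_all add: ev_one ev_mult)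

lemma ev_of_nat: "ev (of_nat k) = [k] \<cdot> \<one>"
  by (induction k) (simp_all add: ev_zero ev_add ev_one a_comm)

lemma ev_sign: "ev (of_int (sign s) * p) = [sign s] \<cdot> ev p"
  by (cases s rule: sign_cases) (simp_all add: ev_uminus add.int_pow_neg)

text \<open>A set-theoretic section of \<open>ev\<close> over the carrier, neither additive nor
  multiplicative; its use is confined to statements modulo the kernel of \<open>ev\<close> or about
  equal arguments.\<close>

definition lift :: "'a \<Rightarrow> 'a multiset \<Rightarrow>\<^sub>0 rat" where
  "lift a = Poly_Mapping.single {#a#} 1"

lemma ev_lift: "a \<in> carrier A \<Longrightarrow> ev (lift a) = a"
  by (simp add: lift_def ev_single \<phi>_one monomial_eval_single)

end

locale rat_pseudocharacter = rat_cring A \<phi> + G: group G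
  for A :: "('a, 'm) ring_scheme" (structure) and \<phi> and G :: "('g, 'k) monoid_scheme" +
  fixes t :: "'g \<Rightarrow> 'a" and n :: nat
  assumes pseudo: "pseudocharacter A G n t"
begin

section \<open>Words in the group and their traces\<close>

lemma t_closed: "g \<in> carrier G \<Longrightarrow> t g \<in> carrier A"
  using pseudo by (auto simp: pseudocharacter_def)

text \<open>Letters outside the group count as the identity, because \<open>trace_ideal\<close>
  quantifies over all words on the type.\<close>

definition word_prod :: "'g list \<Rightarrow> 'g" where
  "word_prod u = list_mult G (map (\<lambda>g. if g \<in> carrier G then g else \<one>\<^bsub>G\<^esub>) u)"

lemma word_prod_Nil: "word_prod [] = \<one>\<^bsub>G\<^esub>"
  by (simp add: word_prod_def list_mult_def)

lemma word_prod_Cons: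
  "word_prod (g # u) = (if g \<in> carrier G then g else \<one>\<^bsub>G\<^esub>) \<otimes>\<^bsub>G\<^esub> word_prod u"
  by (simp add: word_prod_def list_mult_def)

lemma word_prod_closed [simp]: "word_prod u \<in> carrier G"
  by (induction u) (simp_all add: word_prod_Nil word_prod_Cons)

lemma word_prod_append: "word_prod (u @ v) = word_prod u \<otimes>\<^bsub>G\<^esub> word_prod v"
  by (induction u) (simp_all add: word_prod_Nil word_prod_Cons G.m_assoc)

lemma word_prod_concat: "word_prod (concat us) = list_mult G (map word_prod us)"
  by (induction us) (simp_all add: word_prod_Nil word_prod_append list_mult_def)

definition trace_word :: "'g list \<Rightarrow> 'a multiset \<Rightarrow>\<^sub>0 rat" where
  "trace_word u = lift (t (word_prod u))"

lemma ev_trace_word: "ev (trace_word u) = t (word_prod u)"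
  by (simp add: trace_word_def ev_lift t_closed)

text \<open>Both products start each cycle at its least element, so the factors agree one by
  one.\<close>

lemma ev_cycle_prod: "ev (cycle_prod trace_word {..<m} s w) = T_perm A G t m s (\<lambda>x. word_prod (w x))"
  unfolding cycle_prod_def T_perm_def
  by (simp only: ev_prod ev_trace_word word_prod_concat map_map comp_def)

text \<open>Cyclicity is exact since both words lift the same element of the ring; the two
  congruences become the axioms on \<open>t\<close> after evaluation.\<close>

sublocale trace_ideal "trace_word" "{p. ev p = \<zero>}" "Poly_Mapping.single 0" n
proof
  show "trace_word (u @ v) = trace_word (v @ u)" for u v
    using pseudo by (simp add: trace_word_def word_prod_append pseudocharacter_def)
  show "trace_word [] - of_nat n \<in> {p. ev p = \<zero>}"
    using pseudo by (simp add: ev_diff ev_trace_word word_prod_Nil ev_of_nat pseudocharacter_def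
        a_minus_def r_neg)
  show "(\<Sum>p\<in>perms {..<Suc n}. of_int (sign p) * cycle_prod trace_word {..<Suc n} p w) \<in> {p. ev p = \<zero>}" for w
  proof -
    have "ev (\<Sum>p\<in>perms {..<Suc n}. of_int (sign p) * cycle_prod trace_word {..<Suc n} p w) =
        T_alt A G t (n + 1) (\<lambda>x. word_prod (w x))"
      unfolding T_alt_def perms_def ev_sum ev_sign ev_cycle_prod by simp
    also have "\<dots> = \<zero>"
      using pseudo by (auto simp: pseudocharacter_def)
    finally show ?thesis by simp
  qed
qed (simp_all add: ev_zero ev_add ev_mult single_add mult_single)

end

section \<open>The universal representation\<close>

lemma mat_algebra_abelian_monoid:
  assumes "abelian_monoid B"
  shows "abelian_monoid (mat_algebra n B)"
proof -
  interpret B: abelian_monoid B by (rule assms)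
  let ?I = "{..<n} \<times> {..<n}"
  have car: "carrier (mat_algebra n B) = ?I \<rightarrow>\<^sub>E carrier B"
    and zero_eq: "\<zero>\<^bsub>mat_algebra n B\<^esub> = (\<lambda>(i, j)\<in>?I. \<zero>\<^bsub>B\<^esub>)"
    and add_eq: "M \<oplus>\<^bsub>mat_algebra n B\<^esub> M' = (\<lambda>(i, j)\<in>?I. M (i, j) \<oplus>\<^bsub>B\<^esub> M' (i, j))" for M M'
    by (simp_all only: mat_algebra_def partial_object.simps monoid.simps ring.simps module.simps)
  have ext: "M = M'" if M: "M \<in> carrier (mat_algebra n B)" "M' \<in> carrier (mat_algebra n B)"
    and eq: "\<And>i j. i < n \<Longrightarrow> j < n \<Longrightarrow> M (i, j) = M' (i, j)" for M M'
  proof (rule PiE_ext[OF M[unfolded car]])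
    fix z assume "z \<in> ?I"
    then show "M z = M' z" using eq by (cases z) simp
  qed
  have en: "M (i, j) \<in> carrier B" if "M \<in> carrier (mat_algebra n B)" "i < n" "j < n" for M i j
    using PiE_mem[OF that(1)[unfolded car], of "(i, j)"] that(2,3) by simp
  have add: "M \<oplus>\<^bsub>mat_algebra n B\<^esub> M' \<in> carrier (mat_algebra n B)"
    if M: "M \<in> carrier (mat_algebra n B)" "M' \<in> carrier (mat_algebra n B)" for M M'
    unfolding add_eq unfolding car restrict_PiE_iff using en[OF M(1)] en[OF M(2)] by simp
  have ae: "(M \<oplus>\<^bsub>mat_algebra n B\<^esub> M') (i, j) = M (i, j) \<oplus>\<^bsub>B\<^esub> M' (i, j)" if "i < n" "j < n" for M M' i j
    unfolding add_eq using that by simp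
  have zero: "\<zero>\<^bsub>mat_algebra n B\<^esub> \<in> carrier (mat_algebra n B)"
    unfolding zero_eq unfolding car restrict_PiE_iff by simp
  have ze: "\<zero>\<^bsub>mat_algebra n B\<^esub> (i, j) = \<zero>\<^bsub>B\<^esub>" if "i < n" "j < n" for i j
    unfolding zero_eq using that by simp
  show ?thesis
  proof (rule abelian_monoidI)
    fix M M' M'' assume M: "M \<in> carrier (mat_algebra n B)" "M' \<in> carrier (mat_algebra n B)"
      "M'' \<in> carrier (mat_algebra n B)"
    show "M \<oplus>\<^bsub>mat_algebra n B\<^esub> M' \<oplus>\<^bsub>mat_algebra n B\<^esub> M'' =
        M \<oplus>\<^bsub>mat_algebra n B\<^esub> (M' \<oplus>\<^bsub>mat_algebra n B\<^esub> M'')"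
      by (rule ext[OF add[OF add[OF M(1,2)] M(3)] add[OF M(1) add[OF M(2,3)]]])
        (simp only: ae B.a_assoc[OF en[OF M(1)] en[OF M(2)] en[OF M(3)]])
  next
    fix M M' assume M: "M \<in> carrier (mat_algebra n B)" "M' \<in> carrier (mat_algebra n B)"
    show "M \<oplus>\<^bsub>mat_algebra n B\<^esub> M' = M' \<oplus>\<^bsub>mat_algebra n B\<^esub> M"
      by (rule ext[OF add[OF M] add[OF M(2,1)]]) (simp only: ae B.a_comm[OF en[OF M(1)] en[OF M(2)]])
  next
    fix M assume M: "M \<in> carrier (mat_algebra n B)"
    show "\<zero>\<^bsub>mat_algebra n B\<^esub> \<oplus>\<^bsub>mat_algebra n B\<^esub> M = M"
      by (rule ext[OF add[OF zero M] M]) (simp only: ae ze B.l_zero[OF en[OF M]])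
  qed (fact add zero)+
qed

lemma mat_algebra_finsum:
  assumes "abelian_monoid B" "finite S" "\<And>x. x \<in> S \<Longrightarrow> M x \<in> carrier (mat_algebra n B)"
  shows "(\<Oplus>\<^bsub>mat_algebra n B\<^esub>x\<in>S. M x) = (\<lambda>(i, j)\<in>{..<n} \<times> {..<n}. \<Oplus>\<^bsub>B\<^esub>x\<in>S. M x (i, j))"
proof -
  interpret B: abelian_monoid B by (rule assms)
  interpret MB: abelian_monoid "mat_algebra n B" by (rule mat_algebra_abelian_monoid[OF assms(1)])
  show ?thesis
    using assms(2,3)
  proof (induction S rule: finite_induct)
    case empty
    show ?case unfolding MB.finsum_empty B.finsum_empty by (auto simp: mat_algebra_def intro!: restrict_ext)
  next
    case (insert x S)
    have en: "M y (i, j) \<in> carrier B" if "y \<in> insert x S" "i < n" "j < n" for y i j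
      using insert.prems[OF that(1)] that by (auto simp: mat_algebra_def)
    have "(\<Oplus>\<^bsub>mat_algebra n B\<^esub>y\<in>insert x S. M y) = M x \<oplus>\<^bsub>mat_algebra n B\<^esub> (\<Oplus>\<^bsub>mat_algebra n B\<^esub>y\<in>S. M y)"
      using insert by (intro MB.finsum_insert) auto
    also have "\<dots> = M x \<oplus>\<^bsub>mat_algebra n B\<^esub> (\<lambda>(i, j)\<in>{..<n} \<times> {..<n}. \<Oplus>\<^bsub>B\<^esub>y\<in>S. M y (i, j))"
      by (intro arg_cong2[where f = "ring.add (mat_algebra n B)"] refl insert.IH insert.prems) simp
    also have "\<dots> = (\<lambda>(i, j)\<in>{..<n} \<times> {..<n}. M x (i, j) \<oplus>\<^bsub>B\<^esub> (\<Oplus>\<^bsub>B\<^esub>y\<in>S. M y (i, j)))"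
      by (auto simp: mat_algebra_def fun_eq_iff)
    also have "\<dots> = (\<lambda>(i, j)\<in>{..<n} \<times> {..<n}. \<Oplus>\<^bsub>B\<^esub>y\<in>insert x S. M y (i, j))"
      using insert.hyps en by (intro restrict_ext) (auto simp: B.finsum_insert Pi_def)
    finally show ?case .
  qed
qed

context rat_pseudocharacter
begin

section \<open>The quotient algebra\<close>

text \<open>The class of \<open>p\<close> modulo the ideal is encoded by the singleton of the functional
  \<open>M \<mapsto> \<Phi>(p M)\<close> on monomials, which determines it.\<close>

definition coset :: "(('g \<times> nat \<times> nat) multiset \<Rightarrow>\<^sub>0 ('a multiset \<Rightarrow>\<^sub>0 rat)) \<Rightarrow> ('a, 'g) poly_quot" where
  "coset p = {\<lambda>M. ev (functional (p * Poly_Mapping.single M 1))}"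

lemma coset_eq_iff: "coset p = coset p' \<longleftrightarrow> p - p' \<in> relations"
proof -
  have *: "ev (functional ((p - p') * r)) = ev (functional (p * r)) \<ominus> ev (functional (p' * r))" for r
    by (simp add: left_diff_distrib functional_def lin_ext_diff ev_diff)
  show ?thesis
  proof
    assume "coset p = coset p'"
    then have eq: "ev (functional (p * Poly_Mapping.single M 1)) = ev (functional (p' * Poly_Mapping.single M 1))" for M
      by (simp add: coset_def fun_eq_iff)
    show "p - p' \<in> relations"
    proof (rule relationsI)
      fix xs
      show "functional ((p - p') * Poly_Mapping.single (mset xs) 1) \<in> {p. ev p = \<zero>}"
        using *[of "Poly_Mapping.single (mset xs) 1"] eq[of "mset xs"] by (simp add: a_minus_def r_neg)
    qed
  next
    assume "p - p' \<in> relations"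
    then have "ev (functional (p * r)) \<ominus> ev (functional (p' * r)) = \<zero>" for r
      using *[of r] by (simp add: relations_def)
    then have "ev (functional (p * r)) = ev (functional (p' * r))" for r
      by (simp add: r_right_minus_eq)
    then show "coset p = coset p'" by (simp add: coset_def)
  qed
qed

lemma coset_zero_iff: "coset p = coset 0 \<longleftrightarrow> p \<in> relations"
  by (simp add: coset_eq_iff)

lemma coset_add_cong: "coset p = coset p' \<Longrightarrow> coset r = coset r' \<Longrightarrow> coset (p + r) = coset (p' + r')"
  using relations_add[of "p - p'" "r - r'"] by (simp add: coset_eq_iff algebra_simps)

lemma coset_mult_left: "coset p = coset p' \<Longrightarrow> coset (r * p) = coset (r * p')"
  using relations_mult[of "p - p'" r] by (simp add: coset_eq_iff algebra_simps)

lemma coset_mult_cong: "coset p = coset p' \<Longrightarrow> coset r = coset r' \<Longrightarrow> coset (p * r) = coset (p' * r')"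
  using coset_mult_left[of r r' p] coset_mult_left[of p p' r'] by (simp add: mult.commute)

lemma coset_sum_cong:
  "(\<And>x. x \<in> S \<Longrightarrow> coset (p x) = coset (p' x)) \<Longrightarrow> coset (sum p S) = coset (sum p' S)"
proof (induction S rule: infinite_finite_induct)
  case (insert x S)
  show ?case unfolding sum.insert[OF insert.hyps(1,2)]
    by (rule coset_add_cong) (simp_all add: insert.IH insert.prems)
qed simp_all

text \<open>Respects the ring operations only after passing to classes, which is why the rules below
  are stated under \<open>coset\<close>.\<close>

definition const :: "'a \<Rightarrow> ('g \<times> nat \<times> nat) multiset \<Rightarrow>\<^sub>0 ('a multiset \<Rightarrow>\<^sub>0 rat)" where
  "const a = Poly_Mapping.single 0 (lift a)"

text \<open>Together with \<open>ev_lift\<close> this embeds the coefficient ring in the quotient;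
  it rests on \<open>relations_const_iff\<close>.\<close>

lemma coset_single_eq_iff:
  "coset (Poly_Mapping.single 0 c) = coset (Poly_Mapping.single 0 c') \<longleftrightarrow> ev c = ev c'"
proof -
  have "coset (Poly_Mapping.single 0 c) = coset (Poly_Mapping.single 0 c') \<longleftrightarrow> ev (c - c') = \<zero>"
    unfolding coset_eq_iff single_diff[symmetric] relations_const_iff by simp
  then show ?thesis by (simp add: ev_diff r_right_minus_eq)
qed

lemma coset_const_add: "a \<in> carrier A \<Longrightarrow> b \<in> carrier A \<Longrightarrow> coset (const (a \<oplus> b)) = coset (const a + const b)"
  unfolding const_def single_add[symmetric] coset_single_eq_iff by (simp add: ev_lift ev_add)

lemma single_zero_mult: "Poly_Mapping.single (0 :: 'x::monoid_add) c * Poly_Mapping.single 0 d = Poly_Mapping.single 0 (c * d)"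
  by (simp add: mult_single)

lemma coset_const_mult: "a \<in> carrier A \<Longrightarrow> b \<in> carrier A \<Longrightarrow> coset (const (a \<otimes> b)) = coset (const a * const b)"
  unfolding const_def single_zero_mult coset_single_eq_iff by (simp add: ev_lift ev_mult)

lemma coset_const_one: "coset (const \<one>) = coset 1"
  unfolding const_def single_one[symmetric] coset_single_eq_iff by (simp add: ev_lift ev_one)

lemma coset_const_zero: "coset (const \<zero>) = coset 0"
  using coset_single_eq_iff[of "lift \<zero>" 0] by (simp add: const_def ev_lift ev_zero)

lemma coset_const_finsum:
  assumes "\<And>x. x \<in> S \<Longrightarrow> g x \<in> carrier A"
  shows "coset (const (\<Oplus>x\<in>S. g x)) = coset (\<Sum>x\<in>S. const (g x))"
  using assms
  by (induction S rule: infinite_finite_induct)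
    (auto simp: coset_const_zero coset_const_add Pi_def intro!: coset_add_cong)

text \<open>A class is encoded by a functional and does not contain its representatives, so the
  operations on classes have to choose them.\<close>

definition rep :: "('a, 'g) poly_quot \<Rightarrow> ('g \<times> nat \<times> nat) multiset \<Rightarrow>\<^sub>0 ('a multiset \<Rightarrow>\<^sub>0 rat)" where
  "rep Z = (SOME p. coset p = Z)"

lemma coset_rep: "coset (rep (coset p)) = coset p"
  unfolding rep_def by (rule someI) (rule refl)

definition quot :: "('a, ('a, 'g) poly_quot) module" where
  "quot = \<lparr>carrier = range coset,
    monoid.mult = (\<lambda>Z Z'. coset (rep Z * rep Z')), monoid.one = coset 1,
    ring.zero = coset 0, ring.add = (\<lambda>Z Z'. coset (rep Z + rep Z')),
    smult = (\<lambda>a Z. coset (const a * rep Z))\<rparr>"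

lemma quot_simps [simp]:
  "carrier quot = range coset"
  "coset p \<otimes>\<^bsub>quot\<^esub> coset p' = coset (p * p')"
  "coset p \<oplus>\<^bsub>quot\<^esub> coset p' = coset (p + p')"
  "\<one>\<^bsub>quot\<^esub> = coset 1" "\<zero>\<^bsub>quot\<^esub> = coset 0"
  "a \<odot>\<^bsub>quot\<^esub> coset p = coset (const a * p)"
  by (simp_all add: quot_def coset_mult_cong[OF coset_rep coset_rep] coset_add_cong[OF coset_rep coset_rep]
      coset_mult_cong[OF coset_rep refl] coset_mult_left[OF coset_rep])

lemma quot_cring: "cring quot"
proof (rule cringI)
  show "abelian_group quot"
  proof (rule abelian_groupI)
    fix Z assume "Z \<in> carrier quot"
    then obtain p where p: "Z = coset p" by auto
    have "coset (- p) \<oplus>\<^bsub>quot\<^esub> Z = \<zero>\<^bsub>quot\<^esub>" by (simp add: p)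
    then show "\<exists>Z'\<in>carrier quot. Z' \<oplus>\<^bsub>quot\<^esub> Z = \<zero>\<^bsub>quot\<^esub>" by (intro bexI[of _ "coset (- p)"]) auto
  qed (auto simp: add_ac)
  show "Group.comm_monoid quot"
    by (rule comm_monoidI) (auto simp: mult_ac)
qed (auto simp: distrib_right)

lemma quot_algebra: "algebra A quot"
proof (rule algebraI[OF is_cring quot_cring])
  show "(a \<oplus> b) \<odot>\<^bsub>quot\<^esub> Z = a \<odot>\<^bsub>quot\<^esub> Z \<oplus>\<^bsub>quot\<^esub> b \<odot>\<^bsub>quot\<^esub> Z"
    if ab: "a \<in> carrier A" "b \<in> carrier A" and Z: "Z \<in> carrier quot" for a b Z
  proof -
    obtain p where "Z = coset p" using Z by auto
    then show ?thesis
      using coset_mult_cong[OF coset_const_add[OF ab] refl, of p] by (simp add: distrib_right)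
  qed
  show "a \<otimes> b \<odot>\<^bsub>quot\<^esub> Z = a \<odot>\<^bsub>quot\<^esub> (b \<odot>\<^bsub>quot\<^esub> Z)"
    if ab: "a \<in> carrier A" "b \<in> carrier A" and Z: "Z \<in> carrier quot" for a b Z
  proof -
    obtain p where "Z = coset p" using Z by auto
    then show ?thesis
      using coset_mult_cong[OF coset_const_mult[OF ab] refl, of p] by (simp add: mult.assoc)
  qed
  show "\<one> \<odot>\<^bsub>quot\<^esub> Z = Z" if Z: "Z \<in> carrier quot" for Z
  proof -
    obtain p where "Z = coset p" using Z by auto
    then show ?thesis using coset_mult_cong[OF coset_const_one refl, of p] by simp
  qed
qed (auto simp: distrib_left mult.assoc)

lemma quot_abelian_monoid: "abelian_monoid quot"
  using quot_cring by (simp add: cring_def ring_def abelian_group_def)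

lemma quot_finsum: "(\<Oplus>\<^bsub>quot\<^esub>x\<in>S. coset (p x)) = coset (\<Sum>x\<in>S. p x)"
proof -
  interpret Q: abelian_monoid quot by (rule quot_abelian_monoid)
  show ?thesis
  proof (induction S rule: infinite_finite_induct)
    case (insert x S)
    have "(\<Oplus>\<^bsub>quot\<^esub>y\<in>insert x S. coset (p y)) = coset (p x) \<oplus>\<^bsub>quot\<^esub> (\<Oplus>\<^bsub>quot\<^esub>y\<in>S. coset (p y))"
      using insert.hyps by (intro Q.finsum_insert) auto
    then show ?case using insert by simp
  qed simp_all
qed

section \<open>The generic matrices as a representation\<close>

definition \<rho> :: "'g \<Rightarrow> nat \<times> nat \<Rightarrow> ('a, 'g) poly_quot" where
  "\<rho> g = (\<lambda>(i, j)\<in>{..<n} \<times> {..<n}. coset (entry g i j))"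

lemma trace_word_eqI: "word_prod u = word_prod v \<Longrightarrow> ev (trace_word u - trace_word v) = \<zero>"
  by (simp add: trace_word_def ev_zero)

lemma coset_entry_mult:
  assumes "x \<in> carrier G" "y \<in> carrier G"
  shows "coset (\<Sum>k<n. entry x i k * entry y k j) = coset (entry (x \<otimes>\<^bsub>G\<^esub> y) i j)"
  unfolding coset_eq_iff
proof (rule entry_mult)
  show "trace_word ([x, y] @ v) - trace_word ([x \<otimes>\<^bsub>G\<^esub> y] @ v) \<in> {p. ev p = \<zero>}" for v
    using assms by (simp add: trace_word_eqI word_prod_Cons G.m_assoc)
qed

lemma coset_entry_one: "i < n \<Longrightarrow> coset (entry \<one>\<^bsub>G\<^esub> i j) = coset (of_bool (i = j))"
  unfolding coset_eq_iff
proof (rule entry_one)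
  show "trace_word ([\<one>\<^bsub>G\<^esub>] @ v) - trace_word v \<in> {p. ev p = \<zero>}" for v
    by (simp add: trace_word_eqI word_prod_Cons)
qed

lemma coset_entry_trace:
  assumes "x \<in> carrier G" shows "coset (\<Sum>k<n. entry x k k) = coset (const (t x))"
  unfolding coset_eq_iff
  using entry_trace[of x] assms by (simp add: const_def trace_word_def word_prod_Cons word_prod_Nil)

lemma mat_entry_mult:
  "(\<lambda>(i, j)\<in>{..<n} \<times> {..<n}. coset (p i j)) \<otimes>\<^bsub>mat_algebra n quot\<^esub> (\<lambda>(i, j)\<in>{..<n} \<times> {..<n}. coset (p' i j)) =
    (\<lambda>(i, j)\<in>{..<n} \<times> {..<n}. coset (\<Sum>k<n. p i k * p' k j))"
proof -
  interpret Q: abelian_monoid quot by (rule quot_abelian_monoid)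
  have "(\<Oplus>\<^bsub>quot\<^esub>k\<in>{..<n}. (\<lambda>(i, j)\<in>{..<n} \<times> {..<n}. coset (p i j)) (i, k) \<otimes>\<^bsub>quot\<^esub>
      (\<lambda>(i, j)\<in>{..<n} \<times> {..<n}. coset (p' i j)) (k, j)) = coset (\<Sum>k<n. p i k * p' k j)"
    if "i < n" "j < n" for i j
  proof -
    have "(\<Oplus>\<^bsub>quot\<^esub>k\<in>{..<n}. (\<lambda>(i, j)\<in>{..<n} \<times> {..<n}. coset (p i j)) (i, k) \<otimes>\<^bsub>quot\<^esub>
      (\<lambda>(i, j)\<in>{..<n} \<times> {..<n}. coset (p' i j)) (k, j)) = (\<Oplus>\<^bsub>quot\<^esub>k\<in>{..<n}. coset (p i k * p' k j))"
      by (rule Q.finsum_cong') (use that in auto)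
    then show ?thesis by (simp add: quot_finsum)
  qed
  then show ?thesis unfolding mat_algebra_def by (auto intro!: restrict_ext)
qed

lemma mat_one: "\<one>\<^bsub>mat_algebra n quot\<^esub> = (\<lambda>(i, j)\<in>{..<n} \<times> {..<n}. coset (of_bool (i = j)))"
  unfolding mat_algebra_def by (auto intro!: restrict_ext)

lemma \<rho>_closed: "\<rho> g \<in> carrier (mat_algebra n quot)"
  by (auto simp: \<rho>_def mat_algebra_def)

lemma \<rho>_mult:
  assumes "x \<in> carrier G" "y \<in> carrier G"
  shows "\<rho> (x \<otimes>\<^bsub>G\<^esub> y) = \<rho> x \<otimes>\<^bsub>mat_algebra n quot\<^esub> \<rho> y"
  unfolding \<rho>_def mat_entry_mult using coset_entry_mult[OF assms] by simp

lemma \<rho>_one: "\<rho> \<one>\<^bsub>G\<^esub> = \<one>\<^bsub>mat_algebra n quot\<^esub>"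
  unfolding \<rho>_def mat_one by (rule restrict_ext) (auto simp: coset_entry_one)

lemma \<rho>_hom: "\<rho> \<in> hom G (GL n quot)"
proof (rule homI)
  fix x assume x: "x \<in> carrier G"
  have "\<rho> x \<otimes>\<^bsub>mat_algebra n quot\<^esub> \<rho> (inv\<^bsub>G\<^esub> x) = \<one>\<^bsub>mat_algebra n quot\<^esub>"
    "\<rho> (inv\<^bsub>G\<^esub> x) \<otimes>\<^bsub>mat_algebra n quot\<^esub> \<rho> x = \<one>\<^bsub>mat_algebra n quot\<^esub>"
    using x by (simp_all flip: \<rho>_mult \<rho>_one)
  then show "\<rho> x \<in> carrier (GL n quot)"
    using \<rho>_closed by (auto simp: GL_def units_of_def Units_def)
next
  fix x y assume "x \<in> carrier G" "y \<in> carrier G"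
  then show "\<rho> (x \<otimes>\<^bsub>G\<^esub> y) = \<rho> x \<otimes>\<^bsub>GL n quot\<^esub> \<rho> y"
    by (simp add: GL_def units_of_def \<rho>_mult)
qed

section \<open>Linear extension to the group algebra\<close>

abbreviation (input) AG :: "('a, 'g \<Rightarrow> 'a) module" where "AG \<equiv> group_algebra A G"
abbreviation (input) supp :: "('g \<Rightarrow> 'a) \<Rightarrow> 'g set" where "supp \<equiv> coeff_support A"

lemma AG_carrier: "f \<in> carrier AG \<longleftrightarrow> range f \<subseteq> carrier A \<and> supp f \<subseteq> carrier G \<and> finite (supp f)"
  by (simp add: group_algebra_def)

lemma AG_D:
  assumes "f \<in> carrier AG"
  shows "f x \<in> carrier A" "supp f \<subseteq> carrier G" "finite (supp f)" "x \<notin> supp f \<Longrightarrow> f x = \<zero>"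
  using assms by (auto simp: AG_carrier coeff_support_def)

text \<open>A polynomial representing a linear extension. Leaving \<open>V\<close> free covers both
  the matrix entries and the constants \<open>t x\<close> by the same rules.\<close>

definition lin :: "('g \<Rightarrow> ('g \<times> nat \<times> nat) multiset \<Rightarrow>\<^sub>0 ('a multiset \<Rightarrow>\<^sub>0 rat)) \<Rightarrow> ('g \<Rightarrow> 'a)
    \<Rightarrow> ('g \<times> nat \<times> nat) multiset \<Rightarrow>\<^sub>0 ('a multiset \<Rightarrow>\<^sub>0 rat)" where
  "lin V f = (\<Sum>x\<in>supp f. const (f x) * V x)"

lemma coset_lin_superset:
  assumes "finite S" "supp f \<subseteq> S"
  shows "coset (lin V f) = coset (\<Sum>x\<in>S. const (f x) * V x)"
proof -
  \<comment> \<open>Outside the support the coefficient is \<open>const \<zero>\<close>, a nonzero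
    polynomial whose class is zero.\<close>
  have "coset (const (f x) * V x) = coset (if x \<in> supp f then const (f x) * V x else 0)" for x
    using coset_mult_cong[OF coset_const_zero refl, of "V x"] by (auto simp: coeff_support_def)
  then have "coset (\<Sum>x\<in>S. const (f x) * V x) = coset (\<Sum>x\<in>S. if x \<in> supp f then const (f x) * V x else 0)"
    by (rule coset_sum_cong)
  also have "(\<Sum>x\<in>S. if x \<in> supp f then const (f x) * V x else 0) = lin V f"
    unfolding lin_def using assms by (simp add: sum.If_cases Int_absorb1)
  finally show ?thesis by simp
qed

lemma AG_add: "(f \<oplus>\<^bsub>AG\<^esub> h) x = f x \<oplus> h x"
  by (simp add: group_algebra_def)

lemma supp_add: "supp (f \<oplus>\<^bsub>AG\<^esub> h) \<subseteq> supp f \<union> supp h"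
  by (auto simp: coeff_support_def AG_add)

lemma AG_add_closed:
  assumes "f \<in> carrier AG" "h \<in> carrier AG" shows "f \<oplus>\<^bsub>AG\<^esub> h \<in> carrier AG"
  using assms supp_add[of f h] AG_D(1)[OF assms(1)] AG_D(1)[OF assms(2)]
  by (auto simp: AG_carrier AG_add intro: finite_subset)

lemma coset_lin_add:
  assumes "f \<in> carrier AG" "h \<in> carrier AG"
  shows "coset (lin V (f \<oplus>\<^bsub>AG\<^esub> h)) = coset (lin V f + lin V h)"
proof -
  let ?S = "supp f \<union> supp h"
  have fin: "finite ?S" using assms AG_D(3) by blast
  have "coset (lin V (f \<oplus>\<^bsub>AG\<^esub> h)) = coset (\<Sum>x\<in>?S. const ((f \<oplus>\<^bsub>AG\<^esub> h) x) * V x)"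
    by (rule coset_lin_superset[OF fin supp_add])
  also have "\<dots> = coset (\<Sum>x\<in>?S. (const (f x) + const (h x)) * V x)"
    unfolding AG_add
    by (intro coset_sum_cong coset_mult_cong coset_const_add AG_D(1)[OF assms(1)] AG_D(1)[OF assms(2)] refl)
  also have "\<dots> = coset ((\<Sum>x\<in>?S. const (f x) * V x) + (\<Sum>x\<in>?S. const (h x) * V x))"
    by (simp add: distrib_right sum.distrib)
  also have "\<dots> = coset (lin V f + lin V h)"
    by (intro coset_add_cong coset_lin_superset[OF fin, symmetric]) auto
  finally show ?thesis .
qed

lemma AG_smult: "(a \<odot>\<^bsub>AG\<^esub> f) x = a \<otimes> f x"
  by (simp add: group_algebra_def)

lemma supp_smult: "a \<in> carrier A \<Longrightarrow> supp (a \<odot>\<^bsub>AG\<^esub> f) \<subseteq> supp f"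
  by (auto simp: coeff_support_def AG_smult)

lemma AG_smult_closed:
  assumes "a \<in> carrier A" "f \<in> carrier AG" shows "a \<odot>\<^bsub>AG\<^esub> f \<in> carrier AG"
  using assms supp_smult[OF assms(1), of f] AG_D(1)[OF assms(2)]
  by (auto simp: AG_carrier AG_smult intro: finite_subset)

lemma coset_lin_smult:
  assumes "a \<in> carrier A" "f \<in> carrier AG"
  shows "coset (lin V (a \<odot>\<^bsub>AG\<^esub> f)) = coset (const a * lin V f)"
proof -
  have "coset (lin V (a \<odot>\<^bsub>AG\<^esub> f)) = coset (\<Sum>x\<in>supp f. const ((a \<odot>\<^bsub>AG\<^esub> f) x) * V x)"
    by (rule coset_lin_superset[OF AG_D(3)[OF assms(2)] supp_smult[OF assms(1)]])
  also have "\<dots> = coset (\<Sum>x\<in>supp f. (const a * const (f x)) * V x)"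
    unfolding AG_smult
    by (intro coset_sum_cong coset_mult_cong coset_const_mult assms(1) AG_D(1)[OF assms(2)] refl)
  finally show ?thesis by (simp add: lin_def sum_distrib_left mult.assoc)
qed

lemma AG_mult:
  "x \<in> carrier G \<Longrightarrow> (f \<otimes>\<^bsub>AG\<^esub> h) x = (\<Oplus>y\<in>supp f. f y \<otimes> h (inv\<^bsub>G\<^esub> y \<otimes>\<^bsub>G\<^esub> x))"
  by (simp add: group_algebra_def)

lemma supp_mult:
  assumes "f \<in> carrier AG" "h \<in> carrier AG"
  shows "supp (f \<otimes>\<^bsub>AG\<^esub> h) \<subseteq> (\<lambda>(y, z). y \<otimes>\<^bsub>G\<^esub> z) ` (supp f \<times> supp h)"
proof
  fix x assume x: "x \<in> supp (f \<otimes>\<^bsub>AG\<^esub> h)"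
  then have xG: "x \<in> carrier G" by (auto simp: coeff_support_def group_algebra_def split: if_splits)
  show "x \<in> (\<lambda>(y, z). y \<otimes>\<^bsub>G\<^esub> z) ` (supp f \<times> supp h)"
  proof (rule ccontr)
    assume n: "x \<notin> (\<lambda>(y, z). y \<otimes>\<^bsub>G\<^esub> z) ` (supp f \<times> supp h)"
    have "f y \<otimes> h (inv\<^bsub>G\<^esub> y \<otimes>\<^bsub>G\<^esub> x) = \<zero>" if y: "y \<in> supp f" for y
    proof -
      have yG: "y \<in> carrier G" using y AG_D(2)[OF assms(1)] by blast
      have "x = y \<otimes>\<^bsub>G\<^esub> (inv\<^bsub>G\<^esub> y \<otimes>\<^bsub>G\<^esub> x)" using xG yG by (simp add: G.m_assoc[symmetric])
      then have "inv\<^bsub>G\<^esub> y \<otimes>\<^bsub>G\<^esub> x \<notin> supp h" using n y by force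
      then show ?thesis using AG_D(4)[OF assms(2)] AG_D(1)[OF assms(1)] by simp
    qed
    then have "(f \<otimes>\<^bsub>AG\<^esub> h) x = (\<Oplus>y\<in>supp f. \<zero>)"
      unfolding AG_mult[OF xG] by (intro finsum_cong') auto
    then show False using x by (simp add: coeff_support_def)
  qed
qed

lemma AG_mult_closed:
  assumes "f \<in> carrier AG" "h \<in> carrier AG" shows "f \<otimes>\<^bsub>AG\<^esub> h \<in> carrier AG"
  unfolding AG_carrier
proof (intro conjI)
  have "(f \<otimes>\<^bsub>AG\<^esub> h) x \<in> carrier A" for x
  proof (cases "x \<in> carrier G")
    case True
    then show ?thesis unfolding AG_mult[OF True]
      using AG_D(1)[OF assms(1)] AG_D(1)[OF assms(2)] by (intro finsum_closed) auto
  next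
    case False
    then show ?thesis by (simp add: group_algebra_def)
  qed
  then show "range (f \<otimes>\<^bsub>AG\<^esub> h) \<subseteq> carrier A" by blast
  show "supp (f \<otimes>\<^bsub>AG\<^esub> h) \<subseteq> carrier G"
    using supp_mult[OF assms] AG_D(2)[OF assms(1)] AG_D(2)[OF assms(2)] by fastforce
  show "finite (supp (f \<otimes>\<^bsub>AG\<^esub> h))"
    using finite_subset[OF supp_mult[OF assms]] AG_D(3)[OF assms(1)] AG_D(3)[OF assms(2)] by simp
qed

text \<open>The convolution is summed over the finite set of products of the two supports; for fixed
  \<open>y\<close> the substitution \<open>x = y z\<close> then separates the sums.\<close>

lemma coset_lin_mult:
  assumes f: "f \<in> carrier AG" and h: "h \<in> carrier AG"
  shows "coset (lin V (f \<otimes>\<^bsub>AG\<^esub> h)) = coset (\<Sum>y\<in>supp f. const (f y) * lin (\<lambda>z. V (y \<otimes>\<^bsub>G\<^esub> z)) h)"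
proof -
  let ?S = "(\<lambda>(y, z). y \<otimes>\<^bsub>G\<^esub> z) ` (supp f \<times> supp h)"
  have fin: "finite ?S" using AG_D(3)[OF f] AG_D(3)[OF h] by simp
  have SG: "?S \<subseteq> carrier G" using AG_D(2)[OF f] AG_D(2)[OF h] by fastforce
  have "coset (lin V (f \<otimes>\<^bsub>AG\<^esub> h)) = coset (\<Sum>x\<in>?S. const ((f \<otimes>\<^bsub>AG\<^esub> h) x) * V x)"
    by (rule coset_lin_superset[OF fin supp_mult[OF f h]])
  also have "\<dots> = coset (\<Sum>x\<in>?S. (\<Sum>y\<in>supp f. const (f y) * const (h (inv\<^bsub>G\<^esub> y \<otimes>\<^bsub>G\<^esub> x))) * V x)"
  proof (intro coset_sum_cong coset_mult_cong refl)
    fix x assume "x \<in> ?S"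
    then have x: "x \<in> carrier G" using SG by blast
    have "coset (const ((f \<otimes>\<^bsub>AG\<^esub> h) x)) = coset (\<Sum>y\<in>supp f. const (f y \<otimes> h (inv\<^bsub>G\<^esub> y \<otimes>\<^bsub>G\<^esub> x)))"
      unfolding AG_mult[OF x] by (rule coset_const_finsum) (simp add: AG_D(1)[OF f] AG_D(1)[OF h])
    also have "\<dots> = coset (\<Sum>y\<in>supp f. const (f y) * const (h (inv\<^bsub>G\<^esub> y \<otimes>\<^bsub>G\<^esub> x)))"
      by (intro coset_sum_cong coset_const_mult AG_D(1)[OF f] AG_D(1)[OF h])
    finally show "coset (const ((f \<otimes>\<^bsub>AG\<^esub> h) x)) = \<dots>" .
  qed
  also have "(\<Sum>x\<in>?S. (\<Sum>y\<in>supp f. const (f y) * const (h (inv\<^bsub>G\<^esub> y \<otimes>\<^bsub>G\<^esub> x))) * V x) =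
      (\<Sum>y\<in>supp f. const (f y) * (\<Sum>x\<in>?S. const (h (inv\<^bsub>G\<^esub> y \<otimes>\<^bsub>G\<^esub> x)) * V x))"
    unfolding sum_distrib_right sum_distrib_left by (subst sum.swap) (simp add: mult.assoc)
  also have "coset \<dots> = coset (\<Sum>y\<in>supp f. const (f y) * lin (\<lambda>z. V (y \<otimes>\<^bsub>G\<^esub> z)) h)"
  proof (intro coset_sum_cong coset_mult_left)
    fix y assume y: "y \<in> supp f"
    then have yG: "y \<in> carrier G" using AG_D(2)[OF f] by blast
    let ?i = "\<lambda>x. inv\<^bsub>G\<^esub> y \<otimes>\<^bsub>G\<^esub> x"
    have cancel: "y \<otimes>\<^bsub>G\<^esub> ?i x = x" if "x \<in> carrier G" for x
      using that yG by (simp add: G.m_assoc[symmetric])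
    have inj: "inj_on ?i ?S"
      by (rule inj_on_inverseI[where g = "\<lambda>x. y \<otimes>\<^bsub>G\<^esub> x"]) (use SG cancel in blast)
    \<comment> \<open>The shifted set may be larger than the support of \<open>h\<close>;
      \<open>coset_lin_superset\<close> absorbs the extra terms.\<close>
    have sub: "supp h \<subseteq> ?i ` ?S"
    proof
      fix z assume z: "z \<in> supp h"
      then have "z = ?i (y \<otimes>\<^bsub>G\<^esub> z)" using AG_D(2)[OF h] yG by (simp add: G.m_assoc[symmetric] subset_iff)
      moreover have "y \<otimes>\<^bsub>G\<^esub> z \<in> ?S" using y z by force
      ultimately show "z \<in> ?i ` ?S" by blast
    qed
    have "coset (lin (\<lambda>z. V (y \<otimes>\<^bsub>G\<^esub> z)) h) = coset (\<Sum>z\<in>?i ` ?S. const (h z) * V (y \<otimes>\<^bsub>G\<^esub> z))"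
      using fin by (intro coset_lin_superset sub) simp
    also have "(\<Sum>z\<in>?i ` ?S. const (h z) * V (y \<otimes>\<^bsub>G\<^esub> z)) = (\<Sum>x\<in>?S. const (h (?i x)) * V x)"
      unfolding sum.reindex[OF inj] using cancel SG by (intro sum.cong refl) auto
    finally show "coset (\<Sum>x\<in>?S. const (h (?i x)) * V x) = coset (lin (\<lambda>z. V (y \<otimes>\<^bsub>G\<^esub> z)) h)" by simp
  qed
  finally show ?thesis .
qed

abbreviation (input) \<rho>\<^sub>l :: "('g \<Rightarrow> 'a) \<Rightarrow> nat \<times> nat \<Rightarrow> ('a, 'g) poly_quot" where
  "\<rho>\<^sub>l \<equiv> linear_extension A (mat_algebra n quot) \<rho>"

lemma linear_extension_\<rho>:
  assumes "f \<in> carrier AG"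
  shows "\<rho>\<^sub>l f = (\<lambda>(i, j)\<in>{..<n} \<times> {..<n}. coset (lin (\<lambda>x. entry x i j) f))"
proof -
  interpret Q: abelian_monoid quot by (rule quot_abelian_monoid)
  have sm: "a \<odot>\<^bsub>mat_algebra n quot\<^esub> \<rho> x = (\<lambda>(i, j)\<in>{..<n} \<times> {..<n}. coset (const a * entry x i j))" for a x
    by (auto simp: mat_algebra_def \<rho>_def fun_eq_iff)
  have "\<rho>\<^sub>l f = (\<Oplus>\<^bsub>mat_algebra n quot\<^esub>x\<in>supp f. (\<lambda>(i, j)\<in>{..<n} \<times> {..<n}. coset (const (f x) * entry x i j)))"
    by (simp add: linear_extension_def sm)
  also have "\<dots> = (\<lambda>(i, j)\<in>{..<n} \<times> {..<n}. \<Oplus>\<^bsub>quot\<^esub>x\<in>supp f.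
      (\<lambda>(i, j)\<in>{..<n} \<times> {..<n}. coset (const (f x) * entry x i j)) (i, j))"
    by (rule mat_algebra_finsum[OF quot_abelian_monoid AG_D(3)[OF assms]]) (auto simp: mat_algebra_def)
  also have "\<dots> = (\<lambda>(i, j)\<in>{..<n} \<times> {..<n}. coset (lin (\<lambda>x. entry x i j) f))"
    by (rule restrict_ext) (auto simp: quot_finsum lin_def)
  finally show ?thesis .
qed

lemma coset_lin_entry_mult:
  assumes f: "f \<in> carrier AG" and h: "h \<in> carrier AG"
  shows "coset (lin (\<lambda>x. entry x i j) (f \<otimes>\<^bsub>AG\<^esub> h)) =
    coset (\<Sum>k<n. lin (\<lambda>x. entry x i k) f * lin (\<lambda>x. entry x k j) h)"
proof -
  have "coset (lin (\<lambda>x. entry x i j) (f \<otimes>\<^bsub>AG\<^esub> h)) =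
      coset (\<Sum>y\<in>supp f. const (f y) * (\<Sum>z\<in>supp h. const (h z) * entry (y \<otimes>\<^bsub>G\<^esub> z) i j))"
    unfolding coset_lin_mult[OF f h] lin_def[of _ h] ..
  also have "\<dots> = coset (\<Sum>y\<in>supp f. const (f y) * (\<Sum>z\<in>supp h. const (h z) * (\<Sum>k<n. entry y i k * entry z k j)))"
    using AG_D(2)[OF f] AG_D(2)[OF h]
    by (intro coset_sum_cong coset_mult_left coset_entry_mult[symmetric]) auto
  also have "(\<Sum>y\<in>supp f. const (f y) * (\<Sum>z\<in>supp h. const (h z) * (\<Sum>k<n. entry y i k * entry z k j))) =
      (\<Sum>y\<in>supp f. \<Sum>z\<in>supp h. \<Sum>k<n. (const (f y) * entry y i k) * (const (h z) * entry z k j))"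
    by (simp add: sum_distrib_left mult_ac)
  also have "\<dots> = (\<Sum>y\<in>supp f. \<Sum>k<n. \<Sum>z\<in>supp h. (const (f y) * entry y i k) * (const (h z) * entry z k j))"
    by (intro sum.cong refl sum.swap)
  also have "\<dots> = (\<Sum>k<n. \<Sum>y\<in>supp f. \<Sum>z\<in>supp h. (const (f y) * entry y i k) * (const (h z) * entry z k j))"
    by (rule sum.swap)
  also have "\<dots> = (\<Sum>k<n. lin (\<lambda>x. entry x i k) f * lin (\<lambda>x. entry x k j) h)"
    by (simp add: lin_def sum_product)
  finally show ?thesis .
qed

lemma AG_delta:
  assumes "x \<in> carrier G"
  shows "(\<lambda>z. if z = x then \<one> else \<zero>) \<in> carrier AG"
    and "coset (lin V (\<lambda>z. if z = x then \<one> else \<zero>)) = coset (V x)"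
proof -
  let ?d = "\<lambda>z. if z = x then \<one> else \<zero>"
  have sub: "supp ?d \<subseteq> {x}" by (auto simp: coeff_support_def)
  then show "?d \<in> carrier AG" using assms by (auto simp: AG_carrier intro: finite_subset)
  show "coset (lin V ?d) = coset (V x)"
    using coset_lin_superset[OF _ sub, of V] coset_mult_cong[OF coset_const_one refl, of "V x"] by simp
qed

lemma linear_extension_\<rho>_hom: "\<rho>\<^sub>l \<in> algebra_hom A AG (mat_algebra n quot)"
proof -
  let ?M = "mat_algebra n quot"
  have cl: "\<rho>\<^sub>l f \<in> carrier ?M" if "f \<in> carrier AG" for f
    unfolding linear_extension_\<rho>[OF that] by (auto simp: mat_algebra_def)
  have mult: "\<rho>\<^sub>l (f \<otimes>\<^bsub>AG\<^esub> h) = \<rho>\<^sub>l f \<otimes>\<^bsub>?M\<^esub> \<rho>\<^sub>l h" if "f \<in> carrier AG" "h \<in> carrier AG" for f h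
    unfolding linear_extension_\<rho>[OF that(1)] linear_extension_\<rho>[OF that(2)]
      linear_extension_\<rho>[OF AG_mult_closed[OF that]] mat_entry_mult
    using coset_lin_entry_mult[OF that] by simp
  have add: "\<rho>\<^sub>l (f \<oplus>\<^bsub>AG\<^esub> h) = \<rho>\<^sub>l f \<oplus>\<^bsub>?M\<^esub> \<rho>\<^sub>l h" if "f \<in> carrier AG" "h \<in> carrier AG" for f h
    unfolding linear_extension_\<rho>[OF that(1)] linear_extension_\<rho>[OF that(2)]
      linear_extension_\<rho>[OF AG_add_closed[OF that]] coset_lin_add[OF that]
    by (auto simp: mat_algebra_def fun_eq_iff)
  have sm: "\<rho>\<^sub>l (a \<odot>\<^bsub>AG\<^esub> f) = a \<odot>\<^bsub>?M\<^esub> \<rho>\<^sub>l f" if "a \<in> carrier A" "f \<in> carrier AG" for a f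
    unfolding linear_extension_\<rho>[OF that(2)] linear_extension_\<rho>[OF AG_smult_closed[OF that]]
      coset_lin_smult[OF that]
    by (auto simp: mat_algebra_def fun_eq_iff)
  have AG1: "\<one>\<^bsub>AG\<^esub> = (\<lambda>z. if z = \<one>\<^bsub>G\<^esub> then \<one> else \<zero>)" by (simp add: group_algebra_def)
  have one: "\<rho>\<^sub>l \<one>\<^bsub>AG\<^esub> = \<one>\<^bsub>?M\<^esub>"
    unfolding AG1 linear_extension_\<rho>[OF AG_delta(1)[OF G.one_closed]] AG_delta(2)[OF G.one_closed] mat_one
    by (rule restrict_ext) (auto simp: coset_entry_one)
  show ?thesis
    unfolding algebra_hom_def ring_hom_def using cl mult add one sm by auto
qed

lemma trace_\<rho>:
  assumes "g \<in> carrier G" shows "structure_map quot (t g) = mat_trace n quot (\<rho> g)"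
proof -
  interpret Q: abelian_monoid quot by (rule quot_abelian_monoid)
  have "mat_trace n quot (\<rho> g) = (\<Oplus>\<^bsub>quot\<^esub>i\<in>{..<n}. coset (entry g i i))"
    unfolding mat_trace_def by (rule Q.finsum_cong') (auto simp: \<rho>_def)
  then show ?thesis
    using coset_entry_trace[OF assms] by (simp add: quot_finsum structure_map_def)
qed

abbreviation (input) t\<^sub>l :: "('g \<Rightarrow> 'a) \<Rightarrow> 'a" where
  "t\<^sub>l \<equiv> linear_extension A (regular_module A) t"

text \<open>Finite sums read only the additive structure, which \<open>regular_module A\<close>
  shares with \<open>A\<close>.\<close>

lemma linear_extension_t: "t\<^sub>l f = (\<Oplus>x\<in>supp f. f x \<otimes> t x)"
  by (simp add: linear_extension_def regular_module_def finsum_def finprod_def)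

lemma t_closed': "x \<in> supp f \<Longrightarrow> f \<in> carrier AG \<Longrightarrow> t x \<in> carrier A"
  using AG_D(2) t_closed by blast

lemma linear_extension_t_closed: "f \<in> carrier AG \<Longrightarrow> t\<^sub>l f \<in> carrier A"
  unfolding linear_extension_t by (rule finsum_closed) (auto simp: AG_D(1) t_closed')

lemma coset_const_linear_extension_t:
  assumes "f \<in> carrier AG"
  shows "coset (const (t\<^sub>l f)) = coset (lin (\<lambda>x. const (t x)) f)"
proof -
  have "coset (const (t\<^sub>l f)) = coset (\<Sum>x\<in>supp f. const (f x \<otimes> t x))"
    unfolding linear_extension_t
    by (rule coset_const_finsum) (use AG_D(1)[OF assms] t_closed'[OF _ assms] in simp)
  also have "\<dots> = coset (lin (\<lambda>x. const (t x)) f)"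
    unfolding lin_def
    by (intro coset_sum_cong coset_const_mult AG_D(1)[OF assms] t_closed'[OF _ assms])
  finally show ?thesis .
qed

section \<open>The kernel of the representation\<close>

lemma coset_const_zero_iff: "a \<in> carrier A \<Longrightarrow> coset (const a) = coset 0 \<longleftrightarrow> a = \<zero>"
  using coset_single_eq_iff[of "lift a" 0] by (simp add: const_def ev_lift ev_zero)

lemma kernel_subset:
  assumes f: "f \<in> carrier AG" and z: "\<rho>\<^sub>l f = \<zero>\<^bsub>mat_algebra n quot\<^esub>" and h: "h \<in> carrier AG"
  shows "t\<^sub>l (f \<otimes>\<^bsub>AG\<^esub> h) = \<zero>"
proof -
  let ?fh = "f \<otimes>\<^bsub>AG\<^esub> h"
  have fh: "?fh \<in> carrier AG" by (rule AG_mult_closed[OF f h])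
  have z': "coset (lin (\<lambda>x. entry x i j) f) = coset 0" if "i < n" "j < n" for i j
    using fun_cong[OF z[unfolded linear_extension_\<rho>[OF f]], of "(i, j)"] that
    by (simp add: mat_algebra_def)
  have "coset (const (t\<^sub>l ?fh)) = coset (\<Sum>x\<in>supp ?fh. const (?fh x) * const (t x))"
    unfolding coset_const_linear_extension_t[OF fh] lin_def ..
  also have "\<dots> = coset (\<Sum>x\<in>supp ?fh. const (?fh x) * (\<Sum>k<n. entry x k k))"
    using AG_D(2)[OF fh] by (intro coset_sum_cong coset_mult_left coset_entry_trace[symmetric]) auto
  also have "(\<Sum>x\<in>supp ?fh. const (?fh x) * (\<Sum>k<n. entry x k k)) = (\<Sum>k<n. lin (\<lambda>x. entry x k k) ?fh)"
    unfolding lin_def sum_distrib_left by (rule sum.swap)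
  also have "coset \<dots> = coset (\<Sum>k<n. \<Sum>l<n. lin (\<lambda>x. entry x k l) f * lin (\<lambda>x. entry x l k) h)"
    by (intro coset_sum_cong coset_lin_entry_mult f h)
  also have "\<dots> = coset (\<Sum>k<n. \<Sum>l<n. 0 * lin (\<lambda>x. entry x l k) h)"
    by (intro coset_sum_cong coset_mult_cong z' refl) auto
  \<comment> \<open>The trace vanishes in the quotient; injectivity of the structure map brings this
    back to the coefficient ring.\<close>
  finally show ?thesis using linear_extension_t_closed[OF fh] by (simp add: coset_const_zero_iff)
qed

lemma kernel_superset:
  assumes f: "f \<in> carrier AG" and z: "\<And>h. h \<in> carrier AG \<Longrightarrow> t\<^sub>l (f \<otimes>\<^bsub>AG\<^esub> h) = \<zero>"
  shows "\<rho>\<^sub>l f = \<zero>\<^bsub>mat_algebra n quot\<^esub>"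
proof -
  have "(\<Sum>u\<in>supp f. lift (f u) * trace_word ([u] @ v)) \<in> {p. ev p = \<zero>}" for v
  proof -
    let ?x = "word_prod v"
    \<comment> \<open>Testing \<open>f\<close> against the group element spelled by \<open>v\<close>
      gives the sum of the \<open>f u\<close> times the trace of \<open>u\<close> followed by
      \<open>v\<close>, which is the hypothesis of \<open>functional_linear\<close>.\<close>
    let ?d = "\<lambda>z. if z = ?x then \<one> else \<zero>"
    have d: "?d \<in> carrier AG" by (rule AG_delta) simp
    have "coset 0 = coset (const (t\<^sub>l (f \<otimes>\<^bsub>AG\<^esub> ?d)))"
      using z[OF d] coset_const_zero by simp
    also have "\<dots> = coset (\<Sum>y\<in>supp f. const (f y) * lin (\<lambda>z. const (t (y \<otimes>\<^bsub>G\<^esub> z))) ?d)"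
      unfolding coset_const_linear_extension_t[OF AG_mult_closed[OF f d]] by (rule coset_lin_mult[OF f d])
    also have "\<dots> = coset (\<Sum>y\<in>supp f. const (f y) * const (t (y \<otimes>\<^bsub>G\<^esub> ?x)))"
      by (intro coset_sum_cong coset_mult_left AG_delta) simp
    also have "(\<Sum>y\<in>supp f. const (f y) * const (t (y \<otimes>\<^bsub>G\<^esub> ?x))) =
        Poly_Mapping.single 0 (\<Sum>u\<in>supp f. lift (f u) * trace_word ([u] @ v))"
    proof -
      have "const (f y) * const (t (y \<otimes>\<^bsub>G\<^esub> ?x)) = Poly_Mapping.single 0 (lift (f y) * trace_word ([y] @ v))"
        if "y \<in> supp f" for y
        using that AG_D(2)[OF f] by (simp add: const_def mult_single trace_word_def word_prod_Cons subset_iff)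
      then have "(\<Sum>y\<in>supp f. const (f y) * const (t (y \<otimes>\<^bsub>G\<^esub> ?x))) =
        (\<Sum>u\<in>supp f. Poly_Mapping.single 0 (lift (f u) * trace_word ([u] @ v)))"
        by (intro sum.cong refl) simp
      moreover have "(\<Sum>u\<in>S. Poly_Mapping.single 0 (g u)) = Poly_Mapping.single 0 (sum g S)" for S and g :: "'g \<Rightarrow> 'a multiset \<Rightarrow>\<^sub>0 rat"
        by (induction S rule: infinite_finite_induct) (simp_all add: single_add)
      ultimately show ?thesis by simp
    qed
    finally show ?thesis by (rule relations_const_iff[THEN iffD1, OF coset_zero_iff[THEN iffD1, OF sym]])
  qed
  then have "(\<Sum>u\<in>supp f. Poly_Mapping.single 0 (lift (f u)) * entry u i j) \<in> relations" for i j
    by (rule functional_linear)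
  then have "coset (lin (\<lambda>x. entry x i j) f) = coset 0" for i j
    by (simp only: coset_zero_iff lin_def const_def)
  then show ?thesis
    unfolding linear_extension_\<rho>[OF f] by (simp add: mat_algebra_def)
qed

lemma kernel_eq: "a_kernel AG (mat_algebra n quot) \<rho>\<^sub>l = trace_form_kernel A G t"
  using kernel_subset kernel_superset unfolding a_kernel_def' trace_form_kernel_def by blast

end

theorem theorem6p1p5:
  fixes A :: "('a, 'm) ring_scheme" and G :: "('g, 'k) monoid_scheme"
    and t :: "'g \<Rightarrow> 'a" and n :: nat
  assumes "cring A" and "contains_rat A" and "group G" and "pseudocharacter A G n t"
  shows "\<exists>(B :: ('a, ('a, 'g) poly_quot) module) \<rho>.
           algebra A B \<and>
           \<rho> \<in> hom G (GL n B) \<and>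
           linear_extension A (mat_algebra n B) \<rho>
             \<in> algebra_hom A (group_algebra A G) (mat_algebra n B) \<and>
           (\<forall>g\<in>carrier G. structure_map B (t g) = mat_trace n B (\<rho> g)) \<and>
           a_kernel (group_algebra A G) (mat_algebra n B) (linear_extension A (mat_algebra n B) \<rho>)
             = trace_form_kernel A G t"
proof -
  obtain \<phi> where \<phi>: "\<phi> \<in> ring_hom rat_ring A" using assms(2) by (auto simp: contains_rat_def)
  interpret rat_pseudocharacter A \<phi> G t n
    using assms \<phi> by (intro rat_pseudocharacter.intro rat_cring.intro rat_cring_axioms.intro
        rat_pseudocharacter_axioms.intro)
  show ?thesis
    using quot_algebra \<rho>_hom linear_extension_\<rho>_hom trace_\<rho> kernel_eq
    by (intro exI[of _ quot] exI[of _ \<rho>] conjI ballI)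
qed

end
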